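(* Let $m\ge1$ be an integer and let $X_t=f((\varepsilon_{t-u})_{u\in\mathbb{Z}})$, $t\in\mathbb{Z}$, where $f\colon\mathbb{R}^{\mathbb{Z}}\to\mathbb{R}$ is measurable and $(\varepsilon_u)_{u\in\mathbb{Z}}$ is an i.i.d. sequence of real random variables. Let $h\colon\mathbb{R}^2\to\mathbb{R}$ be symmetric, let $g\colon\mathbb{R}^m\to\mathbb{R}$ be measurable, and let $(b_n)_{n\ge1}$, $(\ell_n)_{n\ge1}$ be sequences of positive integers. With $W_{n,j}$, $U_n$ and $\delta_i$ defined in the context, assume: (1) $h$ is Lipschitz-continuous. (2) $\mathbb{E}[X_1^{2m}]<\infty$ and $\sum_{i\in\mathbb{Z}}\sum_{k=1}^m i^2\,\delta_i\big((X_t^k)_{t\in\mathbb{Z}}\big)<\infty$. (3) $g(v_0)=0$, where $v_0=(\mathbb{E}[X_1^k])_{k=1}^m\in\mathbb{R}^m$, and there exists $a>0$ such that $g$ is differentiable at each point of $\prod_{k=1}^m(\mathbb{E}[X_1^k]-2a,\mathbb{E}[X_1^k]+2a)$ and the gradient of $g$ is bounded on this set. (4) $b_n\to\infty$, $\ell_n\to\infty$ and $b_n/\ell_n\to0$ as $n\to\infty$. Let $\eta\colon\mathbb{R}^m\to[0,1]$ be a smooth function with $\eta(x)=1$ if $\|x-v_0\|_2\le a$ and $\eta(x)=0$ if $\|x-v_0\|_2>2a$, and define $$W^{(\eta)}_{n,j}:=\sqrt{\ell_n}\,(g\cdot\eta)\Big(\Big(\frac1{\ell_n}\sum_{t\in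 B_{n,j}}X_t^k\Big)_{k=1}^m\Big).$$ If $$\sigma^2:=\sum_{t\in\mathbb{Z}}\operatorname{Cov}\Big(\sum_{k=1}^m\frac{\partial g}{\partial x_k}(v_0)X_0^k,\ \sum_{k=1}^m\frac{\partial g}{\partial x_k}(v_0)X_t^k\Big)>0,$$ then, as $n\to\infty$, $$\sqrt{b_n}\Big(U_n-\frac1{b_n(b_n-1)}\sum_{1\le j\ne k\le b_n}\mathbb{E}\big[h(W^{(\eta)}_{n,j},W^{(\eta)}_{n,k})\big]\Big)\to N(0,4\gamma^2)$$ in distribution, where $$\gamma^2:=\operatorname{Cov}\big(h(\sigma N,\sigma N'),\,h(\sigma N',\sigma N'')\big)$$ for independent standard normal random variables $N,N',N''$.
   Context: Blocks: $B_{n,j}:=\{(j-1)\ell_n+1,\dots,j\ell_n\}$ for $1\le j\le b_n$. Block statistics: $W_{n,j}:=\sqrt{\ell_n}\,g\big(\frac1{\ell_n}\sum_{t\in B_{n,j}}X_t,\frac1{\ell_n}\sum_{t\in B_{n,j}}X_t^2,\dots,\frac1{\ell_n}\sum_{t\in B_{n,j}}X_t^m\big)$. U-statistic: $U_n:=\frac1{b_n(b_n-1)}\sum_{1\le j\ne k\le b_n}h(W_{n,j},W_{n,k})$. Dependence coefficients: for a process $Y_t=F((\varepsilon_{t-u})_{u\in\mathbb{Z}})$ with $F\colon\mathbb{R}^{\mathbb{Z}}\to\mathbb{R}$ measurable (e.g. $Y_t=X_t^k$, with $F=f^k$), let $(\varepsilon'_u)_{u\in\mathbb{Z}}$ be an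 independent copy of $(\varepsilon_u)_{u\in\mathbb{Z}}$, put $\varepsilon^{*,i}_v=\varepsilon'_i$ if $v=i$ and $\varepsilon^{*,i}_v=\varepsilon_v$ otherwise, let $Y_0^{*,i}=F((\varepsilon^{*,i}_{-u})_{u\in\mathbb{Z}})$, and define $\delta_i((Y_t)_{t\in\mathbb{Z}}):=\|Y_0-Y_0^{*,i}\|_2$, where $\|Y\|_2=(\mathbb{E}[Y^2])^{1/2}$. $N(0,v)$ is the centred normal law with variance $v$, and $\sigma$ is the positive square root of $\sigma^2$. *)

theory Defs
  imports "HOL-Probability.Probability"
begin

definition covariance :: "'w measure \<Rightarrow> ('w \<Rightarrow> real) \<Rightarrow> ('w \<Rightarrow> real) \<Rightarrow> real" where
  "covariance M X Y =
     (\<integral>w. (X w - (\<integral>z. X z \<partial>M)) * (Y w - (\<integral>z. Y z \<partial>M)) \<partial>M)"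

text \<open>The centred normal law with variance \<open>v\<close>; for \<open>v = 0\<close> it has no density and is
  the point mass at 0.\<close>

definition centred_normal :: "real \<Rightarrow> real measure" where
  "centred_normal v =
     (if v = 0 then return borel 0 else density lborel (\<lambda>x. ennreal (normal_density 0 (sqrt v) x)))"

definition iid_real :: "'w measure \<Rightarrow> (int \<Rightarrow> 'w \<Rightarrow> real) \<Rightarrow> bool" where
  "iid_real M eps \<longleftrightarrow>
     prob_space.indep_vars M (\<lambda>_. borel) eps UNIV \<and>
     (\<forall>u. distr M borel (eps u) = distr M borel (eps 0))"

definition bernoulli_shift ::
    "((int \<Rightarrow> real) \<Rightarrow> real) \<Rightarrow> (int \<Rightarrow> 'w \<Rightarrow> real) \<Rightarrow> int \<Rightarrow> 'w \<Rightarrow> real" where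
  "bernoulli_shift F eps t w = F (\<lambda>u. eps (t - u) w)"

text \<open>The dependence coefficient \<open>\<delta>\<^sub>i\<close> of \<open>bernoulli_shift F eps\<close>. The independent copy of
  \<open>eps\<close> is realised on the product space: \<open>eps\<close> is read off the first component and the copy
  off the second. As a Bochner integral this is the \<open>L\<^sup>2\<close> norm only for square-integrable
  \<open>bernoulli_shift F eps 0\<close>.\<close>

definition dep_coeff ::
    "'w measure \<Rightarrow> ((int \<Rightarrow> real) \<Rightarrow> real) \<Rightarrow> (int \<Rightarrow> 'w \<Rightarrow> real) \<Rightarrow> int \<Rightarrow> real" where
  "dep_coeff M F eps i =
     (let eps_star = (\<lambda>v (w, w'). if v = i then eps i w' else eps v w)
      in sqrt (\<integral>p. (bernoulli_shift F eps 0 (fst p) - bernoulli_shift F eps_star 0 p)\<^sup>2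
                 \<partial>(M \<Otimes>\<^sub>M M)))"

definition partial_deriv :: "'m::finite \<Rightarrow> (real^'m \<Rightarrow> real) \<Rightarrow> real^'m \<Rightarrow> real" where
  "partial_deriv k g x = deriv (\<lambda>s. g (x + s *\<^sub>R axis k 1)) 0"

definition gradient :: "(real^'m::finite \<Rightarrow> real) \<Rightarrow> real^'m \<Rightarrow> real^'m" where
  "gradient g x = (\<chi> k. partial_deriv k g x)"

text \<open>All iterated partial derivatives (the empty list gives \<open>f\<close> itself) are totally
  differentiable, hence continuous: this is \<open>C\<^sup>\<infinity>\<close> on the whole space.\<close>

definition smooth :: "(real^'m::finite \<Rightarrow> real) \<Rightarrow> bool" where
  "smooth f \<longleftrightarrow> (\<forall>ks x. foldr partial_deriv ks f differentiable (at x))"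

definition block :: "nat \<Rightarrow> nat \<Rightarrow> int set" where
  "block l j = {(int j - 1) * int l + 1 .. int j * int l}"

text \<open>The coordinates of the \<open>m\<close>-dimensional space are indexed by a finite type; \<open>idx k\<close> is the
  number in \<open>{1..m}\<close> of the coordinate \<open>k\<close>, i.e. the order of the moment placed there.\<close>

definition block_moments ::
    "('m::finite \<Rightarrow> nat) \<Rightarrow> (int \<Rightarrow> 'w \<Rightarrow> real) \<Rightarrow> nat \<Rightarrow> nat \<Rightarrow> 'w \<Rightarrow> real^'m" where
  "block_moments idx X l j w = (\<chi> k. (1 / real l) * (\<Sum>t\<in>block l j. X t w ^ idx k))"

definition block_stat ::
    "(real^'m::finite \<Rightarrow> real) \<Rightarrow> ('m \<Rightarrow> nat) \<Rightarrow> (int \<Rightarrow> 'w \<Rightarrow> real) \<Rightarrow> nat \<Rightarrow> nat \<Rightarrow> 'w \<Rightarrow> real" where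
  "block_stat g idx X l j w = sqrt (real l) * g (block_moments idx X l j w)"

definition off_diag_mean :: "nat \<Rightarrow> (nat \<Rightarrow> nat \<Rightarrow> real) \<Rightarrow> real" where
  "off_diag_mean b c =
     1 / (real b * (real b - 1)) * (\<Sum>(j, k) \<in> {(j, k). j \<in> {1..b} \<and> k \<in> {1..b} \<and> j \<noteq> k}. c j k)"

definition long_run_var ::
    "'w measure \<Rightarrow> (real^'m::finite \<Rightarrow> real) \<Rightarrow> real^'m \<Rightarrow> ('m \<Rightarrow> nat) \<Rightarrow> (int \<Rightarrow> 'w \<Rightarrow> real) \<Rightarrow> real" where
  "long_run_var M g v0 idx X =
     (\<Sum>\<^sub>\<infinity>t\<in>UNIV. covariance M
        (\<lambda>w. \<Sum>k\<in>UNIV. partial_deriv k g v0 * X 0 w ^ idx k)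
        (\<lambda>w. \<Sum>k\<in>UNIV. partial_deriv k g v0 * X t w ^ idx k))"

text \<open>\<open>\<gamma>\<^sup>2\<close>; the independent standard normal variables \<open>N, N', N''\<close> are the coordinates of the
  product space.\<close>

definition gamma_sq :: "(real \<times> real \<Rightarrow> real) \<Rightarrow> real \<Rightarrow> real" where
  "gamma_sq h \<sigma> =
     covariance (std_normal_distribution \<Otimes>\<^sub>M (std_normal_distribution \<Otimes>\<^sub>M std_normal_distribution))
       (\<lambda>(x, y, z). h (\<sigma> * x, \<sigma> * y))
       (\<lambda>(x, y, z). h (\<sigma> * y, \<sigma> * z))"

end

theory Submission
  imports Defs
begin

text \<open>Transported to the product space of the noise, every block statistic is compared with the same
  statistic in which each \<open>X\<^sub>t\<^sup>k\<close> is replaced by its average over the noise outside the block. The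
  moment condition makes the total error of a block sum bounded, so a block statistic moves by
  \<open>O(1 / \<surd>\<ell>\<^sub>n)\<close> and, since \<open>b\<^sub>n / \<ell>\<^sub>n \<rightarrow> 0\<close>, the normalised U-statistic moves by \<open>o(1)\<close> in
  \<open>L\<^sup>1\<close>. The new block statistics are independent and identically distributed, and the Hoeffding
  decomposition reduces their U-statistic to a triangular array with i.i.d. rows. Its Lindeberg
  condition is uniform integrability of the squared block statistics, which follows by splitting
  the summands into a bounded finite-range part, whose sums have bounded fourth moments, and an
  \<open>L\<^sup>2\<close>-small part. The central limit theorem for a single block is obtained by the same
  device: a block of length \<open>\<ell>\<close> is cut into \<open>p \<approx> \<ell>\<^sup>1\<^sup>/\<^sup>4\<close> sub-blocks, which become independent
  at a cost of \<open>O(p / \<surd>\<ell>)\<close>. The cutoff \<open>\<eta>\<close> is harmless because, by Chebyshev's inequality,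
  some block mean leaves the ball of radius \<open>a\<close> with probability \<open>O(b\<^sub>n / \<ell>\<^sub>n)\<close>.\<close>

section \<open>The space of square-integrable functions\<close>

text \<open>Each X_t may depend on noise in both directions, so no filtration fits and independence
  is manufactured: \<open>CE A F\<close> integrates out the noise outside \<open>A\<close>, and
  functions living on disjoint index sets are exactly independent. The weight i^2 in the moment
  condition makes this affordable. Averaging out noise at distance more than r costs at most D / (r
  + 1)^2, and summing this over the distances to the two ends of a block gives a convergent series
  whatever the block length.

  Convergence is followed through characteristic functions. They tolerate L1-small changes and
  changes on rare events, and treat the degenerate limit \<gamma> = 0 like any other. The linear
  Hoeffding term is itself built from the law of a block statistic, which varies with the block
  length; the limit of its variance therefore needs more than weak convergence, namely a Skorohod
  coupling made L2-convergent by uniform integrability. Positivity of \<sigma>^2 also yields the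
  summability of the covariances, because the infinite sum of a non-summable family is 0 by
  convention.\<close>

definition L2 :: "'a measure \<Rightarrow> ('a \<Rightarrow> real) \<Rightarrow> bool" where
  "L2 M f \<longleftrightarrow> f \<in> borel_measurable M \<and> integrable M (\<lambda>x. (f x)\<^sup>2)"

definition nrm :: "'a measure \<Rightarrow> ('a \<Rightarrow> real) \<Rightarrow> real" where
  "nrm M f = sqrt (\<integral>x. (f x)\<^sup>2 \<partial>M)"

lemma L2_measurable: "L2 M f \<Longrightarrow> f \<in> borel_measurable M"
  by (simp add: L2_def)

lemma L2_sq_integrable: "L2 M f \<Longrightarrow> integrable M (\<lambda>x. (f x)\<^sup>2)"
  by (simp add: L2_def)

lemma nrm_nonneg [simp]: "0 \<le> nrm M f"
  by (simp add: nrm_def)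

lemma nrm_sq: "(nrm M f)\<^sup>2 = (\<integral>x. (f x)\<^sup>2 \<partial>M)"
  by (simp add: nrm_def)

lemma nrm_cong_AE:
  assumes "AE x in M. f x = g x" "f \<in> borel_measurable M" "g \<in> borel_measurable M"
  shows "nrm M f = nrm M g"
proof -
  have "(\<integral>x. (f x)\<^sup>2 \<partial>M) = (\<integral>x. (g x)\<^sup>2 \<partial>M)"
    by (rule integral_cong_AE) (use assms in auto)
  then show ?thesis by (simp add: nrm_def)
qed

lemma L2_bound:
  assumes "L2 M g" "f \<in> borel_measurable M" "AE x in M. \<bar>f x\<bar> \<le> \<bar>g x\<bar>"
  shows "L2 M f" and "nrm M f \<le> nrm M g"
proof -
  have *: "AE x in M. (f x)\<^sup>2 \<le> (g x)\<^sup>2"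
    using assms(3) by eventually_elim (simp add: abs_le_square_iff)
  have "integrable M (\<lambda>x. (f x)\<^sup>2)"
    by (rule Bochner_Integration.integrable_bound[OF L2_sq_integrable[OF assms(1)]]) (use assms * in auto)
  then show f: "L2 M f"
    using assms by (simp add: L2_def)
  show "nrm M f \<le> nrm M g"
    unfolding nrm_def
    by (intro real_sqrt_le_mono integral_mono_AE L2_sq_integrable f assms *)
qed

lemma L2_cmult: "L2 M f \<Longrightarrow> L2 M (\<lambda>x. c * f x)"
  by (auto simp: L2_def power_mult_distrib)

lemma nrm_cmult: "nrm M (\<lambda>x. c * f x) = \<bar>c\<bar> * nrm M f"
  by (simp add: nrm_def power_mult_distrib real_sqrt_mult)

lemma L2_minus: "L2 M f \<Longrightarrow> L2 M (\<lambda>x. - f x)"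
  by (auto simp: L2_def)

lemma nrm_minus: "nrm M (\<lambda>x. - f x) = nrm M f"
  by (simp add: nrm_def)

lemma L2_abs: "L2 M f \<Longrightarrow> L2 M (\<lambda>x. \<bar>f x\<bar>)"
  by (auto simp: L2_def)

lemma nrm_abs: "nrm M (\<lambda>x. \<bar>f x\<bar>) = nrm M f"
  by (simp add: nrm_def)

lemma nrm_commute: "nrm M (\<lambda>x. f x - g x) = nrm M (\<lambda>x. g x - f x)"
  by (simp add: nrm_def power2_commute)

lemma L2_mult_integrable:
  assumes "L2 M f" "L2 M g"
  shows "integrable M (\<lambda>x. f x * g x)"
proof (rule Bochner_Integration.integrable_bound)
  show "integrable M (\<lambda>x. (f x)\<^sup>2 + (g x)\<^sup>2)"
    using assms by (auto simp: L2_def)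
  show "(\<lambda>x. f x * g x) \<in> borel_measurable M"
    using assms by (auto simp: L2_def)
  show "AE x in M. norm (f x * g x) \<le> norm ((f x)\<^sup>2 + (g x)\<^sup>2)"
  proof (rule AE_I2)
    fix x
    have "2 * \<bar>f x\<bar> * \<bar>g x\<bar> \<le> (f x)\<^sup>2 + (g x)\<^sup>2"
      using sum_squares_bound[of "\<bar>f x\<bar>" "\<bar>g x\<bar>"] by simp
    moreover have "0 \<le> \<bar>f x\<bar> * \<bar>g x\<bar>" by simp
    ultimately show "norm (f x * g x) \<le> norm ((f x)\<^sup>2 + (g x)\<^sup>2)"
      unfolding real_norm_def abs_mult by linarith
  qed
qed

lemma L2_add:
  assumes "L2 M f" "L2 M g"
  shows "L2 M (\<lambda>x. f x + g x)"
proof -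
  have "integrable M (\<lambda>x. (f x)\<^sup>2 + (g x)\<^sup>2 + 2 * (f x * g x))"
    using assms L2_mult_integrable[OF assms] by (auto simp: L2_def)
  then show ?thesis
    using assms by (auto simp: L2_def power2_sum mult.assoc)
qed

lemma L2_diff: "L2 M f \<Longrightarrow> L2 M g \<Longrightarrow> L2 M (\<lambda>x. f x - g x)"
  using L2_add[OF _ L2_minus] by fastforce

lemma L2_sum: "(\<And>i. i \<in> I \<Longrightarrow> L2 M (f i)) \<Longrightarrow> L2 M (\<lambda>x. \<Sum>i\<in>I. f i x)"
proof (induction I rule: infinite_finite_induct)
  case (insert i I)
  then show ?case
    by (simp add: L2_add)
qed (simp_all add: L2_def)

lemma cauchy_schwarz_integral:
  assumes f: "L2 M f" and g: "L2 M g"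
  shows "\<bar>\<integral>x. f x * g x \<partial>M\<bar> \<le> nrm M f * nrm M g"
proof -
  define A where "A = (\<integral>x. (f x)\<^sup>2 \<partial>M)"
  define B where "B = (\<integral>x. f x * g x \<partial>M)"
  define C where "C = (\<integral>x. (g x)\<^sup>2 \<partial>M)"
  have A0: "A \<ge> 0" and C0: "C \<ge> 0" by (auto simp: A_def C_def)
  \<comment> \<open>The square of \<open>s * f + g\<close> integrates to a quadratic polynomial in
    \<open>s\<close>; its nonnegativity for every \<open>s\<close> bounds the discriminant.\<close>
  have pos: "0 \<le> s\<^sup>2 * A + 2 * s * B + C" for s
  proof -
    have "0 \<le> (\<integral>x. (s * f x + g x)\<^sup>2 \<partial>M)" by simp
    also have "\<dots> = (\<integral>x. s\<^sup>2 * (f x)\<^sup>2 + 2 * s * (f x * g x) + (g x)\<^sup>2 \<partial>M)"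
      by (intro Bochner_Integration.integral_cong) (auto simp: power2_eq_square algebra_simps)
    also have "\<dots> = s\<^sup>2 * A + 2 * s * B + C"
      unfolding A_def B_def C_def using f g L2_mult_integrable[OF f g]
      by (simp add: L2_def)
    finally show ?thesis .
  qed
  have "B\<^sup>2 \<le> A * C"
  proof (cases "A = 0")
    case True
    have "B = 0"
    proof (rule ccontr)
      assume "B \<noteq> 0"
      \<comment> \<open>With A = 0 the polynomial is affine in \<open>s\<close>, and this
        \<open>s\<close> would give it the value -1.\<close>
      with pos[of "- (C + 1) / (2 * B)"] True C0 show False
        by (simp add: field_simps)
    qed
    with True show ?thesis by simp
  next
    case False
    with A0 have "A > 0" by simp
    \<comment> \<open>The minimiser of the quadratic polynomial.\<close>
    with pos[of "- B / A"] show ?thesis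
      by (simp add: field_simps power2_eq_square)
  qed
  then have "sqrt (B\<^sup>2) \<le> sqrt (A * C)" by (rule real_sqrt_le_mono)
  then show ?thesis
    by (simp add: nrm_def A_def B_def C_def real_sqrt_mult)
qed

lemma nrm_triangle:
  assumes f: "L2 M f" and g: "L2 M g"
  shows "nrm M (\<lambda>x. f x + g x) \<le> nrm M f + nrm M g"
proof (rule power2_le_imp_le)
  have "(nrm M (\<lambda>x. f x + g x))\<^sup>2 = (\<integral>x. (f x)\<^sup>2 + (g x)\<^sup>2 + 2 * (f x * g x) \<partial>M)"
    unfolding nrm_sq by (intro Bochner_Integration.integral_cong) (auto simp: power2_eq_square algebra_simps)
  also have "\<dots> = (nrm M f)\<^sup>2 + (nrm M g)\<^sup>2 + 2 * (\<integral>x. f x * g x \<partial>M)"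
    unfolding nrm_sq using f g L2_mult_integrable[OF f g] by (simp add: L2_def)
  also have "\<dots> \<le> (nrm M f)\<^sup>2 + (nrm M g)\<^sup>2 + 2 * (nrm M f * nrm M g)"
    using cauchy_schwarz_integral[OF f g] by simp
  finally show "(nrm M (\<lambda>x. f x + g x))\<^sup>2 \<le> (nrm M f + nrm M g)\<^sup>2"
    by (simp add: power2_sum)
qed simp

lemma nrm_triangle_diff:
  assumes "L2 M f" "L2 M g"
  shows "nrm M (\<lambda>x. f x - g x) \<le> nrm M f + nrm M g"
  using nrm_triangle[OF assms(1) L2_minus[OF assms(2)]] by (simp add: nrm_minus)

lemma nrm_triangle3:
  assumes "L2 M f" "L2 M g" "L2 M k"
  shows "nrm M (\<lambda>x. f x - k x) \<le> nrm M (\<lambda>x. f x - g x) + nrm M (\<lambda>x. g x - k x)"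
  using nrm_triangle[OF L2_diff[OF assms(1,2)] L2_diff[OF assms(2,3)]] by simp

lemma nrm_sum:
  assumes "\<And>i. i \<in> I \<Longrightarrow> L2 M (f i)"
  shows "nrm M (\<lambda>x. \<Sum>i\<in>I. f i x) \<le> (\<Sum>i\<in>I. nrm M (f i))"
  using assms
proof (induction I rule: infinite_finite_induct)
  case (insert i I)
  have "nrm M (\<lambda>x. f i x + (\<Sum>i\<in>I. f i x)) \<le> nrm M (f i) + nrm M (\<lambda>x. \<Sum>i\<in>I. f i x)"
    using insert by (intro nrm_triangle L2_sum) auto
  with insert show ?case by simp
qed (simp_all add: nrm_def)

lemma L2_distr:
  assumes T: "T \<in> measurable M N" and f: "f \<in> borel_measurable N"
  shows "L2 (distr M N T) f \<longleftrightarrow> L2 M (\<lambda>x. f (T x))"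
  using measurable_compose[OF T f] f integrable_distr_eq[OF T, of "\<lambda>x. (f x)\<^sup>2"] by (simp add: L2_def)

lemma nrm_distr:
  assumes T: "T \<in> measurable M N" and f: "f \<in> borel_measurable N"
  shows "nrm (distr M N T) f = nrm M (\<lambda>x. f (T x))"
  using f integral_distr[OF T, of "\<lambda>x. (f x)\<^sup>2"] by (simp add: nrm_def)

context prob_space
begin

lemma L2_const: "L2 M (\<lambda>x. c)"
  by (simp add: L2_def)

lemma nrm_const: "nrm M (\<lambda>x. c) = \<bar>c\<bar>"
  by (simp add: nrm_def prob_space)

lemma L2_bounded:
  assumes "f \<in> borel_measurable M" "\<And>x. x \<in> space M \<Longrightarrow> \<bar>f x\<bar> \<le> c"
  shows "L2 M f"
  by (rule L2_bound(1)[OF L2_const[of c]]) (use assms in \<open>auto intro!: AE_I2 order_trans[OF _ abs_ge_self]\<close>)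

lemma L2_integrable: "L2 M f \<Longrightarrow> integrable M f"
  using L2_mult_integrable[OF _ L2_const[of 1]] by simp

lemma abs_integral_le_nrm:
  assumes "L2 M f" shows "\<bar>\<integral>x. f x \<partial>M\<bar> \<le> nrm M f"
  using cauchy_schwarz_integral[OF assms L2_const[of 1]] by (simp add: nrm_const)

lemma integral_abs_le_nrm:
  assumes "L2 M f" shows "(\<integral>x. \<bar>f x\<bar> \<partial>M) \<le> nrm M f"
  using abs_integral_le_nrm[OF L2_abs[OF assms]] by (simp add: nrm_abs)

lemma sq_integral_le: "L2 M f \<Longrightarrow> (\<integral>x. f x \<partial>M)\<^sup>2 \<le> (\<integral>x. (f x)\<^sup>2 \<partial>M)"
  using power_mono[OF abs_integral_le_nrm, of f 2] by (simp add: nrm_sq)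

lemma integral_sq_centred:
  assumes "L2 M f"
  shows "(\<integral>x. (f x - (\<integral>y. f y \<partial>M))\<^sup>2 \<partial>M) = (\<integral>x. (f x)\<^sup>2 \<partial>M) - (\<integral>y. f y \<partial>M)\<^sup>2"
proof -
  define c where "c = (\<integral>y. f y \<partial>M)"
  have "(\<integral>x. (f x - c)\<^sup>2 \<partial>M) = (\<integral>x. (f x)\<^sup>2 - 2 * c * f x + c\<^sup>2 \<partial>M)"
    by (intro Bochner_Integration.integral_cong) (auto simp: power2_eq_square algebra_simps)
  also have "\<dots> = (\<integral>x. (f x)\<^sup>2 \<partial>M) - 2 * c * c + c\<^sup>2"
    using assms L2_integrable[OF assms] by (simp add: L2_def prob_space c_def)
  finally show ?thesis by (simp add: c_def power2_eq_square)
qed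

text \<open>Subtracting the mean is an orthogonal projection in L2; recentring an approximation
  error is therefore free.\<close>

lemma nrm_centred_le:
  assumes "L2 M f"
  shows "nrm M (\<lambda>x. f x - (\<integral>y. f y \<partial>M)) \<le> nrm M f"
  unfolding nrm_def integral_sq_centred[OF assms] by simp

end

section \<open>The product space of the noise\<close>

text \<open>A pointwise substitute for measurability with respect to the sigma-algebra generated by
  the coordinates in \<open>A\<close>. It involves no null sets, and \<open>indep_depends\<close>
  turns it into independence.\<close>

definition depends :: "'i set \<Rightarrow> (('i \<Rightarrow> 'a) \<Rightarrow> 'b) \<Rightarrow> bool" where
  "depends A F \<longleftrightarrow> (\<forall>x y. (\<forall>u\<in>A. x u = y u) \<longrightarrow> F x = F y)"

definition mix :: "'i set \<Rightarrow> ('i \<Rightarrow> 'a) \<Rightarrow> ('i \<Rightarrow> 'a) \<Rightarrow> 'i \<Rightarrow> 'a" where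
  "mix A x y = (\<lambda>u. if u \<in> A then x u else y u)"

definition shift :: "int \<Rightarrow> (int \<Rightarrow> 'a) \<Rightarrow> int \<Rightarrow> 'a" where
  "shift t x = (\<lambda>u. x (u + t))"

lemma mix_mix: "mix B (mix A x y) z = mix (A \<inter> B) x (mix B y z)"
  by (auto simp: mix_def fun_eq_iff)

lemma shift_mix: "shift t (mix A x y) = mix {u. u + t \<in> A} (shift t x) (shift t y)"
  by (auto simp: mix_def shift_def fun_eq_iff)

locale noise =
  fixes \<mu> :: "real measure"
  assumes prob_mu: "prob_space \<mu>" and sets_mu: "sets \<mu> = sets borel"
begin

definition P :: "(int \<Rightarrow> real) measure" where
  "P = PiM UNIV (\<lambda>_. \<mu>)"

lemma space_mu: "space \<mu> = UNIV"
  using sets_eq_imp_space_eq[OF sets_mu] by simp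

lemma space_P [simp]: "space P = UNIV"
  by (simp add: P_def space_PiM space_mu)

lemma sets_P: "sets P = sets (PiM UNIV (\<lambda>_. borel))"
  unfolding P_def by (rule sets_PiM_cong) (simp_all add: sets_mu)

sublocale P: prob_space P
  unfolding P_def by (intro prob_space_PiM prob_mu)

lemma prob_UNIV: "measure P UNIV = 1"
  using P.prob_space by simp

sublocale PP: pair_prob_space P P ..

lemma measurable_into_P:
  assumes "\<And>u. (\<lambda>z. f z u) \<in> borel_measurable N"
  shows "f \<in> measurable N P"
proof -
  have "f \<in> measurable N (PiM UNIV (\<lambda>_. borel))"
    by (rule measurable_PiM_single') (use assms in auto)
  then show ?thesis
    using measurable_cong_sets[OF refl sets_P] by blast
qed

lemma measurable_coord [measurable]: "(\<lambda>x. x u) \<in> borel_measurable P"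
proof -
  have "(\<lambda>x. x u) \<in> borel_measurable (PiM UNIV (\<lambda>_. borel))"
    by (rule measurable_component_singleton) simp
  then show ?thesis
    using measurable_cong_sets[OF sets_P refl] by blast
qed

lemma measurable_mix [measurable]:
  assumes [measurable]: "f \<in> measurable N P" "g \<in> measurable N P"
  shows "(\<lambda>z. mix A (f z) (g z)) \<in> measurable N P"
proof (rule measurable_into_P)
  fix u show "(\<lambda>z. mix A (f z) (g z) u) \<in> borel_measurable N"
    unfolding mix_def by (cases "u \<in> A") simp_all
qed

lemma measurable_shift [measurable]: "shift t \<in> measurable P P"
  by (rule measurable_into_P) (simp add: shift_def)

section \<open>Cylinder sets and the invariance of the noise law under mixing and shifting\<close>

lemma emeasure_cylinder:
  assumes "finite J" "\<And>j. j \<in> J \<Longrightarrow> F j \<in> sets \<mu>"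
  shows "emeasure P {x. \<forall>j\<in>J. x j \<in> F j} = (\<Prod>j\<in>J. emeasure \<mu> (F j))"
proof -
  interpret pr: product_prob_space "\<lambda>_. \<mu>" UNIV
    by (intro product_prob_spaceI prob_mu)
  show ?thesis
    using pr.emeasure_PiM_Collect[of J F] assms by (simp add: P_def[symmetric])
qed

lemma sets_cylinder:
  assumes "finite J" "\<And>j. j \<in> J \<Longrightarrow> F j \<in> sets \<mu>"
  shows "{x. \<forall>j\<in>J. x j \<in> F j} \<in> sets P"
proof -
  have "{x \<in> space P. \<forall>j\<in>J. x j \<in> F j} \<in> sets P"
  proof (rule sets.sets_Collect_finite_All[OF _ assms(1)])
    fix j assume "j \<in> J"
    then have [measurable]: "F j \<in> sets borel"
      using assms(2) sets_mu by simp
    show "{x \<in> space P. x j \<in> F j} \<in> sets P" by measurable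
  qed
  then show ?thesis by simp
qed

text \<open>Finite-dimensional cylinders generate the product sigma-algebra and are stable under
  intersection, so they determine the law. Both invariance statements below are checked on
  them.\<close>

lemma P_eqI:
  assumes sets: "sets Q = sets P"
    and eq: "\<And>J F. finite J \<Longrightarrow> (\<And>j. j \<in> J \<Longrightarrow> F j \<in> sets \<mu>) \<Longrightarrow>
      emeasure Q {x. \<forall>j\<in>J. x j \<in> F j} = (\<Prod>j\<in>J. emeasure \<mu> (F j))"
  shows "Q = P"
proof -
  interpret pr: product_prob_space "\<lambda>_. \<mu>" UNIV
    by (intro product_prob_spaceI prob_mu)
  show ?thesis
    unfolding P_def
  proof (rule pr.PiM_eq)
    show "sets Q = sets (PiM UNIV (\<lambda>_. \<mu>))" using sets by (simp add: P_def)
    fix J :: "int set" and F assume J: "finite J" "\<And>j. j \<in> J \<Longrightarrow> F j \<in> sets \<mu>"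
    have "prod_emb UNIV (\<lambda>_. \<mu>) J (Pi\<^sub>E J F) = {x. \<forall>j\<in>J. x j \<in> F j}"
      by (auto simp: prod_emb_def space_mu PiE_iff)
    with eq[OF J] show "emeasure Q (prod_emb UNIV (\<lambda>_. \<mu>) J (Pi\<^sub>E J F)) = (\<Prod>j\<in>J. emeasure \<mu> (F j))"
      by simp
  qed
qed

text \<open>A cylinder event for the mixture splits into a condition on the first copy at the
  indices in \<open>A\<close> and one on the second copy at the others; by independence the
  probabilities multiply to that of the cylinder. This is what makes resampling any part of the
  noise legitimate.\<close>

lemma distr_mix: "distr (P \<Otimes>\<^sub>M P) P (\<lambda>z. mix A (fst z) (snd z)) = P"
proof (rule P_eqI)
  fix J :: "int set" and F assume J: "finite J" "\<And>j. j \<in> J \<Longrightarrow> F j \<in> sets \<mu>"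
  have eq: "(\<lambda>z. mix A (fst z) (snd z)) -` {x. \<forall>j\<in>J. x j \<in> F j} \<inter> space (P \<Otimes>\<^sub>M P) =
      {x. \<forall>j\<in>J \<inter> A. x j \<in> F j} \<times> {x. \<forall>j\<in>J - A. x j \<in> F j}"
    by (auto simp: mix_def space_pair_measure)
  have "emeasure (distr (P \<Otimes>\<^sub>M P) P (\<lambda>z. mix A (fst z) (snd z))) {x. \<forall>j\<in>J. x j \<in> F j} =
      emeasure (P \<Otimes>\<^sub>M P) ({x. \<forall>j\<in>J \<inter> A. x j \<in> F j} \<times> {x. \<forall>j\<in>J - A. x j \<in> F j})"
    using sets_cylinder[OF J] by (simp only: emeasure_distr measurable_shift measurable_mix measurable_fst measurable_snd eq)
  also have "\<dots> = (\<Prod>j\<in>J \<inter> A. emeasure \<mu> (F j)) * (\<Prod>j\<in>J - A. emeasure \<mu> (F j))"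
    using J by (subst P.emeasure_pair_measure_Times)
      (auto intro!: sets_cylinder arg_cong2[where f="(*)"] emeasure_cylinder)
  also have "\<dots> = (\<Prod>j\<in>J. emeasure \<mu> (F j))"
    using J(1) by (metis mult.commute prod.Int_Diff)
  finally show "emeasure (distr (P \<Otimes>\<^sub>M P) P (\<lambda>z. mix A (fst z) (snd z))) {x. \<forall>j\<in>J. x j \<in> F j}
      = (\<Prod>j\<in>J. emeasure \<mu> (F j))" .
qed simp

lemma distr_shift: "distr P P (shift t) = P"
proof (rule P_eqI)
  fix J :: "int set" and F assume J: "finite J" "\<And>j. j \<in> J \<Longrightarrow> F j \<in> sets \<mu>"
  have eq: "shift t -` {x. \<forall>j\<in>J. x j \<in> F j} \<inter> space P =
      {x. \<forall>j\<in>(\<lambda>j. j + t) ` J. x j \<in> F (j - t)}"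
    by (auto simp: shift_def)
  have "emeasure (distr P P (shift t)) {x. \<forall>j\<in>J. x j \<in> F j} =
      emeasure P {x. \<forall>j\<in>(\<lambda>j. j + t) ` J. x j \<in> F (j - t)}"
    using sets_cylinder[OF J] by (simp only: emeasure_distr measurable_shift measurable_mix measurable_fst measurable_snd eq)
  also have "\<dots> = (\<Prod>j\<in>(\<lambda>j. j + t) ` J. emeasure \<mu> (F (j - t)))"
    using J by (intro emeasure_cylinder) auto
  also have "\<dots> = (\<Prod>j\<in>J. emeasure \<mu> (F j))"
    by (subst prod.reindex) (auto simp: inj_on_def)
  finally show "emeasure (distr P P (shift t)) {x. \<forall>j\<in>J. x j \<in> F j} = (\<Prod>j\<in>J. emeasure \<mu> (F j))" .
qed simp

lemma integral_mix:
  fixes F :: "_ \<Rightarrow> real"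
  assumes "F \<in> borel_measurable P"
  shows "(\<integral>z. F (mix A (fst z) (snd z)) \<partial>(P \<Otimes>\<^sub>M P)) = (\<integral>x. F x \<partial>P)"
  using integral_distr[of "\<lambda>z. mix A (fst z) (snd z)" "P \<Otimes>\<^sub>M P" P F] assms by (simp add: distr_mix)

lemma integrable_mix:
  fixes F :: "_ \<Rightarrow> real"
  assumes "integrable P F"
  shows "integrable (P \<Otimes>\<^sub>M P) (\<lambda>z. F (mix A (fst z) (snd z)))"
  using integrable_distr[of "\<lambda>z. mix A (fst z) (snd z)" "P \<Otimes>\<^sub>M P" P F] assms by (simp add: distr_mix)

lemma integral_shift:
  fixes F :: "_ \<Rightarrow> real"
  assumes "F \<in> borel_measurable P"
  shows "(\<integral>x. F (shift t x) \<partial>P) = (\<integral>x. F x \<partial>P)"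
  using integral_distr[of "shift t" P P F] assms by (simp add: distr_shift)

lemma L2_shift: "L2 P F \<Longrightarrow> L2 P (\<lambda>x. F (shift t x))"
  using L2_distr[of "shift t" P P F] by (simp add: distr_shift L2_measurable)

lemma nrm_shift: "F \<in> borel_measurable P \<Longrightarrow> nrm P (\<lambda>x. F (shift t x)) = nrm P F"
  using nrm_distr[of "shift t" P P F] by (simp add: distr_shift)

lemma L2_mix:
  assumes "L2 P F"
  shows "L2 (P \<Otimes>\<^sub>M P) (\<lambda>z. F (mix A (fst z) (snd z)))"
  using L2_distr[of "\<lambda>z. mix A (fst z) (snd z)" "P \<Otimes>\<^sub>M P" P F] assms by (simp add: distr_mix L2_measurable)

lemma L2_fst: "L2 P F \<Longrightarrow> L2 (P \<Otimes>\<^sub>M P) (\<lambda>z. F (fst z))"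
  using L2_mix[of F UNIV] by (simp add: mix_def)

text \<open>Jensen's inequality on almost every section, followed by Fubini.\<close>

lemma L2_integral_snd:
  assumes K: "L2 (P \<Otimes>\<^sub>M P) K"
  shows "L2 P (\<lambda>x. \<integral>y. K (x, y) \<partial>P)" "nrm P (\<lambda>x. \<integral>y. K (x, y) \<partial>P) \<le> nrm (P \<Otimes>\<^sub>M P) K"
proof -
  have [measurable]: "K \<in> borel_measurable (P \<Otimes>\<^sub>M P)" using K by (rule L2_measurable)
  note K2 = L2_sq_integrable[OF K]
  have ae: "AE x in P. (\<integral>y. K (x, y) \<partial>P)\<^sup>2 \<le> (\<integral>y. (K (x, y))\<^sup>2 \<partial>P)"
    using PP.AE_integrable_fst'[OF K2]
  proof eventually_elim
    case (elim x)
    then have "L2 P (\<lambda>y. K (x, y))" by (simp add: L2_def)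
    then show ?case by (rule P.sq_integral_le)
  qed
  have int: "integrable P (\<lambda>x. \<integral>y. (K (x, y))\<^sup>2 \<partial>P)"
    using PP.integrable_fst'[OF K2] .
  have int2: "integrable P (\<lambda>x. (\<integral>y. K (x, y) \<partial>P)\<^sup>2)"
    by (rule Bochner_Integration.integrable_bound[OF int]) (use ae in auto)
  then show "L2 P (\<lambda>x. \<integral>y. K (x, y) \<partial>P)"
    by (simp add: L2_def)
  have "(\<integral>x. (\<integral>y. K (x, y) \<partial>P)\<^sup>2 \<partial>P) \<le> (\<integral>x. (\<integral>y. (K (x, y))\<^sup>2 \<partial>P) \<partial>P)"
    by (rule integral_mono_AE[OF int2 int ae])
  also have "\<dots> = (\<integral>z. (K z)\<^sup>2 \<partial>(P \<Otimes>\<^sub>M P))"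
    using PP.integral_fst'[OF K2] by simp
  finally show "nrm P (\<lambda>x. \<integral>y. K (x, y) \<partial>P) \<le> nrm (P \<Otimes>\<^sub>M P) K"
    by (simp add: nrm_def)
qed

section \<open>Averaging over part of the noise\<close>

text \<open>For square-integrable \<open>F\<close>, a version of the conditional expectation given the coordinates in \<open>A\<close>.\<close>

definition CE :: "int set \<Rightarrow> ((int \<Rightarrow> real) \<Rightarrow> real) \<Rightarrow> (int \<Rightarrow> real) \<Rightarrow> real" where
  "CE A F x = (\<integral>y. F (mix A x y) \<partial>P)"

lemma CE_measurable [measurable]:
  assumes [measurable]: "F \<in> borel_measurable P"
  shows "CE A F \<in> borel_measurable P"
  unfolding CE_def by measurable

lemma depends_CE: "depends A (CE A F)"
proof -
  have *: "mix A x z = mix A y z" if "\<forall>u\<in>A. x u = y u" for x y z :: "int \<Rightarrow> real"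
    using that by (auto simp: mix_def)
  then have "CE A F x = CE A F y" if "\<forall>u\<in>A. x u = y u" for x y
    unfolding CE_def by (intro Bochner_Integration.integral_cong refl arg_cong[where f=F] * that)
  then show ?thesis by (auto simp: depends_def)
qed

lemma CE_depends:
  assumes "depends B F" "B \<subseteq> A"
  shows "CE A F = F"
proof
  fix x
  have "F (mix A x y) = F x" for y
    by (rule assms(1)[unfolded depends_def, rule_format]) (use assms(2) in \<open>auto simp: mix_def\<close>)
  then show "CE A F x = F x" by (simp add: CE_def prob_UNIV)
qed

lemma L2_CE: "L2 P F \<Longrightarrow> L2 P (CE A F)"
  using L2_integral_snd(1)[OF L2_mix[of F A]] by (simp add: CE_def[abs_def])

lemma nrm_CE_le: 
  assumes "L2 P F" shows "nrm P (CE A F) \<le> nrm P F"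
proof -
  have "nrm (P \<Otimes>\<^sub>M P) (\<lambda>z. F (mix A (fst z) (snd z))) = nrm P F"
    using nrm_distr[of "\<lambda>z. mix A (fst z) (snd z)" "P \<Otimes>\<^sub>M P" P F] assms by (simp add: distr_mix L2_measurable)
  then show ?thesis
    using L2_integral_snd(2)[OF L2_mix[OF assms, of A]] by (simp add: CE_def[abs_def])
qed

lemma AE_L2_section:
  assumes "L2 P F" shows "AE x in P. L2 P (\<lambda>y. F (mix A x y))"
proof -
  have [measurable]: "F \<in> borel_measurable P" using assms by (rule L2_measurable)
  show ?thesis
    using PP.AE_integrable_fst'[OF L2_sq_integrable[OF L2_mix[OF assms, of A]]]
    by (simp add: L2_def)
qed

lemma CE_diff:
  assumes "L2 P F" "L2 P G"
  shows "AE x in P. CE A (\<lambda>x. F x - G x) x = CE A F x - CE A G x"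
  using AE_L2_section[OF assms(1), of A] AE_L2_section[OF assms(2), of A]
  by eventually_elim (simp add: CE_def P.L2_integrable)

text \<open>Resampling twice is resampling once: for fixed \<open>x\<close> the two inner integrals
  run over a mixture of two independent copies, which has law \<open>P\<close> again. The identity
  holds only almost everywhere because Fubini needs the section of \<open>F\<close> at
  \<open>x\<close> to be integrable.\<close>

lemma CE_CE:
  assumes "L2 P F"
  shows "AE x in P. CE A (CE B F) x = CE (A \<inter> B) F x"
  using AE_L2_section[OF assms, of "A \<inter> B"]
proof eventually_elim
  case (elim x)
  define H where "H v = F (mix (A \<inter> B) x v)" for v
  have H: "integrable P H"
    using P.L2_integrable[OF elim] by (simp add: H_def[abs_def])
  have "CE (A \<inter> B) F x = (\<integral>v. H v \<partial>P)"
    by (simp add: CE_def H_def)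
  also have "\<dots> = (\<integral>z. H (mix B (fst z) (snd z)) \<partial>(P \<Otimes>\<^sub>M P))"
    using H by (subst integral_mix) auto
  also have "\<dots> = (\<integral>y. \<integral>z. H (mix B y z) \<partial>P \<partial>P)"
    using PP.integral_fst'[OF integrable_mix[OF H, of B]] by simp
  also have "\<dots> = CE A (CE B F) x"
    by (simp add: CE_def H_def mix_mix)
  finally show ?case ..
qed

lemma integral_CE:
  assumes "L2 P F"
  shows "(\<integral>x. CE A F x \<partial>P) = (\<integral>x. F x \<partial>P)"
proof -
  have "integrable P F" using assms by (rule P.L2_integrable)
  then show ?thesis
    using PP.integral_fst'[OF integrable_mix[of F A]] integral_mix[of F A]
    by (simp add: CE_def)
qed

text \<open>The bridge from the dependence coefficients to averaging: \<open>F - CE A F\<close> is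
  the average over the second copy of the coupling difference, and averaging contracts the
  norm.\<close>

lemma CE_coupling:
  assumes F: "L2 P F"
  shows "nrm P (\<lambda>x. F x - CE A F x) \<le> nrm (P \<Otimes>\<^sub>M P) (\<lambda>z. F (fst z) - F (mix A (fst z) (snd z)))"
proof -
  have [measurable]: "F \<in> borel_measurable P" using F by (rule L2_measurable)
  have K: "L2 (P \<Otimes>\<^sub>M P) (\<lambda>z. F (fst z) - F (mix A (fst z) (snd z)))"
    by (intro L2_diff L2_fst L2_mix F)
  have "AE x in P. (\<integral>y. F x - F (mix A x y) \<partial>P) = F x - CE A F x"
    using AE_L2_section[OF F, of A]
    by eventually_elim (simp add: CE_def P.L2_integrable prob_UNIV)
  then have "nrm P (\<lambda>x. F x - CE A F x) = nrm P (\<lambda>x. \<integral>y. F x - F (mix A x y) \<partial>P)"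
    by (intro nrm_cong_AE) auto
  also have "\<dots> \<le> nrm (P \<Otimes>\<^sub>M P) (\<lambda>z. F (fst z) - F (mix A (fst z) (snd z)))"
    using L2_integral_snd(2)[OF K] by simp
  finally show ?thesis .
qed

lemma CE_shift:
  assumes [measurable]: "F \<in> borel_measurable P"
  shows "CE A (\<lambda>x. F (shift t x)) x = CE {u. u + t \<in> A} F (shift t x)"
  unfolding CE_def shift_mix by (rule integral_shift) simp

section \<open>Independence of functions of disjoint sets of coordinates\<close>

lemma indep_depends:
  assumes meas: "\<And>j. j \<in> J \<Longrightarrow> F j \<in> borel_measurable P"
    and dep: "\<And>j. j \<in> J \<Longrightarrow> depends (A j) (F j)"
    and disj: "disjoint_family_on A J"
  shows "P.indep_vars (\<lambda>_. borel) F J"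
proof -
  have coord: "P.indep_vars (\<lambda>_. borel) (\<lambda>u x. x u) (UNIV :: int set)"
  proof (subst P.indep_vars_iff_distr_eq_PiM)
    interpret pr: product_prob_space "\<lambda>_. \<mu>" "UNIV :: int set"
      by (intro product_prob_spaceI prob_mu)
    have 1: "distr P borel (\<lambda>x. x u) = \<mu>" for u
    proof -
      have "distr P borel (\<lambda>x. x u) = distr P \<mu> (\<lambda>x. x u)"
        by (rule distr_cong) (auto simp: sets_mu)
      also have "\<dots> = \<mu>" unfolding P_def by (rule pr.PiM_component) simp
      finally show ?thesis .
    qed
    have "distr P (PiM UNIV (\<lambda>_. borel)) (\<lambda>x. restrict x UNIV) = distr P P (\<lambda>x. x)"
      by (rule distr_cong) (auto simp: sets_P)
    then show "distr P (PiM UNIV (\<lambda>_. borel)) (\<lambda>x. \<lambda>i\<in>UNIV. x i) = (\<Pi>\<^sub>M i\<in>UNIV. distr P borel (\<lambda>x. x i))"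
      by (simp add: 1 P_def[symmetric] distr_id2)
  qed auto
  have restr: "P.indep_vars (\<lambda>j. PiM (A j) (\<lambda>_. borel)) (\<lambda>j x. restrict x (A j)) J"
    using P.indep_vars_restrict[OF coord, of J A] disj by auto
  \<comment> \<open>Coordinates outside \<open>A j\<close> are filled with 0. By \<open>dep\<close>
    this leaves the value of \<open>F j\<close> unchanged, and it exhibits \<open>F j\<close> as a
    measurable function of the restriction to \<open>A j\<close>.\<close>
  define Y where "Y j z = F j (\<lambda>u. if u \<in> A j then z u else 0)" for j z
  have "P.indep_vars (\<lambda>_. borel) (\<lambda>j x. Y j (restrict x (A j))) J"
  proof (rule P.indep_vars_compose2[OF restr])
    fix j assume "j \<in> J"
    have "(\<lambda>z u. if u \<in> A j then z u else 0) \<in> measurable (PiM (A j) (\<lambda>_. borel)) P"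
    proof (rule measurable_into_P)
      fix u show "(\<lambda>z. if u \<in> A j then z u else 0) \<in> borel_measurable (PiM (A j) (\<lambda>_. borel))"
        by (cases "u \<in> A j") auto
    qed
    from measurable_compose[OF this meas[OF \<open>j \<in> J\<close>]]
    show "Y j \<in> borel_measurable (PiM (A j) (\<lambda>_. borel))"
      by (simp add: Y_def[abs_def])
  qed
  moreover have "Y j (restrict x (A j)) = F j x" if "j \<in> J" for j x
    unfolding Y_def by (rule dep[OF that, unfolded depends_def, rule_format]) simp
  ultimately show ?thesis
    by (subst P.indep_vars_cong[OF refl _ refl, where Y="\<lambda>j x. Y j (restrict x (A j))"]) (auto simp: fun_eq_iff)
qed

lemma indep_var_depends:
  fixes F G :: "_ \<Rightarrow> real"
  assumes F: "F \<in> borel_measurable P" "depends A F"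
    and G: "G \<in> borel_measurable P" "depends B G"
    and "A \<inter> B = {}"
  shows "P.indep_var borel F borel G"
proof -
  have *: "P.indep_vars (\<lambda>_. borel) (case_bool F G) UNIV"
    by (rule indep_depends[where A="case_bool A B"])
      (use assms in \<open>auto simp: disjoint_family_on_def split: bool.splits\<close>)
  have eq: "(\<lambda>_::bool. borel :: real measure) = case_bool borel borel"
    by (auto simp: fun_eq_iff split: bool.splits)
  from * show ?thesis
    unfolding P.indep_var_def eq[symmetric] by simp
qed

lemma integral_mult_depends:
  fixes F G :: "_ \<Rightarrow> real"
  assumes F: "F \<in> borel_measurable P" "depends A F" "integrable P F"
    and G: "G \<in> borel_measurable P" "depends B G" "integrable P G"
    and "A \<inter> B = {}"
  shows "(\<integral>x. F x * G x \<partial>P) = (\<integral>x. F x \<partial>P) * (\<integral>x. G x \<partial>P)"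
  by (rule P.indep_var_lebesgue_integral[OF indep_var_depends]) (use assms in auto)

section \<open>Averaging out distant noise\<close>


lemma CE_add:
  assumes "L2 P F" "L2 P G"
  shows "AE x in P. CE A (\<lambda>x. F x + G x) x = CE A F x + CE A G x"
  using AE_L2_section[OF assms(1), of A] AE_L2_section[OF assms(2), of A]
  by eventually_elim (simp add: CE_def P.L2_integrable)

lemma CE_cmult: "CE A (\<lambda>x. c * F x) x = c * CE A F x"
  by (simp add: CE_def)

lemma nrm_CE_diff_le:
  assumes "L2 P F" "L2 P G"
  shows "nrm P (\<lambda>x. CE A F x - CE A G x) \<le> nrm P (\<lambda>x. F x - G x)"
proof -
  have [measurable]: "F \<in> borel_measurable P" "G \<in> borel_measurable P"
    using assms by (auto simp: L2_measurable)
  have "nrm P (\<lambda>x. CE A F x - CE A G x) = nrm P (CE A (\<lambda>x. F x - G x))"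
    using CE_diff[OF assms, of A] by (intro nrm_cong_AE) auto
  also have "\<dots> \<le> nrm P (\<lambda>x. F x - G x)"
    by (intro nrm_CE_le L2_diff assms)
  finally show ?thesis .
qed

text \<open>This is L2 convergence of the conditional expectations given a growing window, that is,
  the L2 form of Levy's upward theorem. It is established below for all of L2 by a density argument
  instead of martingale convergence.\<close>

definition cyl_approx :: "((int \<Rightarrow> real) \<Rightarrow> real) \<Rightarrow> bool" where
  "cyl_approx F \<longleftrightarrow> (\<lambda>N. nrm P (\<lambda>x. F x - CE {- int N..int N} F x)) \<longlonglongrightarrow> 0"

text \<open>Since \<open>CE\<close> is a contraction, the window error of \<open>F\<close> is at
  most that of \<open>G\<close> plus twice the distance of \<open>F\<close> and
  \<open>G\<close>.\<close>

lemma cyl_approx_limit: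
  assumes F: "L2 P F"
    and lim: "\<And>e. e > 0 \<Longrightarrow> \<exists>G. L2 P G \<and> cyl_approx G \<and> nrm P (\<lambda>x. F x - G x) \<le> e"
  shows "cyl_approx F"
  unfolding cyl_approx_def
proof (rule LIMSEQ_I)
  fix e :: real assume "e > 0"
  then obtain G where G: "L2 P G" "cyl_approx G" "nrm P (\<lambda>x. F x - G x) \<le> e / 3"
    using lim[of "e / 3"] by auto
  obtain N0 where N0: "\<And>N. N \<ge> N0 \<Longrightarrow> nrm P (\<lambda>x. G x - CE {- int N..int N} G x) < e / 3"
    using LIMSEQ_D[OF G(2)[unfolded cyl_approx_def], of "e / 3"] \<open>e > 0\<close> by auto
  have "nrm P (\<lambda>x. F x - CE {- int N..int N} F x) < e" if "N \<ge> N0" for N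
  proof -
    let ?A = "{- int N..int N}"
    have "nrm P (\<lambda>x. F x - CE ?A F x) \<le> nrm P (\<lambda>x. F x - G x) + nrm P (\<lambda>x. G x - CE ?A F x)"
      by (intro nrm_triangle3 F G L2_CE)
    also have "nrm P (\<lambda>x. G x - CE ?A F x) \<le> nrm P (\<lambda>x. G x - CE ?A G x) + nrm P (\<lambda>x. CE ?A G x - CE ?A F x)"
      by (intro nrm_triangle3 F G L2_CE)
    also have "nrm P (\<lambda>x. CE ?A G x - CE ?A F x) \<le> nrm P (\<lambda>x. F x - G x)"
      using nrm_CE_diff_le[OF G(1) F] by (subst nrm_commute[of P F G])
    finally show ?thesis using G(3) N0[OF that] by linarith
  qed
  then show "\<exists>no. \<forall>n\<ge>no. norm (nrm P (\<lambda>x. F x - CE {- int n..int n} F x) - 0) < e"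
    by auto
qed

lemma cyl_approx_add:
  assumes F: "L2 P F" "cyl_approx F" and G: "L2 P G" "cyl_approx G"
  shows "cyl_approx (\<lambda>x. F x + G x)"
  unfolding cyl_approx_def
proof (rule tendsto_sandwich[OF _ _ tendsto_const])
  have [measurable]: "F \<in> borel_measurable P" "G \<in> borel_measurable P"
    using F G by (auto simp: L2_measurable)
  show "(\<lambda>N. nrm P (\<lambda>x. F x - CE {- int N..int N} F x) + nrm P (\<lambda>x. G x - CE {- int N..int N} G x)) \<longlonglongrightarrow> 0"
    using tendsto_add[OF F(2)[unfolded cyl_approx_def] G(2)[unfolded cyl_approx_def]] by simp
  show "\<forall>\<^sub>F N in sequentially. nrm P (\<lambda>x. F x + G x - CE {- int N..int N} (\<lambda>x. F x + G x) x) \<le>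
     nrm P (\<lambda>x. F x - CE {- int N..int N} F x) + nrm P (\<lambda>x. G x - CE {- int N..int N} G x)"
  proof (rule always_eventually, rule allI)
    fix N
    let ?A = "{- int N..int N}"
    have "nrm P (\<lambda>x. F x + G x - CE ?A (\<lambda>x. F x + G x) x) =
        nrm P (\<lambda>x. (F x - CE ?A F x) + (G x - CE ?A G x))"
      using CE_add[OF F(1) G(1), of ?A] by (intro nrm_cong_AE) auto
    also have "\<dots> \<le> nrm P (\<lambda>x. F x - CE ?A F x) + nrm P (\<lambda>x. G x - CE ?A G x)"
      by (intro nrm_triangle L2_diff F G L2_CE)
    finally show "nrm P (\<lambda>x. F x + G x - CE ?A (\<lambda>x. F x + G x) x) \<le> \<dots>" .
  qed
qed simp

lemma cyl_approx_cmult: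
  assumes "cyl_approx F"
  shows "cyl_approx (\<lambda>x. c * F x)"
proof -
  have "nrm P (\<lambda>x. c * F x - CE A (\<lambda>x. c * F x) x) = \<bar>c\<bar> * nrm P (\<lambda>x. F x - CE A F x)" for A
    by (simp add: CE_cmult nrm_cmult flip: right_diff_distrib)
  then show ?thesis
    using tendsto_mult_left[OF assms[unfolded cyl_approx_def], of "\<bar>c\<bar>"] by (simp add: cyl_approx_def)
qed

lemma cyl_approx_depends:
  assumes "depends J F" "finite J"
  shows "cyl_approx F"
proof -
  obtain N0 where N0: "J \<subseteq> {- int N0..int N0}"
  proof -
    from assms(2) obtain K where "\<forall>j\<in>J. \<bar>j\<bar> \<le> K"
      using finite_imageI[OF assms(2), of abs] by (meson finite_abs_int_segment Max_ge imageI)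
    then have "J \<subseteq> {- int (nat K)..int (nat K)}" by fastforce
    then show ?thesis by (rule that)
  qed
  have "\<forall>\<^sub>F N in sequentially. nrm P (\<lambda>x. F x - CE {- int N..int N} F x) = 0"
    using eventually_ge_at_top[of N0]
  proof eventually_elim
    case (elim N)
    then have "J \<subseteq> {- int N..int N}" using N0 by fastforce
    then show ?case
      by (simp add: CE_depends[OF assms(1)] nrm_def)
  qed
  then show ?thesis
    unfolding cyl_approx_def by (rule tendsto_eventually)
qed

lemma L2_indicator: "A \<in> sets P \<Longrightarrow> L2 P (indicator A :: _ \<Rightarrow> real)"
  by (intro P.L2_bounded[where c=1]) (auto simp: indicator_def)

lemma cyl_approx_sum:
  assumes "\<And>i. i \<in> I \<Longrightarrow> L2 P (F i)" "\<And>i. i \<in> I \<Longrightarrow> cyl_approx (F i)"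
  shows "cyl_approx (\<lambda>x. \<Sum>i\<in>I. F i x)"
  using assms
proof (induction I rule: infinite_finite_induct)
  case (insert i I)
  then show ?case by (simp add: cyl_approx_add L2_sum)
qed (auto intro!: cyl_approx_depends[of "{}"] simp: depends_def)

text \<open>Dynkin's argument over the cylinders, where the error is eventually exactly 0.
  Complements are covered by linearity, disjoint unions by \<open>cyl_approx_limit\<close> with
  finite partial unions.\<close>

lemma cyl_approx_indicator:
  assumes "A \<in> sets P"
  shows "cyl_approx (indicator A :: _ \<Rightarrow> real)"
proof -
  let ?G = "prod_algebra (UNIV :: int set) (\<lambda>_. \<mu>)"
  have sub: "?G \<subseteq> Pow UNIV" by simp
  have eq: "sets P = sigma_sets UNIV ?G"
    unfolding P_def sets_PiM by (simp add: space_mu)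
  have "A \<in> sigma_sets UNIV ?G" using assms eq by simp
  with Int_stable_prod_algebra sub show ?thesis
  proof (induction rule: sigma_sets_induct_disjoint)
    case (basic A)
    then obtain J E where A: "A = prod_emb UNIV (\<lambda>_. \<mu>) J (Pi\<^sub>E J E)" "finite J"
      by (elim prod_algebraE)
    have "depends J (indicator A :: _ \<Rightarrow> real)"
      unfolding depends_def
    proof (intro allI impI)
      fix x y :: "int \<Rightarrow> real" assume "\<forall>u\<in>J. x u = y u"
      then have "restrict x J = restrict y J" by auto
      then show "indicator A x = (indicator A y :: real)"
        by (simp add: A prod_emb_def space_mu indicator_def)
    qed
    then show ?case using A(2) by (rule cyl_approx_depends)
  next
    case empty
    show ?case by (rule cyl_approx_depends[of "{}"]) (simp_all add: depends_def)
  next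
    case (compl A)
    have "cyl_approx (\<lambda>x. 1 + (-1) * indicator A x)"
    proof (intro cyl_approx_add cyl_approx_cmult L2_cmult P.L2_const)
      show "cyl_approx (\<lambda>x. 1)"
        by (rule cyl_approx_depends[of "{}"]) (auto simp: depends_def)
      show "L2 P (indicator A)" using compl(1) eq by (intro L2_indicator) simp
    qed (rule compl)
    moreover have "(\<lambda>x. 1 + (-1) * indicator A x) = (indicator (UNIV - A) :: _ \<Rightarrow> real)"
      by (auto simp: indicator_def fun_eq_iff)
    ultimately show ?case by simp
  next
    case (union A)
    have A: "A i \<in> sets P" for i using union(2) eq by auto
    show ?case
    proof (rule cyl_approx_limit)
      show "L2 P (indicator (\<Union>i. A i) :: _ \<Rightarrow> real)"
        using A by (intro L2_indicator) auto
      fix e :: real assume "e > 0"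
      have inc: "(\<lambda>n. measure P (\<Union>i<n. A i)) \<longlonglongrightarrow> measure P (\<Union>n. \<Union>i<n. A i)"
        using A by (intro P.finite_Lim_measure_incseq) (auto simp: incseq_def intro: less_le_trans)
      have "(\<Union>n. \<Union>i<n. A i) = (\<Union>i. A i)" by auto
      with inc have "(\<lambda>n. measure P (\<Union>i<n. A i)) \<longlonglongrightarrow> measure P (\<Union>i. A i)" by simp
      \<comment> \<open>The tolerance is e^2 because the norm of an indicator is the square root of
        the measure.\<close>
      from LIMSEQ_D[OF this, of "e\<^sup>2"] \<open>e > 0\<close> obtain n where
        n: "\<bar>measure P (\<Union>i<n. A i) - measure P (\<Union>i. A i)\<bar> < e\<^sup>2" by auto
      define B where "B = (\<Union>i. A i) - (\<Union>i<n. A i)"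
      have B: "B \<in> sets P" using A by (auto simp: B_def)
      have "measure P B = measure P (\<Union>i. A i) - measure P (\<Union>i<n. A i)"
        unfolding B_def using A by (intro P.finite_measure_Diff) auto
      with n have mB: "measure P B \<le> e\<^sup>2" by linarith
      have sum: "(\<Sum>i<n. indicator (A i) x) = (indicator (\<Union>i<n. A i) x :: real)" for x
        using union(1) by (subst indicator_UN_disjoint) (auto simp: disjoint_family_on_def)
      have "indicator (\<Union>i. A i) x - (\<Sum>i<n. indicator (A i) x) = (indicator B x :: real)" for x
        unfolding sum by (auto simp: B_def indicator_def)
      moreover have "nrm P (indicator B :: _ \<Rightarrow> real) \<le> e"
      proof -
        have "(\<lambda>x. (indicator B x :: real)\<^sup>2) = indicator B" by (auto simp: indicator_def)
        then have "nrm P (indicator B :: _ \<Rightarrow> real) = sqrt (measure P B)"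
          using B by (simp add: nrm_def)
        also have "\<dots> \<le> sqrt (e\<^sup>2)" using mB by (rule real_sqrt_le_mono)
        finally show ?thesis using \<open>e > 0\<close> by simp
      qed
      ultimately have "nrm P (\<lambda>x. indicator (\<Union>i. A i) x - (\<Sum>i<n. indicator (A i) x)) \<le> e" by simp
      then show "\<exists>G. L2 P G \<and> cyl_approx G \<and> nrm P (\<lambda>x. indicator (\<Union>i. A i) x - G x) \<le> e"
        using A union(3) by (intro exI[of _ "\<lambda>x. \<Sum>i<n. indicator (A i) x"] conjI L2_sum cyl_approx_sum L2_indicator) auto
    qed
  qed
qed

text \<open>Simple functions are dense. They can be chosen with absolute value at most twice that of
  \<open>F\<close>, so the difference is at most three times as large, which gives the 9 in the
  dominating function.\<close>

lemma cyl_approx_L2: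
  assumes F: "L2 P F"
  shows "cyl_approx F"
proof (rule cyl_approx_limit[OF F])
  have [measurable]: "F \<in> borel_measurable P" using F by (rule L2_measurable)
  fix e :: real assume e: "e > 0"
  obtain S where S: "\<And>i. simple_function P (S i)" "\<And>x. (\<lambda>i. S i x) \<longlonglongrightarrow> F x"
      "\<And>i x. \<bar>S i x\<bar> \<le> 2 * \<bar>F x\<bar>"
    using borel_measurable_implies_sequence_metric[of F P 0] by (auto simp: dist_real_def)
  have [measurable]: "S i \<in> borel_measurable P" for i
    using S(1) by (rule borel_measurable_simple_function)
  have S_L2: "L2 P (S i)" for i
    by (rule L2_bound(1)[OF L2_cmult[OF F, of 2]]) (use S(3) in \<open>auto simp: abs_mult\<close>)
  have "(\<lambda>i. \<integral>x. (F x - S i x)\<^sup>2 \<partial>P) \<longlonglongrightarrow> (\<integral>x. 0 \<partial>P)"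
  proof (rule integral_dominated_convergence[where w="\<lambda>x. 9 * (F x)\<^sup>2"])
    show "integrable P (\<lambda>x. 9 * (F x)\<^sup>2)" using F by (simp add: L2_def)
    show "AE x in P. (\<lambda>i. (F x - S i x)\<^sup>2) \<longlonglongrightarrow> 0"
      by (intro AE_I2) (auto intro!: tendsto_eq_intros S(2))
    fix i
    show "AE x in P. norm ((F x - S i x)\<^sup>2) \<le> 9 * (F x)\<^sup>2"
    proof (rule AE_I2)
      fix x
      have "\<bar>F x - S i x\<bar> \<le> 3 * \<bar>F x\<bar>" using S(3)[of i x] by linarith
      from power_mono[OF this, of 2] show "norm ((F x - S i x)\<^sup>2) \<le> 9 * (F x)\<^sup>2"
        by (simp add: power_mult_distrib)
    qed
  qed auto
  then have "(\<lambda>i. nrm P (\<lambda>x. F x - S i x)) \<longlonglongrightarrow> 0"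
    unfolding nrm_def using tendsto_real_sqrt by fastforce
  then obtain i where i: "nrm P (\<lambda>x. F x - S i x) < e"
    using LIMSEQ_D[of _ 0 e] e by fastforce
  have fin: "finite (range (S i))"
    using S(1)[of i] by (simp add: simple_function_def)
  have eq: "S i x = (\<Sum>c\<in>range (S i). c * indicator (S i -` {c}) x)" for x
  proof -
    have "(\<Sum>c\<in>range (S i). c * indicator (S i -` {c}) x) = (\<Sum>c\<in>{S i x}. c * indicator (S i -` {c}) x)"
      by (intro sum.mono_neutral_right fin) (auto simp: indicator_def)
    then show ?thesis by simp
  qed
  have sets: "S i -` {c} \<in> sets P" for c
    using measurable_sets[of "S i" P borel "{c}"] by simp
  have "cyl_approx (\<lambda>x. \<Sum>c\<in>range (S i). c * indicator (S i -` {c}) x)"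
    by (intro cyl_approx_sum cyl_approx_cmult cyl_approx_indicator L2_cmult L2_indicator sets)
  moreover have "(\<lambda>x. \<Sum>c\<in>range (S i). c * indicator (S i -` {c}) x) = S i"
    by (rule ext) (rule eq[symmetric])
  ultimately have "cyl_approx (S i)" by simp
  then show "\<exists>G. L2 P G \<and> cyl_approx G \<and> nrm P (\<lambda>x. F x - G x) \<le> e"
    using S_L2 i by (intro exI[of _ "S i"]) auto
qed

text \<open>Averaging out one more index on top of \<open>I\<close> costs no more than averaging out
  that index alone, because \<open>CE (- I)\<close> is a contraction. The single costs simply add
  up.\<close>

lemma CE_telescope:
  assumes F: "L2 P F" and "finite I"
  shows "nrm P (\<lambda>x. F x - CE (- I) F x) \<le> (\<Sum>i\<in>I. nrm P (\<lambda>x. F x - CE (- {i}) F x))"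
  using assms(2)
proof induction
  case empty
  have "depends UNIV F" unfolding depends_def by (metis UNIV_I ext)
  then show ?case by (simp add: CE_depends nrm_def)
next
  case (insert i I)
  have [measurable]: "F \<in> borel_measurable P" using F by (rule L2_measurable)
  have eq: "- insert i I = - I \<inter> - {i}" by auto
  have "nrm P (\<lambda>x. F x - CE (- insert i I) F x) = nrm P (\<lambda>x. F x - CE (- I) (CE (- {i}) F) x)"
    unfolding eq using CE_CE[OF F, of "-I" "-{i}"] by (intro nrm_cong_AE) auto
  also have "\<dots> \<le> nrm P (\<lambda>x. F x - CE (- I) F x) + nrm P (\<lambda>x. CE (- I) F x - CE (- I) (CE (- {i}) F) x)"
    by (intro nrm_triangle3 F L2_CE)
  also have "nrm P (\<lambda>x. CE (- I) F x - CE (- I) (CE (- {i}) F) x) \<le> nrm P (\<lambda>x. F x - CE (- {i}) F x)"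
    by (intro nrm_CE_diff_le F L2_CE)
  finally show ?case using insert by simp
qed

text \<open>Passage from finitely to infinitely many averaged indices: inside a window only finitely
  many are involved, and what the noise outside the window contributes is controlled by
  \<open>cyl_approx_L2\<close> and vanishes as the window grows.\<close>

lemma CE_bound:
  assumes F: "L2 P F"
    and bound: "\<And>I. finite I \<Longrightarrow> I \<inter> A = {} \<Longrightarrow> (\<Sum>i\<in>I. nrm P (\<lambda>x. F x - CE (- {i}) F x)) \<le> D"
  shows "nrm P (\<lambda>x. F x - CE A F x) \<le> D"
proof -
  have [measurable]: "F \<in> borel_measurable P" using F by (rule L2_measurable)
  let ?N = "\<lambda>N. {- int N..int N}"
  have "nrm P (\<lambda>x. F x - CE A F x) \<le> D + 2 * nrm P (\<lambda>x. F x - CE (?N N) F x)" for N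
  proof -
    \<comment> \<open>\<open>?B\<close> averages out just the indices of the window that are outside
      \<open>A\<close>. It has the same trace on the window as \<open>A\<close>, so both act alike
      on the window average of \<open>F\<close>.\<close>
    let ?B = "- (?N N - A)"
    have int: "?B \<inter> ?N N = A \<inter> ?N N" by auto
    have "nrm P (\<lambda>x. F x - CE A F x) \<le> nrm P (\<lambda>x. F x - CE ?B F x) + nrm P (\<lambda>x. CE ?B F x - CE A F x)"
      by (intro nrm_triangle3 F L2_CE)
    also have "nrm P (\<lambda>x. F x - CE ?B F x) \<le> D"
      by (rule order_trans[OF CE_telescope[OF F]]) (auto intro!: bound)
    also have "nrm P (\<lambda>x. CE ?B F x - CE A F x) \<le>
        nrm P (\<lambda>x. CE ?B F x - CE ?B (CE (?N N) F) x) + nrm P (\<lambda>x. CE ?B (CE (?N N) F) x - CE A F x)"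
      by (intro nrm_triangle3 F L2_CE)
    also have "nrm P (\<lambda>x. CE ?B F x - CE ?B (CE (?N N) F) x) \<le> nrm P (\<lambda>x. F x - CE (?N N) F x)"
      by (intro nrm_CE_diff_le F L2_CE)
    also have "nrm P (\<lambda>x. CE ?B (CE (?N N) F) x - CE A F x) = nrm P (\<lambda>x. CE A (CE (?N N) F) x - CE A F x)"
    proof (intro nrm_cong_AE)
      show "AE x in P. CE ?B (CE (?N N) F) x - CE A F x = CE A (CE (?N N) F) x - CE A F x"
        using CE_CE[OF F, of ?B "?N N"] CE_CE[OF F, of A "?N N"] unfolding int by eventually_elim simp
    qed simp_all
    also have "\<dots> \<le> nrm P (\<lambda>x. CE (?N N) F x - F x)"
      by (intro nrm_CE_diff_le F L2_CE)
    finally show ?thesis by (simp add: nrm_commute)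
  qed
  moreover have "(\<lambda>N. D + 2 * nrm P (\<lambda>x. F x - CE (?N N) F x)) \<longlonglongrightarrow> D + 2 * 0"
    using cyl_approx_L2[OF F] unfolding cyl_approx_def by (intro tendsto_intros)
  ultimately show ?thesis
    by (intro tendsto_lowerbound[of "\<lambda>N. D + 2 * nrm P (\<lambda>x. F x - CE (?N N) F x)" D sequentially]) auto
qed

section \<open>Rates of decay of the dependence on distant noise\<close>

text \<open>\<open>\<tau> r\<close> bounds the \<open>L\<^sup>2\<close> error of averaging out any set of noise variables at distance
  more than \<open>r\<close> from the origin.\<close>

definition wdep :: "(nat \<Rightarrow> real) \<Rightarrow> ((int \<Rightarrow> real) \<Rightarrow> real) \<Rightarrow> bool" where
  "wdep \<tau> F \<longleftrightarrow> L2 P F \<and> (\<forall>r A. {- int r..int r} \<subseteq> A \<longrightarrow> nrm P (\<lambda>x. F x - CE A F x) \<le> \<tau> r)"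

lemma wdep_L2: "wdep \<tau> F \<Longrightarrow> L2 P F"
  by (simp add: wdep_def)

lemma wdepD: "wdep \<tau> F \<Longrightarrow> {- int r..int r} \<subseteq> A \<Longrightarrow> nrm P (\<lambda>x. F x - CE A F x) \<le> \<tau> r"
  by (simp add: wdep_def)

lemma wdep_nonneg: "wdep \<tau> F \<Longrightarrow> 0 \<le> \<tau> r"
  using wdepD[of \<tau> F r UNIV] order_trans[OF nrm_nonneg] by blast

text \<open>Every averaged index has absolute value at least r + 1, so i^2 / (r + 1)^2 is at least 1
  and can be inserted as a factor. The resulting rate is summable in \<open>r\<close>, which is all
  that later arguments use of the weight i^2.\<close>

lemma wdep_from_coupling:
  assumes F: "L2 P F"
    and d: "\<And>i. nrm (P \<Otimes>\<^sub>M P) (\<lambda>z. F (fst z) - F (mix (- {i}) (fst z) (snd z))) \<le> d i"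
    and D: "\<And>I. finite I \<Longrightarrow> (\<Sum>i\<in>I. (real_of_int i)\<^sup>2 * d i) \<le> D"
  shows "wdep (\<lambda>r. D / (real r + 1)\<^sup>2) F"
  unfolding wdep_def
proof (intro conjI allI impI F)
  fix r and A :: "int set" assume A: "{- int r..int r} \<subseteq> A"
  have d0: "d i \<ge> 0" for i using d[of i] order_trans[OF nrm_nonneg] by blast
  show "nrm P (\<lambda>x. F x - CE A F x) \<le> D / (real r + 1)\<^sup>2"
  proof (rule CE_bound[OF F])
    fix I :: "int set" assume I: "finite I" "I \<inter> A = {}"
    have "(\<Sum>i\<in>I. nrm P (\<lambda>x. F x - CE (- {i}) F x)) \<le> (\<Sum>i\<in>I. (real_of_int i)\<^sup>2 * d i / (real r + 1)\<^sup>2)"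
    proof (rule sum_mono)
      fix i assume "i \<in> I"
      then have "i \<notin> {- int r..int r}" using I A by auto
      then have "int r + 1 \<le> \<bar>i\<bar>" by auto
      then have "real r + 1 \<le> \<bar>real_of_int i\<bar>" by linarith
      from power_mono[OF this, of 2] have *: "(real r + 1)\<^sup>2 \<le> (real_of_int i)\<^sup>2" by simp
      have "nrm P (\<lambda>x. F x - CE (- {i}) F x) \<le> d i"
        using CE_coupling[OF F, of "-{i}"] d[of i] by linarith
      also have "d i \<le> (real_of_int i)\<^sup>2 * d i / (real r + 1)\<^sup>2"
        using mult_right_mono[OF * d0[of i]] by (simp add: pos_le_divide_eq mult.commute)
      finally show "nrm P (\<lambda>x. F x - CE (- {i}) F x) \<le> (real_of_int i)\<^sup>2 * d i / (real r + 1)\<^sup>2" .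
    qed
    also have "\<dots> = (\<Sum>i\<in>I. (real_of_int i)\<^sup>2 * d i) / (real r + 1)\<^sup>2"
      by (rule sum_divide_distrib[symmetric])
    also have "\<dots> \<le> D / (real r + 1)\<^sup>2"
      using D[OF I(1)] by (intro divide_right_mono) auto
    finally show "(\<Sum>i\<in>I. nrm P (\<lambda>x. F x - CE (- {i}) F x)) \<le> D / (real r + 1)\<^sup>2" .
  qed
qed

end

section \<open>Asymptotic uniform integrability\<close>

definition excess :: "real \<Rightarrow> real \<Rightarrow> real" where
  "excess C z = max 0 (\<bar>z\<bar> - C)"

text \<open>Asymptotic uniform integrability of \<open>(\<xi> n)\<^sup>2\<close>: the excess, unlike the
  truncation to \<open>\<bar>\<xi> n\<bar> > C\<close>, is 1-Lipschitz, so the condition survives Lipschitz maps and \<open>L\<^sup>2\<close>-small perturbations.\<close>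

definition ui2 :: "'a measure \<Rightarrow> (nat \<Rightarrow> 'a \<Rightarrow> real) \<Rightarrow> bool" where
  "ui2 M \<xi> \<longleftrightarrow> (\<forall>e>0. \<exists>C>0. \<forall>\<^sub>F n in sequentially. nrm M (\<lambda>x. excess C (\<xi> n x)) \<le> e)"

lemma excess_nonneg [simp]: "0 \<le> excess C z"
  by (simp add: excess_def)

lemma excess_le_abs: "C \<ge> 0 \<Longrightarrow> excess C z \<le> \<bar>z\<bar>"
  by (simp add: excess_def)

lemma excess_measurable [measurable]:
  assumes [measurable]: "f \<in> borel_measurable M"
  shows "(\<lambda>x. excess C (f x)) \<in> borel_measurable M"
  unfolding excess_def by measurable

lemma L2_excess: "L2 M f \<Longrightarrow> C \<ge> 0 \<Longrightarrow> L2 M (\<lambda>x. excess C (f x))"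
  by (rule L2_bound(1)[of M f]) (auto simp: excess_le_abs dest: L2_measurable)

lemma nrm_excess_mono:
  assumes "L2 M g" "f \<in> borel_measurable M" "\<And>x. x \<in> space M \<Longrightarrow> excess C (f x) \<le> g x"
  shows "nrm M (\<lambda>x. excess C (f x)) \<le> nrm M g"
proof (rule L2_bound(2)[OF assms(1)])
  show "(\<lambda>x. excess C (f x)) \<in> borel_measurable M" using assms(2) by simp
  show "AE x in M. \<bar>excess C (f x)\<bar> \<le> \<bar>g x\<bar>"
  proof (rule AE_I2)
    fix x assume "x \<in> space M"
    from assms(3)[OF this] show "\<bar>excess C (f x)\<bar> \<le> \<bar>g x\<bar>"
      using excess_nonneg[of C "f x"] by linarith
  qed
qed

lemma ui2_add:
  assumes "ui2 M \<xi>" "ui2 M \<zeta>" and L2: "\<And>n. L2 M (\<xi> n)" "\<And>n. L2 M (\<zeta> n)"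
  shows "ui2 M (\<lambda>n x. \<xi> n x + \<zeta> n x)"
  unfolding ui2_def
proof (intro allI impI)
  fix e :: real assume "e > 0"
  then obtain C D where C: "C > 0" "\<forall>\<^sub>F n in sequentially. nrm M (\<lambda>x. excess C (\<xi> n x)) \<le> e / 2"
    and D: "D > 0" "\<forall>\<^sub>F n in sequentially. nrm M (\<lambda>x. excess D (\<zeta> n x)) \<le> e / 2"
    using assms(1,2) unfolding ui2_def by (meson half_gt_zero)
  have "\<forall>\<^sub>F n in sequentially. nrm M (\<lambda>x. excess (C + D) (\<xi> n x + \<zeta> n x)) \<le> e"
    using C(2) D(2)
  proof eventually_elim
    case (elim n)
    have "nrm M (\<lambda>x. excess (C + D) (\<xi> n x + \<zeta> n x)) \<le> nrm M (\<lambda>x. excess C (\<xi> n x) + excess D (\<zeta> n x))"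
    proof (rule nrm_excess_mono)
      show "L2 M (\<lambda>x. excess C (\<xi> n x) + excess D (\<zeta> n x))"
        using C(1) D(1) by (intro L2_add L2_excess L2) auto
      show "(\<lambda>x. \<xi> n x + \<zeta> n x) \<in> borel_measurable M"
        using L2[THEN L2_measurable] by (intro borel_measurable_add)
    qed (auto simp: excess_def)
    also have "\<dots> \<le> nrm M (\<lambda>x. excess C (\<xi> n x)) + nrm M (\<lambda>x. excess D (\<zeta> n x))"
      using C(1) D(1) by (intro nrm_triangle L2_excess L2) auto
    finally show ?case using elim by linarith
  qed
  then show "\<exists>C>0. \<forall>\<^sub>F n in sequentially. nrm M (\<lambda>x. excess C (\<xi> n x + \<zeta> n x)) \<le> e"
    using C(1) D(1) by (intro exI[of _ "C + D"]) auto
qed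

lemma ui2_zero: "ui2 M (\<lambda>n x. 0)"
  by (auto simp: ui2_def excess_def nrm_def intro!: exI[of _ 1])

lemma ui2_sum:
  assumes "\<And>i. i \<in> I \<Longrightarrow> ui2 M (\<xi> i)" "\<And>i n. i \<in> I \<Longrightarrow> L2 M (\<xi> i n)"
  shows "ui2 M (\<lambda>n x. \<Sum>i\<in>I. \<xi> i n x)"
  using assms
proof (induction I rule: infinite_finite_induct)
  case (insert i I)
  then show ?case by (simp add: ui2_add L2_sum)
qed (simp_all add: ui2_zero)

lemma ui2_lipschitz:
  assumes "ui2 M \<xi>" "\<And>n. L2 M (\<xi> n)" "\<And>n. \<zeta> n \<in> borel_measurable M" "K > 0" "c \<ge> 0"
    and bd: "\<And>n x. x \<in> space M \<Longrightarrow> \<bar>\<zeta> n x\<bar> \<le> K * \<bar>\<xi> n x\<bar> + c"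
  shows "ui2 M \<zeta>"
  unfolding ui2_def
proof (intro allI impI)
  fix e :: real assume "e > 0"
  with \<open>K > 0\<close> have "e / K > 0" by simp
  then obtain C where C: "C > 0" "\<forall>\<^sub>F n in sequentially. nrm M (\<lambda>x. excess C (\<xi> n x)) \<le> e / K"
    using assms(1) unfolding ui2_def by meson
  have "\<forall>\<^sub>F n in sequentially. nrm M (\<lambda>x. excess (K * C + c) (\<zeta> n x)) \<le> e"
    using C(2)
  proof eventually_elim
    case (elim n)
    have "nrm M (\<lambda>x. excess (K * C + c) (\<zeta> n x)) \<le> nrm M (\<lambda>x. K * excess C (\<xi> n x))"
    proof (rule nrm_excess_mono)
      fix x assume "x \<in> space M"
      from bd[OF this, of n] have "\<bar>\<zeta> n x\<bar> - (K * C + c) \<le> K * (\<bar>\<xi> n x\<bar> - C)"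
        by (simp add: algebra_simps)
      also have "\<dots> \<le> K * excess C (\<xi> n x)"
        using \<open>K > 0\<close> by (intro mult_left_mono) (auto simp: excess_def)
      finally show "excess (K * C + c) (\<zeta> n x) \<le> K * excess C (\<xi> n x)"
        using \<open>K > 0\<close> by (simp add: excess_def[of "K * C + c"])
    qed (use assms C(1) in \<open>auto intro!: L2_cmult L2_excess\<close>)
    also have "\<dots> = K * nrm M (\<lambda>x. excess C (\<xi> n x))"
      using \<open>K > 0\<close> by (simp add: nrm_cmult)
    also have "\<dots> \<le> e" using elim \<open>K > 0\<close> by (simp add: field_simps)
    finally show ?case .
  qed
  moreover have "K * C + c > 0" using \<open>K > 0\<close> C(1) \<open>c \<ge> 0\<close> by (intro add_pos_nonneg) auto
  ultimately show "\<exists>C>0. \<forall>\<^sub>F n in sequentially. nrm M (\<lambda>x. excess C (\<zeta> n x)) \<le> e"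
    by blast
qed

text \<open>The approximating sequence may change with \<open>e\<close>, so that windows and
  truncation levels can be chosen after the tolerance.\<close>

lemma ui2_approx:
  assumes L2: "\<And>n. L2 M (\<xi> n)"
    and ap: "\<And>e. e > 0 \<Longrightarrow> \<exists>\<zeta>. (\<forall>n. L2 M (\<zeta> n)) \<and> ui2 M \<zeta> \<and>
        (\<forall>\<^sub>F n in sequentially. nrm M (\<lambda>x. \<xi> n x - \<zeta> n x) \<le> e)"
  shows "ui2 M \<xi>"
  unfolding ui2_def
proof (intro allI impI)
  fix e :: real assume "e > 0"
  then obtain \<zeta> where z: "\<And>n. L2 M (\<zeta> n)" "ui2 M \<zeta>"
      and ev: "\<forall>\<^sub>F n in sequentially. nrm M (\<lambda>x. \<xi> n x - \<zeta> n x) \<le> e / 2"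
    using ap[of "e / 2"] by auto
  obtain C where C: "C > 0" "\<forall>\<^sub>F n in sequentially. nrm M (\<lambda>x. excess C (\<zeta> n x)) \<le> e / 2"
    using z(2) \<open>e > 0\<close> unfolding ui2_def by (meson half_gt_zero)
  have "\<forall>\<^sub>F n in sequentially. nrm M (\<lambda>x. excess C (\<xi> n x)) \<le> e"
    using ev C(2)
  proof eventually_elim
    case (elim n)
    have "nrm M (\<lambda>x. excess C (\<xi> n x)) \<le> nrm M (\<lambda>x. excess C (\<zeta> n x) + \<bar>\<xi> n x - \<zeta> n x\<bar>)"
    proof (rule nrm_excess_mono)
      show "L2 M (\<lambda>x. excess C (\<zeta> n x) + \<bar>\<xi> n x - \<zeta> n x\<bar>)"
        using C(1) by (intro L2_add L2_excess L2_abs L2_diff L2 z) auto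
    qed (use L2 in \<open>auto simp: excess_def L2_measurable\<close>)
    also have "\<dots> \<le> nrm M (\<lambda>x. excess C (\<zeta> n x)) + nrm M (\<lambda>x. \<bar>\<xi> n x - \<zeta> n x\<bar>)"
      using C(1) by (intro nrm_triangle L2_excess L2_abs L2_diff L2 z) auto
    also have "nrm M (\<lambda>x. \<bar>\<xi> n x - \<zeta> n x\<bar>) = nrm M (\<lambda>x. \<xi> n x - \<zeta> n x)"
      by (rule nrm_abs)
    finally show ?case using elim by linarith
  qed
  with C(1) show "\<exists>C>0. \<forall>\<^sub>F n in sequentially. nrm M (\<lambda>x. excess C (\<xi> n x)) \<le> e" by blast
qed

lemma ui2_perturb:
  assumes "\<And>n. L2 M (\<xi> n)" "\<And>n. L2 M (\<zeta> n)" "ui2 M \<zeta>" "(\<lambda>n. nrm M (\<lambda>x. \<xi> n x - \<zeta> n x)) \<longlonglongrightarrow> 0"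
  shows "ui2 M \<xi>"
proof (rule ui2_approx[OF assms(1)])
  fix e :: real assume "e > 0"
  with order_tendstoD(2)[OF assms(4)] have "\<forall>\<^sub>F n in sequentially. nrm M (\<lambda>x. \<xi> n x - \<zeta> n x) < e" by auto
  then have "\<forall>\<^sub>F n in sequentially. nrm M (\<lambda>x. \<xi> n x - \<zeta> n x) \<le> e" by (rule eventually_mono) simp
  with assms show "\<exists>\<zeta>. (\<forall>n. L2 M (\<zeta> n)) \<and> ui2 M \<zeta> \<and> (\<forall>\<^sub>F n in sequentially. nrm M (\<lambda>x. \<xi> n x - \<zeta> n x) \<le> e)"
    by blast
qed

lemma ui2_subseq:
  assumes "ui2 M \<xi>" "filterlim k at_top sequentially"
  shows "ui2 M (\<lambda>n. \<xi> (k n))"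
  unfolding ui2_def
proof (intro allI impI)
  fix e :: real assume "e > 0"
  then obtain C where C: "C > 0" "\<forall>\<^sub>F n in sequentially. nrm M (\<lambda>x. excess C (\<xi> n x)) \<le> e"
    using assms(1) unfolding ui2_def by meson
  from eventually_compose_filterlim[OF C(2) assms(2)] C(1)
  show "\<exists>C>0. \<forall>\<^sub>F n in sequentially. nrm M (\<lambda>x. excess C (\<xi> (k n) x)) \<le> e" by auto
qed

text \<open>The condition sees only the laws and can therefore be carried to the space that
  Skorohod's theorem produces.\<close>

lemma ui2_distr:
  assumes [measurable]: "\<And>n. \<xi> n \<in> borel_measurable M" "\<And>n. \<zeta> n \<in> borel_measurable N"
    and eq: "\<And>n. distr M borel (\<xi> n) = distr N borel (\<zeta> n)"
    and "ui2 M \<xi>"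
  shows "ui2 N \<zeta>"
proof -
  have "nrm M (\<lambda>x. excess C (\<xi> n x)) = nrm N (\<lambda>x. excess C (\<zeta> n x))" for C n
    using nrm_distr[of "\<xi> n" M borel "excess C"] nrm_distr[of "\<zeta> n" N borel "excess C"] eq[of n] by simp
  then show ?thesis using assms(4) by (simp add: ui2_def)
qed

text \<open>The excess of z over \<open>C\<close> is at most z^2 / C, so its norm is at most the
  square root of the fourth moment divided by \<open>C\<close>.\<close>

lemma ui2_fourth_moment:
  assumes meas [measurable]: "\<And>n. \<xi> n \<in> borel_measurable M"
    and int: "\<And>n. integrable M (\<lambda>x. (\<xi> n x)^4)"
    and bd: "\<And>n. (\<integral>x. (\<xi> n x)^4 \<partial>M) \<le> K"
  shows "ui2 M \<xi>"
  unfolding ui2_def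
proof (intro allI impI)
  fix e :: real assume "e > 0"
  \<comment> \<open>The summand 1 keeps \<open>C\<close> positive even if \<open>K\<close> is
    0.\<close>
  define C where "C = (sqrt \<bar>K\<bar> + 1) / e"
  have "C > 0" using \<open>e > 0\<close> by (simp add: C_def add_nonneg_pos)
  have "nrm M (\<lambda>x. excess C (\<xi> n x)) \<le> e" for n
  proof -
    have pow4: "((\<xi> n x)\<^sup>2)\<^sup>2 = (\<xi> n x)^4" for x by simp
    have "nrm M (\<lambda>x. excess C (\<xi> n x)) \<le> nrm M (\<lambda>x. 1 / C * (\<xi> n x)\<^sup>2)"
    proof (rule nrm_excess_mono)
      have "L2 M (\<lambda>x. (\<xi> n x)\<^sup>2)" using int[of n] by (simp add: L2_def)
      then show "L2 M (\<lambda>x. 1 / C * (\<xi> n x)\<^sup>2)" by (rule L2_cmult)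
      fix x
      show "excess C (\<xi> n x) \<le> 1 / C * (\<xi> n x)\<^sup>2"
      proof (cases "\<bar>\<xi> n x\<bar> \<le> C")
        case False
        then have "C * \<bar>\<xi> n x\<bar> \<le> \<bar>\<xi> n x\<bar> * \<bar>\<xi> n x\<bar>" by (intro mult_right_mono) auto
        then have "\<bar>\<xi> n x\<bar> \<le> 1 / C * (\<xi> n x)\<^sup>2"
          using \<open>C > 0\<close> by (simp add: field_simps power2_eq_square)
        then show ?thesis using \<open>C > 0\<close> excess_le_abs[of C "\<xi> n x"] by linarith
      qed (use \<open>C > 0\<close> in \<open>simp add: excess_def\<close>)
    qed simp
    also have "\<dots> = 1 / C * sqrt (\<integral>x. (\<xi> n x)^4 \<partial>M)"
      using \<open>C > 0\<close> unfolding nrm_cmult by (simp add: nrm_def)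
    also have "\<dots> \<le> 1 / C * (sqrt \<bar>K\<bar> + 1)"
    proof -
      have "(\<integral>x. (\<xi> n x)^4 \<partial>M) \<le> \<bar>K\<bar>" using bd[of n] by linarith
      then have "sqrt (\<integral>x. (\<xi> n x)^4 \<partial>M) \<le> sqrt \<bar>K\<bar>" by (rule real_sqrt_le_mono)
      then have "sqrt (\<integral>x. (\<xi> n x)^4 \<partial>M) \<le> sqrt \<bar>K\<bar> + 1" by linarith
      then show ?thesis using \<open>C > 0\<close> by (intro mult_left_mono) auto
    qed
    also have "\<dots> = e" using \<open>e > 0\<close> by (simp add: C_def add_nonneg_eq_0_iff add_nonneg_pos less_imp_neq[THEN not_sym])
    finally show ?thesis .
  qed
  with \<open>C > 0\<close> show "\<exists>C>0. \<forall>\<^sub>F n in sequentially. nrm M (\<lambda>x. excess C (\<xi> n x)) \<le> e" by auto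
qed

text \<open>Induction that carries the first and second moments along. When a summand is added, all
  terms of the binomial expansion containing a factor to the first power vanish by independence and
  centring.\<close>

lemma (in prob_space) fourth_moment_indep_sum:
  fixes \<xi> :: "'i \<Rightarrow> 'a \<Rightarrow> real"
  assumes "finite I" "indep_vars (\<lambda>_. borel) \<xi> I"
    and bd: "\<And>i x. i \<in> I \<Longrightarrow> \<bar>\<xi> i x\<bar> \<le> K" and mean: "\<And>i. i \<in> I \<Longrightarrow> expectation (\<xi> i) = 0"
  shows "expectation (\<lambda>x. (\<Sum>i\<in>I. \<xi> i x)^4) \<le> 3 * K^4 * (real (card I))\<^sup>2"
proof -
  have "expectation (\<lambda>x. \<Sum>i\<in>I. \<xi> i x) = 0 \<and> expectation (\<lambda>x. (\<Sum>i\<in>I. \<xi> i x)\<^sup>2) \<le> K\<^sup>2 * real (card I)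
      \<and> expectation (\<lambda>x. (\<Sum>i\<in>I. \<xi> i x)^4) \<le> 3 * K^4 * (real (card I))\<^sup>2"
    using assms
  proof (induction I)
    case empty
    show ?case by simp
  next
    case (insert i I)
    have [measurable]: "\<xi> j \<in> borel_measurable M" if "j \<in> insert i I" for j
      using insert.prems(1) that by (auto simp: indep_vars_def)
    define S where "S x = (\<Sum>i\<in>I. \<xi> i x)" for x
    have [measurable]: "S \<in> borel_measurable M" "\<xi> i \<in> borel_measurable M"
      unfolding S_def by auto
    have ind: "indep_var borel (\<xi> i) borel S"
      unfolding S_def by (rule indep_vars_sum) (use insert in auto)
    have IH: "expectation S = 0" "expectation (\<lambda>x. (S x)\<^sup>2) \<le> K\<^sup>2 * real (card I)"
        "expectation (\<lambda>x. (S x)^4) \<le> 3 * K^4 * (real (card I))\<^sup>2"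
      unfolding S_def using insert.IH insert.prems indep_vars_subset[OF insert.prems(1), of I] by auto
    have x_bd: "\<bar>\<xi> i x\<bar> \<le> K" for x using insert.prems by auto
    have S_bd: "\<bar>S x\<bar> \<le> real (card I) * K" for x
      unfolding S_def by (rule order_trans[OF sum_abs]) (use insert.prems in \<open>auto intro!: sum_bounded_above\<close>)
    have int: "integrable M (\<lambda>x. (\<xi> i x)^p)" for p
      by (rule integrable_const_bound[where B="K^p"]) (use x_bd in \<open>auto simp: power_abs intro!: power_mono\<close>)
    have intS: "integrable M (\<lambda>x. (S x)^p)" for p
      by (rule integrable_const_bound[where B="(real (card I) * K)^p"])
        (use S_bd in \<open>auto simp: power_abs intro!: power_mono\<close>)
    have prod: "expectation (\<lambda>x. (\<xi> i x)^p * (S x)^q) = expectation (\<lambda>x. (\<xi> i x)^p) * expectation (\<lambda>x. (S x)^q)"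
      and prodi: "integrable M (\<lambda>x. (\<xi> i x)^p * (S x)^q)" for p q
    proof -
      have "indep_var borel ((\<lambda>z. z^p) \<circ> \<xi> i) borel ((\<lambda>z. z^q) \<circ> S)"
        by (rule indep_var_compose[OF ind]) auto
      then have iv: "indep_var borel (\<lambda>x. (\<xi> i x)^p) borel (\<lambda>x. (S x)^q)" by (simp add: comp_def)
      show "expectation (\<lambda>x. (\<xi> i x)^p * (S x)^q) = expectation (\<lambda>x. (\<xi> i x)^p) * expectation (\<lambda>x. (S x)^q)"
        by (rule indep_var_lebesgue_integral[OF iv int intS])
      show "integrable M (\<lambda>x. (\<xi> i x)^p * (S x)^q)"
        by (rule indep_var_integrable[OF iv int intS])
    qed
    have K0: "K \<ge> 0" using x_bd[of undefined] by linarith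
    have mom: "expectation (\<lambda>x. (\<xi> i x)^p) \<le> K^p" for p
    proof -
      have "(\<xi> i x)^p \<le> K^p" for x
        using power_mono[OF x_bd, of x p] abs_ge_self[of "\<xi> i x ^ p"] by (simp add: power_abs)
      then have "expectation (\<lambda>x. (\<xi> i x)^p) \<le> expectation (\<lambda>x. K^p)"
        by (intro integral_mono int) auto
      then show ?thesis by (simp add: prob_space)
    qed
    have sum: "(\<Sum>j\<in>insert i I. \<xi> j x) = \<xi> i x + S x" for x
      using insert.hyps by (simp add: S_def)
    have card: "real (card (insert i I)) = real (card I) + 1" using insert.hyps by simp
    have mean_i: "expectation (\<xi> i) = 0" using insert.prems by auto
    have e1: "expectation (\<lambda>x. \<xi> i x + S x) = 0"
      using int[of 1] intS[of 1] IH(1) mean_i by simp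
    have "expectation (\<lambda>x. (\<xi> i x + S x)\<^sup>2) = expectation (\<lambda>x. (\<xi> i x)^2 + 2 * ((\<xi> i x)^1 * (S x)^1) + (S x)\<^sup>2)"
      by (intro Bochner_Integration.integral_cong) (auto simp: power2_eq_square algebra_simps)
    also have "\<dots> = expectation (\<lambda>x. (\<xi> i x)^2) + 2 * expectation (\<lambda>x. (\<xi> i x)^1 * (S x)^1) + expectation (\<lambda>x. (S x)\<^sup>2)"
      using int[of 2] intS[of 2] prodi[of 1 1] by simp
    also have "\<dots> \<le> K^2 + K\<^sup>2 * real (card I)"
      using mom[of 2] IH(2) prod[of 1 1] mean_i by simp
    finally have e2: "expectation (\<lambda>x. (\<xi> i x + S x)\<^sup>2) \<le> K^2 * real (card (insert i I))"
      unfolding card by (simp add: algebra_simps)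
    have "expectation (\<lambda>x. (\<xi> i x + S x)^4) = expectation (\<lambda>x. (\<xi> i x)^4 + 4 * ((\<xi> i x)^3 * (S x)^1)
        + 6 * ((\<xi> i x)^2 * (S x)^2) + 4 * ((\<xi> i x)^1 * (S x)^3) + (S x)^4)"
      by (intro Bochner_Integration.integral_cong) (auto simp: power2_eq_square power3_eq_cube power4_eq_xxxx algebra_simps)
    also have "\<dots> = expectation (\<lambda>x. (\<xi> i x)^4) + 4 * expectation (\<lambda>x. (\<xi> i x)^3 * (S x)^1)
        + 6 * expectation (\<lambda>x. (\<xi> i x)^2 * (S x)^2) + 4 * expectation (\<lambda>x. (\<xi> i x)^1 * (S x)^3) + expectation (\<lambda>x. (S x)^4)"
      using int[of 4] intS[of 4] prodi[of 3 1] prodi[of 2 2] prodi[of 1 3] by simp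
    also have "\<dots> = expectation (\<lambda>x. (\<xi> i x)^4)
        + 6 * (expectation (\<lambda>x. (\<xi> i x)^2) * expectation (\<lambda>x. (S x)^2)) + expectation (\<lambda>x. (S x)^4)"
      unfolding prod using IH(1) mean_i by simp
    also have "\<dots> \<le> K^4 + 6 * (K^2 * (K\<^sup>2 * real (card I))) + 3 * K^4 * (real (card I))\<^sup>2"
      using mom[of 4] IH(3) mult_mono[OF mom[of 2] IH(2)] K0 by simp
    \<comment> \<open>With n the number of earlier summands this compares 1 + 6 n + 3 n^2 with 3 (n
      + 1)^2; the constant 3 is what absorbs the mixed term 6 n.\<close>
    also have "\<dots> \<le> 3 * K^4 * (real (card I) + 1)\<^sup>2"
      using K0 by (simp add: power2_eq_square power4_eq_xxxx algebra_simps)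
    finally have e4: "expectation (\<lambda>x. (\<xi> i x + S x)^4) \<le> 3 * K^4 * (real (card (insert i I)))\<^sup>2"
      unfolding card .
    show ?case unfolding sum using e1 e2 e4 by blast
  qed
  then show ?thesis by blast
qed

text \<open>Used with \<phi> a distance between integers, which takes each value a bounded number of
  times; the sum over \<open>T\<close> is then bounded independently of the size of
  \<open>T\<close>.\<close>

lemma fiber_sum_le:
  fixes \<tau> :: "nat \<Rightarrow> real"
  assumes "finite T" "summable \<tau>" "\<And>r. 0 \<le> \<tau> r" "\<And>r. card {t\<in>T. \<phi> t = r} \<le> c"
  shows "(\<Sum>t\<in>T. \<tau> (\<phi> t)) \<le> real c * suminf \<tau>"
proof -
  have "(\<Sum>t\<in>T. \<tau> (\<phi> t)) = (\<Sum>r\<in>\<phi> ` T. \<Sum>t | t \<in> T \<and> \<phi> t = r. \<tau> (\<phi> t))"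
    using assms(1) by (rule sum.image_gen)
  also have "\<dots> = (\<Sum>r\<in>\<phi> ` T. real (card {t\<in>T. \<phi> t = r}) * \<tau> r)"
    by (intro sum.cong refl) simp
  also have "\<dots> \<le> (\<Sum>r\<in>\<phi> ` T. real c * \<tau> r)"
    using assms by (intro sum_mono mult_right_mono) auto
  also have "\<dots> = real c * (\<Sum>r\<in>\<phi> ` T. \<tau> r)" by (simp add: sum_distrib_left)
  also have "\<dots> \<le> real c * suminf \<tau>"
    using assms by (intro mult_left_mono sum_le_suminf) auto
  finally show ?thesis .
qed

section \<open>Second moments of partial sums\<close>

context noise
begin

lemma CE_const: "CE A (\<lambda>x. c) = (\<lambda>x. c)"
  by (rule CE_depends[of "{}"]) (auto simp: depends_def)

lemma wdep_diff:
  assumes F: "wdep \<tau> F" and G: "wdep \<tau>' G"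
  shows "wdep (\<lambda>r. \<tau> r + \<tau>' r) (\<lambda>x. F x - G x)"
  unfolding wdep_def
proof (intro conjI allI impI)
  note L2 = wdep_L2[OF F] wdep_L2[OF G]
  have [measurable]: "F \<in> borel_measurable P" "G \<in> borel_measurable P"
    using L2 by (auto simp: L2_measurable)
  show "L2 P (\<lambda>x. F x - G x)" by (intro L2_diff L2)
  fix r and A :: "int set" assume A: "{- int r..int r} \<subseteq> A"
  have "nrm P (\<lambda>x. F x - G x - CE A (\<lambda>x. F x - G x) x) =
      nrm P (\<lambda>x. (F x - CE A F x) - (G x - CE A G x))"
    using CE_diff[OF L2, of A] by (intro nrm_cong_AE) auto
  also have "\<dots> \<le> nrm P (\<lambda>x. F x - CE A F x) + nrm P (\<lambda>x. G x - CE A G x)"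
    by (intro nrm_triangle_diff L2_diff L2_CE L2)
  also have "\<dots> \<le> \<tau> r + \<tau>' r"
    using wdepD[OF F A] wdepD[OF G A] by simp
  finally show "nrm P (\<lambda>x. F x - G x - CE A (\<lambda>x. F x - G x) x) \<le> \<tau> r + \<tau>' r" .
qed

lemma wdep_diff_const:
  assumes "wdep \<tau> F"
  shows "wdep \<tau> (\<lambda>x. F x - c)"
proof -
  have "wdep (\<lambda>r. 0) (\<lambda>x. c)"
    by (simp add: wdep_def CE_const P.L2_const nrm_def)
  from wdep_diff[OF assms this] show ?thesis by simp
qed

text \<open>Averaging does not commute with \<open>\<phi>\<close>. The detour goes through \<phi> of
  the average, which depends on \<open>A\<close> only and is within \<tau> r; averaging \<phi>(F)
  itself can at most double that error.\<close>

lemma wdep_lipschitz: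
  assumes F: "wdep \<tau> F" and \<phi>: "\<And>a b. \<bar>\<phi> a - \<phi> b\<bar> \<le> \<bar>a - b\<bar>"
    and [measurable]: "\<phi> \<in> borel_measurable borel"
  shows "wdep (\<lambda>r. 2 * \<tau> r) (\<lambda>x. \<phi> (F x))"
  unfolding wdep_def
proof (intro conjI allI impI)
  note L2 = wdep_L2[OF F]
  have [measurable]: "F \<in> borel_measurable P"
    using L2 by (auto simp: L2_measurable)
  have L2_comp: "L2 P (\<lambda>x. \<phi> (G x))" if "L2 P G" for G
  proof (rule L2_bound(1))
    show "L2 P (\<lambda>x. \<bar>G x\<bar> + \<bar>\<phi> 0\<bar>)" by (intro L2_add L2_abs that P.L2_const)
    show "(\<lambda>x. \<phi> (G x)) \<in> borel_measurable P" using L2_measurable[OF that] by simp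
    show "AE x in P. \<bar>\<phi> (G x)\<bar> \<le> \<bar>\<bar>G x\<bar> + \<bar>\<phi> 0\<bar>\<bar>"
    proof (rule AE_I2)
      fix x show "\<bar>\<phi> (G x)\<bar> \<le> \<bar>\<bar>G x\<bar> + \<bar>\<phi> 0\<bar>\<bar>" using \<phi>[of "G x" 0] by simp
    qed
  qed
  show "L2 P (\<lambda>x. \<phi> (F x))" by (rule L2_comp[OF L2])
  fix r and A :: "int set" assume A: "{- int r..int r} \<subseteq> A"
  define H where "H x = \<phi> (CE A F x)" for x
  have H: "L2 P H" unfolding H_def[abs_def] by (intro L2_comp L2_CE L2)
  have dH: "depends A H"
    using depends_CE[of A F] unfolding depends_def H_def by metis
  have "nrm P (\<lambda>x. \<phi> (F x) - H x) \<le> nrm P (\<lambda>x. F x - CE A F x)"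
  proof (rule L2_bound(2))
    show "L2 P (\<lambda>x. F x - CE A F x)" by (intro L2_diff L2_CE L2)
    show "(\<lambda>x. \<phi> (F x) - H x) \<in> borel_measurable P" by (simp add: H_def)
    show "AE x in P. \<bar>\<phi> (F x) - H x\<bar> \<le> \<bar>F x - CE A F x\<bar>"
      by (rule AE_I2) (simp add: H_def \<phi>)
  qed
  also have "\<dots> \<le> \<tau> r" by (rule wdepD[OF F A])
  finally have 1: "nrm P (\<lambda>x. \<phi> (F x) - H x) \<le> \<tau> r" .
  have "nrm P (\<lambda>x. \<phi> (F x) - CE A (\<lambda>x. \<phi> (F x)) x) \<le>
      nrm P (\<lambda>x. \<phi> (F x) - H x) + nrm P (\<lambda>x. H x - CE A (\<lambda>x. \<phi> (F x)) x)"
    by (intro nrm_triangle3 L2_comp L2 H L2_CE)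
  also have "nrm P (\<lambda>x. H x - CE A (\<lambda>x. \<phi> (F x)) x) = nrm P (\<lambda>x. CE A H x - CE A (\<lambda>x. \<phi> (F x)) x)"
    by (simp add: CE_depends[OF dH])
  also have "\<dots> \<le> nrm P (\<lambda>x. H x - \<phi> (F x))"
    by (intro nrm_CE_diff_le H L2_comp L2)
  finally show "nrm P (\<lambda>x. \<phi> (F x) - CE A (\<lambda>x. \<phi> (F x)) x) \<le> 2 * \<tau> r"
    using 1 by (simp add: nrm_commute[of P H])
qed

text \<open>Averaging operators commute almost everywhere and contract, so averaging over other
  noise cannot spoil the rate.\<close>

lemma wdep_CE:
  assumes F: "wdep \<tau> F"
  shows "wdep \<tau> (CE B F)"
  unfolding wdep_def
proof (intro conjI allI impI)
  note L2 = wdep_L2[OF F]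
  have [measurable]: "F \<in> borel_measurable P"
    using L2 by (auto simp: L2_measurable)
  show "L2 P (CE B F)" by (intro L2_CE L2)
  fix r and A :: "int set" assume A: "{- int r..int r} \<subseteq> A"
  have "nrm P (\<lambda>x. CE B F x - CE A (CE B F) x) = nrm P (\<lambda>x. CE B F x - CE B (CE A F) x)"
  proof (intro nrm_cong_AE)
    show "AE x in P. CE B F x - CE A (CE B F) x = CE B F x - CE B (CE A F) x"
      using CE_CE[OF L2, of A B] CE_CE[OF L2, of B A] unfolding Int_commute[of B A]
      by eventually_elim simp
  qed simp_all
  also have "\<dots> \<le> nrm P (\<lambda>x. F x - CE A F x)" by (intro nrm_CE_diff_le L2 L2_CE)
  also have "\<dots> \<le> \<tau> r" by (rule wdepD[OF F A])
  finally show "nrm P (\<lambda>x. CE B F x - CE A (CE B F) x) \<le> \<tau> r" .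
qed

lemma wdep_shift_bound:
  assumes F: "wdep \<tau> F" and A: "{t - int r..t + int r} \<subseteq> A"
  shows "nrm P (\<lambda>x. F (shift t x) - CE A (\<lambda>x. F (shift t x)) x) \<le> \<tau> r"
proof -
  have [measurable]: "F \<in> borel_measurable P"
    using wdep_L2[OF F] by (auto simp: L2_measurable)
  have "nrm P (\<lambda>x. F (shift t x) - CE A (\<lambda>x. F (shift t x)) x) =
      nrm P (\<lambda>x. F x - CE {u. u + t \<in> A} F x)"
    using nrm_shift[of "\<lambda>x. F x - CE {u. u + t \<in> A} F x" t] by (simp add: CE_shift)
  also have "\<dots> \<le> \<tau> r" using A by (intro wdepD[OF F]) auto
  finally show ?thesis .
qed

text \<open>Each factor is replaced by its average given a window of noise around its own index. The
  windows are disjoint, so the product of the averages integrates to 0 by independence and centring;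
  each of the two replacements costs at most nrm P F times \<tau> r.\<close>

lemma covariance_bound:
  assumes F: "wdep \<tau> F" and mean: "(\<integral>x. F x \<partial>P) = 0" and st: "s \<noteq> t"
  shows "\<bar>\<integral>x. F (shift s x) * F (shift t x) \<partial>P\<bar> \<le> 2 * nrm P F * \<tau> (nat ((\<bar>t - s\<bar> - 1) div 2))"
proof -
  \<comment> \<open>The largest radius with 2 r < |t - s|, for which the windows are still
    disjoint.\<close>
  define r where "r = nat ((\<bar>t - s\<bar> - 1) div 2)"
  define A where "A = {s - int r..s + int r}"
  define B where "B = {t - int r..t + int r}"
  define Fs where "Fs x = F (shift s x)" for x
  define Ft where "Ft x = F (shift t x)" for x
  have r: "2 * int r < \<bar>t - s\<bar>" using st unfolding r_def by linarith
  have AB: "A \<inter> B = {}" using r by (auto simp: A_def B_def)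
  have [measurable]: "F \<in> borel_measurable P"
    using wdep_L2[OF F] by (auto simp: L2_measurable)
  have L2: "L2 P Fs" "L2 P Ft"
    unfolding Fs_def[abs_def] Ft_def[abs_def] by (intro L2_shift wdep_L2[OF F])+
  have [measurable]: "Fs \<in> borel_measurable P" "Ft \<in> borel_measurable P"
    using L2 by (auto simp: L2_measurable)
  have nrm: "nrm P Fs = nrm P F" "nrm P Ft = nrm P F"
    unfolding Fs_def Ft_def by (simp_all add: nrm_shift)
  have "(\<integral>x. CE A Fs x \<partial>P) = 0"
    unfolding integral_CE[OF L2(1)] Fs_def using mean by (simp add: integral_shift)
  then have zero: "(\<integral>x. CE A Fs x * CE B Ft x \<partial>P) = 0"
    using integral_mult_depends[OF _ depends_CE _ _ depends_CE _ AB, of Fs Ft]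
    by (simp add: P.L2_integrable L2_CE L2)
  have "(\<integral>x. Fs x * Ft x \<partial>P) = (\<integral>x. (Fs x - CE A Fs x) * Ft x + CE A Fs x * (Ft x - CE B Ft x) + CE A Fs x * CE B Ft x \<partial>P)"
    by (intro Bochner_Integration.integral_cong) (auto simp: algebra_simps)
  also have "\<dots> = (\<integral>x. (Fs x - CE A Fs x) * Ft x \<partial>P) + (\<integral>x. CE A Fs x * (Ft x - CE B Ft x) \<partial>P) + (\<integral>x. CE A Fs x * CE B Ft x \<partial>P)"
  proof -
    have "integrable P (\<lambda>x. (Fs x - CE A Fs x) * Ft x)" "integrable P (\<lambda>x. CE A Fs x * (Ft x - CE B Ft x))"
      "integrable P (\<lambda>x. CE A Fs x * CE B Ft x)"
      by (intro L2_mult_integrable L2_diff L2_CE L2)+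
    then show ?thesis by simp
  qed
  finally have "\<bar>\<integral>x. Fs x * Ft x \<partial>P\<bar> \<le> \<bar>\<integral>x. (Fs x - CE A Fs x) * Ft x \<partial>P\<bar> + \<bar>\<integral>x. CE A Fs x * (Ft x - CE B Ft x) \<partial>P\<bar>"
    using zero by linarith
  also have "\<bar>\<integral>x. (Fs x - CE A Fs x) * Ft x \<partial>P\<bar> \<le> nrm P (\<lambda>x. Fs x - CE A Fs x) * nrm P Ft"
    by (intro cauchy_schwarz_integral L2_diff L2_CE L2)
  also have "\<dots> \<le> \<tau> r * nrm P F"
    using wdep_shift_bound[OF F, of s r A] by (intro mult_mono) (auto simp: A_def Fs_def[symmetric] nrm wdep_nonneg[OF F])
  also have "\<bar>\<integral>x. CE A Fs x * (Ft x - CE B Ft x) \<partial>P\<bar> \<le> nrm P (CE A Fs) * nrm P (\<lambda>x. Ft x - CE B Ft x)"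
    by (intro cauchy_schwarz_integral L2_diff L2_CE L2)
  also have "\<dots> \<le> nrm P F * \<tau> r"
    using wdep_shift_bound[OF F, of t r B] nrm_CE_le[OF L2(1), of A] by (intro mult_mono) (auto simp: B_def Ft_def[symmetric] nrm)
  finally show ?thesis by (simp add: r_def Fs_def Ft_def algebra_simps)
qed

text \<open>The 8 is the 2 of \<open>covariance_bound\<close> times 4, since for fixed
  \<open>s\<close> the radius r belongs to the four indices with |t - s| equal to 2 r + 1 or 2 r +
  2. The off-diagonal part is linear in the norm of \<open>F\<close>, so a small norm makes the
  bound small even when the sum of \<tau> does not shrink.\<close>

lemma variance_bound:
  assumes F: "wdep \<tau> F" and sm: "summable \<tau>" and mean: "(\<integral>x. F x \<partial>P) = 0" and T: "finite T"
  shows "(\<integral>x. (\<Sum>t\<in>T. F (shift t x))\<^sup>2 \<partial>P) \<le> real (card T) * ((nrm P F)\<^sup>2 + 8 * nrm P F * suminf \<tau>)"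
proof -
  have L2: "L2 P (\<lambda>x. F (shift t x))" for t
    by (intro L2_shift wdep_L2[OF F])
  have "(\<integral>x. (\<Sum>t\<in>T. F (shift t x))\<^sup>2 \<partial>P) = (\<integral>x. (\<Sum>s\<in>T. \<Sum>t\<in>T. F (shift s x) * F (shift t x)) \<partial>P)"
    by (simp add: power2_eq_square sum_product)
  also have "\<dots> = (\<Sum>s\<in>T. \<Sum>t\<in>T. \<integral>x. F (shift s x) * F (shift t x) \<partial>P)"
    by (simp add: L2_mult_integrable[OF L2 L2])
  also have "\<dots> \<le> (\<Sum>s\<in>T. (nrm P F)\<^sup>2 + 8 * nrm P F * suminf \<tau>)"
  proof (rule sum_mono)
    fix s assume s: "s \<in> T"
    have "(\<Sum>t\<in>T. \<integral>x. F (shift s x) * F (shift t x) \<partial>P) =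
        (\<integral>x. F (shift s x) * F (shift s x) \<partial>P) + (\<Sum>t\<in>T - {s}. \<integral>x. F (shift s x) * F (shift t x) \<partial>P)"
      by (rule sum.remove[OF T s])
    also have "(\<integral>x. F (shift s x) * F (shift s x) \<partial>P) = (nrm P F)\<^sup>2"
      using nrm_shift[of F s] wdep_L2[OF F]
      by (simp add: nrm_sq[symmetric] power2_eq_square[symmetric] L2_measurable)
    also have "(\<Sum>t\<in>T - {s}. \<integral>x. F (shift s x) * F (shift t x) \<partial>P) \<le>
        (\<Sum>t\<in>T - {s}. 2 * nrm P F * \<tau> (nat ((\<bar>t - s\<bar> - 1) div 2)))"
      by (intro sum_mono order_trans[OF abs_ge_self covariance_bound[OF F mean]]) auto
    also have "\<dots> = 2 * nrm P F * (\<Sum>t\<in>T - {s}. \<tau> (nat ((\<bar>t - s\<bar> - 1) div 2)))"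
      by (simp add: sum_distrib_left)
    also have "\<dots> \<le> 2 * nrm P F * (real 4 * suminf \<tau>)"
    proof (intro mult_left_mono fiber_sum_le sm wdep_nonneg[OF F])
      show "finite (T - {s})" using T by simp
      fix r
      have "{t \<in> T - {s}. nat ((\<bar>t - s\<bar> - 1) div 2) = r} \<subseteq>
          set [s + 2 * int r + 1, s + 2 * int r + 2, s - 2 * int r - 1, s - 2 * int r - 2]"
      proof
        fix t assume "t \<in> {t \<in> T - {s}. nat ((\<bar>t - s\<bar> - 1) div 2) = r}"
        then have ts: "t \<noteq> s" "nat ((\<bar>t - s\<bar> - 1) div 2) = r" by auto
        then have "(\<bar>t - s\<bar> - 1) div 2 = int r" by linarith
        then have "\<bar>t - s\<bar> = 2 * int r + 1 \<or> \<bar>t - s\<bar> = 2 * int r + 2" by linarith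
        then show "t \<in> set [s + 2 * int r + 1, s + 2 * int r + 2, s - 2 * int r - 1, s - 2 * int r - 2]"
          by (simp add: abs_if split: if_splits) linarith+
      qed
      from card_mono[OF _ this] card_length[of "[s + 2 * int r + 1, s + 2 * int r + 2, s - 2 * int r - 1, s - 2 * int r - 2]"]
      show "card {t \<in> T - {s}. nat ((\<bar>t - s\<bar> - 1) div 2) = r} \<le> 4" by simp
    qed simp
    finally show "(\<Sum>t\<in>T. \<integral>x. F (shift s x) * F (shift t x) \<partial>P) \<le> (nrm P F)\<^sup>2 + 8 * nrm P F * suminf \<tau>"
      by simp
  qed
  finally show ?thesis by simp
qed

section \<open>Normalised partial sums\<close>

definition nsum :: "((int \<Rightarrow> real) \<Rightarrow> real) \<Rightarrow> nat \<Rightarrow> (int \<Rightarrow> real) \<Rightarrow> real" where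
  "nsum F l x = 1 / sqrt (real l) * (\<Sum>t\<in>{1..int l}. F (shift t x))"

lemma L2_nsum: "L2 P F \<Longrightarrow> L2 P (nsum F l)"
  unfolding nsum_def[abs_def] by (intro L2_cmult L2_sum L2_shift)

lemma nrm_nsum_le:
  assumes F: "wdep \<tau> F" and sm: "summable \<tau>" and mean: "(\<integral>x. F x \<partial>P) = 0"
  shows "nrm P (nsum F l) \<le> sqrt ((nrm P F)\<^sup>2 + 8 * nrm P F * suminf \<tau>)"
proof (cases "l = 0")
  case True
  then show ?thesis
    using suminf_nonneg[OF sm wdep_nonneg[OF F]] by (simp add: nsum_def nrm_def)
next
  case False
  have "(\<integral>x. (nsum F l x)\<^sup>2 \<partial>P) = 1 / real l * (\<integral>x. (\<Sum>t\<in>{1..int l}. F (shift t x))\<^sup>2 \<partial>P)"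
    by (simp add: nsum_def power_divide)
  also have "\<dots> \<le> 1 / real l * (real (card {1..int l}) * ((nrm P F)\<^sup>2 + 8 * nrm P F * suminf \<tau>))"
    by (intro mult_left_mono variance_bound F sm mean) auto
  also have "\<dots> = (nrm P F)\<^sup>2 + 8 * nrm P F * suminf \<tau>" using False by simp
  finally show ?thesis unfolding nrm_def by (rule real_sqrt_le_mono)
qed

text \<open>Within one residue class modulo 2 q + 1 the windows of radius q are disjoint, so the
  summands are independent and the fourth moment bound applies. The number of classes does not
  depend on the length of the sum.\<close>

lemma ui2_nsum_finite_range:
  assumes [measurable]: "Q \<in> borel_measurable P" and dep: "depends {- int q..int q} Q"
    and bd: "\<And>x. \<bar>Q x\<bar> \<le> c" and mean: "(\<integral>x. Q x \<partial>P) = 0"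
  shows "ui2 P (nsum Q)"
proof -
  define d where "d = 2 * int q + 1"
  have d: "d > 0" by (simp add: d_def)
  define T where "T l r = {t\<in>{1..int l}. t mod d = r}" for l r
  define S where "S r l x = 1 / sqrt (real l) * (\<Sum>t\<in>T l r. Q (shift t x))" for r l x
  have Q2: "L2 P Q" using bd by (intro P.L2_bounded[of _ c]) auto
  have S2: "L2 P (S r l)" for r l
    unfolding S_def[abs_def] by (intro L2_cmult L2_sum L2_shift Q2)
  have split: "nsum Q = (\<lambda>l x. \<Sum>r\<in>{0..<d}. S r l x)"
  proof (intro ext)
    fix l x
    have "(\<Sum>t\<in>{1..int l}. Q (shift t x)) = (\<Sum>r\<in>{0..<d}. \<Sum>t\<in>T l r. Q (shift t x))"
      unfolding T_def using d by (intro sum.group[symmetric]) auto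
    then show "nsum Q l x = (\<Sum>r\<in>{0..<d}. S r l x)"
      by (simp add: nsum_def S_def sum_distrib_left)
  qed
  have "ui2 P (S r)" for r
  proof (rule ui2_fourth_moment[where K="3 * c ^ 4"])
    fix l
    show [measurable]: "S r l \<in> borel_measurable P" using S2 by (rule L2_measurable)
    have finT: "finite (T l r)" unfolding T_def by (rule finite_subset[of _ "{1..int l}"]) auto
    have "\<bar>\<Sum>t\<in>T l r. Q (shift t x)\<bar> \<le> real (card (T l r)) * c" for x
      by (rule order_trans[OF sum_abs]) (auto intro!: sum_bounded_above bd)
    then have "\<bar>(\<Sum>t\<in>T l r. Q (shift t x)) ^ 4\<bar> \<le> (real (card (T l r)) * c) ^ 4" for x
      unfolding power_abs by (intro power_mono) auto
    then have int: "integrable P (\<lambda>x. (\<Sum>t\<in>T l r. Q (shift t x)) ^ 4)"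
      by (intro P.integrable_const_bound[of _ "(real (card (T l r)) * c) ^ 4"]) auto
    have eq: "(S r l x)^4 = 1 / (real l)\<^sup>2 * (\<Sum>t\<in>T l r. Q (shift t x)) ^ 4" for x
    proof -
      have "(sqrt (real l)) ^ 4 = ((sqrt (real l))\<^sup>2)\<^sup>2" by (simp only: power_mult[symmetric])  simp
      then show ?thesis by (simp add: S_def power_mult_distrib power_divide)
    qed
    then show "integrable P (\<lambda>x. (S r l x)^4)" using int by simp
    have ind: "P.indep_vars (\<lambda>_. borel) (\<lambda>t x. Q (shift t x)) (T l r)"
    proof (rule indep_depends)
      show "(\<lambda>x. Q (shift t x)) \<in> borel_measurable P" for t by simp
      show "depends {t - int q..t + int q} (\<lambda>x. Q (shift t x))" for t
        unfolding depends_def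
      proof (intro allI impI)
        fix x y :: "int \<Rightarrow> real" assume "\<forall>u\<in>{t - int q..t + int q}. x u = y u"
        then show "Q (shift t x) = Q (shift t y)"
          by (intro dep[unfolded depends_def, rule_format]) (auto simp: shift_def)
      qed
      show "disjoint_family_on (\<lambda>t. {t - int q..t + int q}) (T l r)"
        unfolding disjoint_family_on_def
      proof (intro ballI impI)
        fix s t assume st: "s \<in> T l r" "t \<in> T l r" "s \<noteq> t"
        then have "d dvd s - t" by (auto simp: T_def mod_eq_dvd_iff[symmetric])
        with st(3) have "\<bar>s - t\<bar> \<ge> d"
          using dvd_imp_le_int[of "s - t" d] by (simp add: d_def)
        then show "{s - int q..s + int q} \<inter> {t - int q..t + int q} = {}" by (auto simp: d_def)
      qed
    qed
    have card: "card (T l r) \<le> l"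
    proof -
      have "T l r \<subseteq> {1..int l}" by (auto simp: T_def)
      from card_mono[OF _ this] show ?thesis by simp
    qed
    have c0: "c \<ge> 0" using bd[of undefined] by linarith
    have "(\<integral>x. (S r l x)^4 \<partial>P) = 1 / (real l)\<^sup>2 * (\<integral>x. (\<Sum>t\<in>T l r. Q (shift t x)) ^ 4 \<partial>P)"
      by (simp add: eq)
    also have "\<dots> \<le> 1 / (real l)\<^sup>2 * (3 * c ^ 4 * (real (card (T l r)))\<^sup>2)"
      using bd mean by (intro mult_left_mono P.fourth_moment_indep_sum finT ind) (auto simp: integral_shift)
    also have "\<dots> \<le> 1 / (real l)\<^sup>2 * (3 * c ^ 4 * (real l)\<^sup>2)"
      using card c0 by (intro mult_left_mono power_mono) auto
    also have "\<dots> \<le> 3 * c ^ 4" using c0 by (cases "l = 0") auto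
    finally show "(\<integral>x. (S r l x)^4 \<partial>P) \<le> 3 * c ^ 4" .
  qed
  then show ?thesis unfolding split by (intro ui2_sum S2)
qed

end

section \<open>Uniform integrability of partial sums and a triangular central limit theorem\<close>

lemma excess_small:
  assumes G: "L2 M G" and "e > 0"
  shows "\<exists>c>0. nrm M (\<lambda>x. excess c (G x)) \<le> e"
proof -
  have [measurable]: "G \<in> borel_measurable M" using G by (rule L2_measurable)
  have "(\<lambda>n. \<integral>x. (excess (real n) (G x))\<^sup>2 \<partial>M) \<longlonglongrightarrow> (\<integral>x. 0 \<partial>M)"
  proof (rule integral_dominated_convergence[where w="\<lambda>x. (G x)\<^sup>2"])
    show "integrable M (\<lambda>x. (G x)\<^sup>2)" using G by (rule L2_sq_integrable)
    show "AE x in M. (\<lambda>n. (excess (real n) (G x))\<^sup>2) \<longlonglongrightarrow> 0"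
    proof (rule AE_I2)
      fix x
      have "\<forall>\<^sub>F n in sequentially. (excess (real n) (G x))\<^sup>2 = 0"
        using eventually_ge_at_top[of "nat \<lceil>\<bar>G x\<bar>\<rceil>"]
        proof eventually_elim
          case (elim n)
          then have "\<bar>G x\<bar> \<le> real n" by linarith
          then show ?case by (simp add: excess_def)
        qed
      then show "(\<lambda>n. (excess (real n) (G x))\<^sup>2) \<longlonglongrightarrow> 0" by (rule tendsto_eventually)
    qed
    show "AE x in M. norm ((excess (real n) (G x))\<^sup>2) \<le> (G x)\<^sup>2" for n
      using excess_le_abs[of "real n"] by (intro AE_I2) (simp add: abs_le_square_iff[symmetric])
  qed simp_all
  then have "(\<lambda>n. nrm M (\<lambda>x. excess (real n) (G x))) \<longlonglongrightarrow> 0"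
    unfolding nrm_def using tendsto_real_sqrt by fastforce
  from order_tendstoD(2)[OF this \<open>e > 0\<close>]
  have "\<forall>\<^sub>F n in sequentially. nrm M (\<lambda>x. excess (real n) (G x)) < e \<and> n > 0"
    using eventually_gt_at_top[of 0] by eventually_elim simp
  then obtain n where "nrm M (\<lambda>x. excess (real n) (G x)) < e" "n > 0"
    by (rule eventually_happens'[OF sequentially_bot, THEN exE]) auto
  then show ?thesis by (intro exI[of _ "real n"]) auto
qed

lemma cesaro_mean:
  fixes u :: "nat \<Rightarrow> real"
  assumes "u \<longlonglongrightarrow> L"
  shows "(\<lambda>n. (\<Sum>k<n. u k) / real n) \<longlonglongrightarrow> L"
proof (rule LIMSEQ_I)
  fix e :: real assume "e > 0"
  then obtain N where N: "\<And>k. k \<ge> N \<Longrightarrow> \<bar>u k - L\<bar> < e / 2"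
    using LIMSEQ_D[OF assms, of "e / 2"] by auto
  define B where "B = (\<Sum>k<N. \<bar>u k - L\<bar>)"
  have "\<bar>(\<Sum>k<n. u k) / real n - L\<bar> < e" if n: "n \<ge> nat \<lceil>2 * B / e\<rceil> + 1" for n
  proof -
    have n0: "real n > 0" using n by simp
    have nB: "B < real n * e / 2" 
    proof -
      have "2 * B / e < real n" using n by linarith
      then show ?thesis using \<open>e > 0\<close> by (simp add: field_simps)
    qed
    have "\<bar>(\<Sum>k<n. u k) - real n * L\<bar> = \<bar>\<Sum>k<n. u k - L\<bar>" by (simp add: sum_subtractf)
    also have "\<dots> \<le> (\<Sum>k<n. \<bar>u k - L\<bar>)" by (rule sum_abs)
    also have "\<dots> \<le> (\<Sum>k<n. (if k < N then \<bar>u k - L\<bar> else 0) + e / 2)"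
      using N \<open>e > 0\<close> by (intro sum_mono) (auto simp: not_less intro: less_imp_le)
    also have "\<dots> = (\<Sum>k | k < n \<and> k < N. \<bar>u k - L\<bar>) + real n * e / 2"
      by (simp add: sum.distrib sum.If_cases lessThan_def Collect_conj_eq)
    also have "(\<Sum>k | k < n \<and> k < N. \<bar>u k - L\<bar>) \<le> B"
      unfolding B_def by (intro sum_mono2) auto
    finally have "\<bar>(\<Sum>k<n. u k) - real n * L\<bar> < real n * e" using nB by linarith
    moreover have "(\<Sum>k<n. u k) / real n - L = ((\<Sum>k<n. u k) - real n * L) / real n"
      using n0 by (simp add: field_simps)
    ultimately show ?thesis using n0 by (simp add: abs_divide field_simps)
  qed
  then show "\<exists>no. \<forall>n\<ge>no. norm ((\<Sum>k<n. u k) / real n - L) < e" by auto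
qed

lemma shift_shift: "shift a (shift b x) = shift (a + b) x"
  by (simp add: shift_def add.assoc)

context noise
begin

text \<open>\<open>F\<close> is averaged to a finite window, clipped and recentred. The remainder
  has small norm, while its rate stays below three times \<tau> whatever the window and the level;
  \<open>variance_bound\<close> then makes its normalised sums small uniformly in the
  length.\<close>

lemma ui2_nsum:
  assumes F: "wdep \<tau> F" and sm: "summable \<tau>" and mean: "(\<integral>x. F x \<partial>P) = 0"
  shows "ui2 P (nsum F)"
proof (rule ui2_approx)
  note L2 = wdep_L2[OF F]
  have [measurable]: "F \<in> borel_measurable P" using L2 by (rule L2_measurable)
  show "L2 P (nsum F n)" for n by (rule L2_nsum[OF L2])
  fix e :: real assume "e > 0"
  define S where "S = suminf (\<lambda>r. \<tau> r + 2 * \<tau> r)"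
  have sm3: "summable (\<lambda>r. \<tau> r + 2 * \<tau> r)" using sm by (intro summable_add summable_mult)
  have S0: "S \<ge> 0" unfolding S_def using wdep_nonneg[OF F] by (intro suminf_nonneg sm3) simp
  \<comment> \<open>For a remainder of norm at most \<delta> <= 1 the variance bound is at most
    \<delta> (1 + 8 S), which this choice puts below e^2. \<open>S\<close> is fixed before the
    window and the clipping level.\<close>
  define \<delta> where "\<delta> = min 1 (e\<^sup>2 / (1 + 8 * S))"
  have \<delta>: "\<delta> > 0" "\<delta> \<le> 1" using \<open>e > 0\<close> S0 by (auto simp: \<delta>_def)
  obtain q where q: "nrm P (\<lambda>x. F x - CE {- int q..int q} F x) \<le> \<delta> / 2"
  proof -
    have "\<forall>\<^sub>F q in sequentially. nrm P (\<lambda>x. F x - CE {- int q..int q} F x) < \<delta> / 2"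
      using \<delta> by (intro order_tendstoD(2)[OF cyl_approx_L2[OF L2, unfolded cyl_approx_def]]) simp
    then obtain q where "nrm P (\<lambda>x. F x - CE {- int q..int q} F x) < \<delta> / 2"
      by (auto simp: eventually_sequentially)
    then show ?thesis by (intro that[of q]) simp
  qed
  define G where "G = CE {- int q..int q} F"
  have G: "L2 P G" unfolding G_def by (rule L2_CE[OF L2])
  then have [measurable]: "G \<in> borel_measurable P" by (rule L2_measurable)
  obtain c where c: "c > 0" "nrm P (\<lambda>x. excess c (G x)) \<le> \<delta> / 2"
    using excess_small[OF G, of "\<delta> / 2"] \<delta> by auto
  define \<phi> where "\<phi> z = max (- c) (min c z)" for z
  have [measurable]: "\<phi> \<in> borel_measurable borel" unfolding \<phi>_def by measurable
  have \<phi>: "\<bar>\<phi> a - \<phi> b\<bar> \<le> \<bar>a - b\<bar>" for a b unfolding \<phi>_def by linarith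
  define Q where "Q x = \<phi> (G x)" for x
  have [measurable]: "Q \<in> borel_measurable P" unfolding Q_def by measurable
  have Qbd: "\<bar>Q x\<bar> \<le> c" for x using c(1) by (auto simp: Q_def \<phi>_def)
  have Q2: "L2 P Q" by (rule P.L2_bounded[of _ c]) (simp_all add: Qbd)
  have wQ: "wdep (\<lambda>r. 2 * \<tau> r) Q"
    unfolding Q_def G_def by (intro wdep_lipschitz wdep_CE F \<phi>) simp
  define q0 where "q0 = (\<integral>x. Q x \<partial>P)"
  define Q' where "Q' x = Q x - q0" for x
  have wR: "wdep (\<lambda>r. \<tau> r + 2 * \<tau> r) (\<lambda>x. F x - Q' x)"
    unfolding Q'_def by (intro wdep_diff F wdep_diff_const wQ)
  have Q'2: "L2 P Q'" unfolding Q'_def by (intro L2_diff Q2 P.L2_const)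
  have Q'_mean: "(\<integral>x. Q' x \<partial>P) = 0"
    using P.L2_integrable[OF Q2] by (simp add: Q'_def q0_def prob_UNIV)
  have R_mean: "(\<integral>x. F x - Q' x \<partial>P) = 0"
    using P.L2_integrable[OF Q'2] P.L2_integrable[OF L2] Q'_mean mean by simp
  have FQ: "(\<integral>x. F x - Q x \<partial>P) = - q0"
    using P.L2_integrable[OF Q2] P.L2_integrable[OF L2] mean by (simp add: q0_def)
  \<comment> \<open>As \<open>F\<close> is centred, \<open>F - Q'\<close> is \<open>F - Q\<close>
    minus its own mean, so recentring \<open>Q\<close> does not enlarge the error.\<close>
  have "nrm P (\<lambda>x. F x - Q' x) = nrm P (\<lambda>x. (F x - Q x) - (\<integral>x. F x - Q x \<partial>P))"
    unfolding FQ by (simp add: Q'_def algebra_simps)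
  also have "\<dots> \<le> nrm P (\<lambda>x. F x - Q x)"
    by (intro P.nrm_centred_le L2_diff L2 Q2)
  also have "\<dots> \<le> nrm P (\<lambda>x. F x - G x) + nrm P (\<lambda>x. G x - Q x)"
    by (intro nrm_triangle3 L2 G Q2)
  also have "nrm P (\<lambda>x. G x - Q x) \<le> nrm P (\<lambda>x. excess c (G x))"
  proof (rule L2_bound(2))
    show "L2 P (\<lambda>x. excess c (G x))" using c(1) by (intro L2_excess G) auto
    show "AE x in P. \<bar>G x - Q x\<bar> \<le> \<bar>excess c (G x)\<bar>"
      using c(1) by (intro AE_I2) (auto simp: Q_def \<phi>_def excess_def)
  qed simp
  finally have nR: "nrm P (\<lambda>x. F x - Q' x) \<le> \<delta>" using q c(2) unfolding G_def by linarith
  have "ui2 P (nsum Q')"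
  proof (rule ui2_nsum_finite_range[of _ q "c + \<bar>q0\<bar>"])
    show "Q' \<in> borel_measurable P" using Q'2 by (rule L2_measurable)
    show "depends {- int q..int q} Q'"
      using depends_CE[of "{- int q..int q}" F] unfolding depends_def Q'_def Q_def G_def by metis
    show "\<bar>Q' x\<bar> \<le> c + \<bar>q0\<bar>" for x using Qbd[of x] unfolding Q'_def by linarith
  qed (rule Q'_mean)
  moreover have "nrm P (\<lambda>x. nsum F l x - nsum Q' l x) \<le> e" for l
  proof -
    have "nsum F l x - nsum Q' l x = nsum (\<lambda>x. F x - Q' x) l x" for x
      by (simp add: nsum_def sum_subtractf diff_divide_distrib)
    then have "nrm P (\<lambda>x. nsum F l x - nsum Q' l x) = nrm P (nsum (\<lambda>x. F x - Q' x) l)" by simp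
    also have "\<dots> \<le> sqrt ((nrm P (\<lambda>x. F x - Q' x))\<^sup>2 + 8 * nrm P (\<lambda>x. F x - Q' x) * S)"
      unfolding S_def by (rule nrm_nsum_le[OF wR sm3 R_mean])
    also have "\<dots> \<le> sqrt (\<delta> * (1 + 8 * S))"
    proof (rule real_sqrt_le_mono)
      have "(nrm P (\<lambda>x. F x - Q' x))\<^sup>2 \<le> \<delta> * 1"
        unfolding power2_eq_square using nR \<delta> by (intro mult_mono) auto
      moreover have "8 * nrm P (\<lambda>x. F x - Q' x) * S \<le> 8 * \<delta> * S"
        using nR S0 by (intro mult_right_mono) auto
      ultimately show "(nrm P (\<lambda>x. F x - Q' x))\<^sup>2 + 8 * nrm P (\<lambda>x. F x - Q' x) * S \<le> \<delta> * (1 + 8 * S)"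
        by (simp add: algebra_simps)
    qed
    also have "\<dots> \<le> sqrt (e\<^sup>2)"
    proof (rule real_sqrt_le_mono)
      have "\<delta> \<le> e\<^sup>2 / (1 + 8 * S)" by (simp add: \<delta>_def)
      then show "\<delta> * (1 + 8 * S) \<le> e\<^sup>2" using S0 by (simp add: pos_le_divide_eq)
    qed
    finally show ?thesis using \<open>e > 0\<close> by simp
  qed
  ultimately show "\<exists>\<zeta>. (\<forall>n. L2 P (\<zeta> n)) \<and> ui2 P \<zeta> \<and>
      (\<forall>\<^sub>F n in sequentially. nrm P (\<lambda>x. nsum F n x - \<zeta> n x) \<le> e)"
    by (intro exI[of _ "nsum Q'"]) (auto intro: L2_nsum[OF Q'2])
qed

text \<open>Enlarging the square of index pairs from l to l + 1 adds each lag d with |d| <= l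
  exactly once. The variance is therefore a Cesaro mean of the symmetric partial sums of the
  covariance series.\<close>

lemma nsum_variance_limit:
  assumes L2: "L2 P F"
    and sm: "(\<lambda>t. \<integral>x. F x * F (shift t x) \<partial>P) summable_on UNIV"
  shows "(\<lambda>l. \<integral>x. (nsum F l x)\<^sup>2 \<partial>P) \<longlonglongrightarrow> (\<Sum>\<^sub>\<infinity>t. \<integral>x. F x * F (shift t x) \<partial>P)"
proof -
  define c where "c t = (\<integral>x. F x * F (shift t x) \<partial>P)" for t
  have [measurable]: "F \<in> borel_measurable P" using L2 by (rule L2_measurable)
  have c: "(\<integral>x. F (shift s x) * F (shift t x) \<partial>P) = c (t - s)" for s t
    using integral_shift[of "\<lambda>x. F x * F (shift (t - s) x)" s] by (simp add: c_def shift_shift)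
  define a where "a l = (\<Sum>s\<in>{1..int l}. \<Sum>t\<in>{1..int l}. c (t - s))" for l
  have a_Suc: "a (Suc l) = a l + (\<Sum>d\<in>{- int l..int l}. c d)" for l
  proof -
    have ins: "{1..int (Suc l)} = insert (int l + 1) {1..int l}" by auto
    have "a (Suc l) = a l + (\<Sum>s\<in>{1..int l}. c (int l + 1 - s)) + (\<Sum>t\<in>{1..int l}. c (t - (int l + 1))) + c 0"
      unfolding a_def ins by (simp add: sum.distrib)
    also have "(\<Sum>s\<in>{1..int l}. c (int l + 1 - s)) = (\<Sum>d\<in>{1..int l}. c d)"
      by (rule sum.reindex_bij_witness[of _ "\<lambda>d. int l + 1 - d" "\<lambda>d. int l + 1 - d"]) auto
    also have "(\<Sum>t\<in>{1..int l}. c (t - (int l + 1))) = (\<Sum>d\<in>{- int l..-1}. c d)"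
      by (rule sum.reindex_bij_witness[of _ "\<lambda>d. d + (int l + 1)" "\<lambda>d. d - (int l + 1)"]) auto
    finally have "a (Suc l) = a l + ((\<Sum>d\<in>{- int l..-1}. c d) + c 0 + (\<Sum>d\<in>{1..int l}. c d))" by simp
    also have "(\<Sum>d\<in>{- int l..-1}. c d) + c 0 + (\<Sum>d\<in>{1..int l}. c d) = (\<Sum>d\<in>{- int l..int l}. c d)"
    proof -
      have "{- int l..int l} = {- int l..-1} \<union> ({0} \<union> {1..int l})" by auto
      moreover have "(\<Sum>d\<in>{- int l..-1} \<union> ({0} \<union> {1..int l}). c d) = (\<Sum>d\<in>{- int l..-1}. c d) + (c 0 + (\<Sum>d\<in>{1..int l}. c d))"
        by (subst sum.union_disjoint) auto
      ultimately show ?thesis by simp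
    qed
    finally show ?thesis .
  qed
  have a_sum: "a l = (\<Sum>k<l. \<Sum>d\<in>{- int k..int k}. c d)" for l
    by (induction l) (simp add: a_def, simp add: a_Suc)
  have "filterlim (\<lambda>k. {- int k..int k}) (finite_subsets_at_top UNIV) sequentially"
    unfolding filterlim_finite_subsets_at_top
  proof (intro allI impI, elim conjE)
    fix X :: "int set" assume "finite X"
    then obtain K where K: "\<forall>j\<in>X. \<bar>j\<bar> \<le> K"
      by (meson finite_imageI Max_ge imageI)
    show "\<forall>\<^sub>F k in sequentially. finite {- int k..int k} \<and> X \<subseteq> {- int k..int k} \<and> {- int k..int k} \<subseteq> UNIV"
      using eventually_ge_at_top[of "nat K"]
    proof eventually_elim
      case (elim k)
      then have "X \<subseteq> {- int k..int k}" using K by fastforce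
      then show ?case by simp
    qed
  qed
  moreover have "(sum c \<longlongrightarrow> infsum c UNIV) (finite_subsets_at_top UNIV)"
    using sm unfolding c_def[symmetric] by (rule infsum_tendsto)
  ultimately have "(\<lambda>k. sum c {- int k..int k}) \<longlonglongrightarrow> infsum c UNIV"
    by (rule filterlim_compose[rotated])
  from cesaro_mean[OF this] have lim: "(\<lambda>l. a l / real l) \<longlonglongrightarrow> infsum c UNIV"
    unfolding a_sum .
  have "(\<integral>x. (nsum F l x)\<^sup>2 \<partial>P) = a l / real l" for l
  proof -
    have int: "integrable P (\<lambda>x. F (shift s x) * F (shift t x))" for s t
      by (intro L2_mult_integrable L2_shift L2)
    have "(\<integral>x. (nsum F l x)\<^sup>2 \<partial>P) = 1 / real l * (\<integral>x. (\<Sum>s\<in>{1..int l}. \<Sum>t\<in>{1..int l}. F (shift s x) * F (shift t x)) \<partial>P)"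
      by (simp add: nsum_def power_divide power2_eq_square[of "sum _ _"] sum_product)
    also have "(\<integral>x. (\<Sum>s\<in>{1..int l}. \<Sum>t\<in>{1..int l}. F (shift s x) * F (shift t x)) \<partial>P) = a l"
      unfolding a_def by (simp add: int c)
    finally show ?thesis by simp
  qed
  then show ?thesis using lim by (simp add: c_def[symmetric])
qed

end

section \<open>A central limit theorem for triangular arrays\<close>

lemma char_cmult:
  assumes [measurable]: "f \<in> borel_measurable M"
  shows "char (distr M borel (\<lambda>x. c * f x)) t = char (distr M borel f) (c * t)"
  by (simp add: char_def integral_distr mult.assoc mult.left_commute)

text \<open>\<open>\<xi> n\<close> stands for the common law of row n, which has \<open>b n\<close>
  entries. A second-order expansion of the characteristic function at an argument of order 1 / sqrt
  (b n) leaves an error that is still negligible after multiplication by \<open>b n\<close>.\<close>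

lemma (in prob_space) triangular_clt_char:
  fixes \<xi> :: "nat \<Rightarrow> 'a \<Rightarrow> real" and b :: "nat \<Rightarrow> nat"
  assumes L2: "\<And>n. L2 M (\<xi> n)" and mean: "\<And>n. expectation (\<xi> n) = 0"
    and var: "(\<lambda>n. expectation (\<lambda>x. (\<xi> n x)\<^sup>2)) \<longlonglongrightarrow> s"
    and ui: "ui2 M \<xi>" and b: "filterlim b at_top sequentially"
  shows "(\<lambda>n. char (distr M borel (\<xi> n)) (t / sqrt (real (b n))) ^ b n) \<longlonglongrightarrow> complex_of_real (exp (- s * t\<^sup>2 / 2))"
proof -
  define u where "u n = t / sqrt (real (b n))" for n
  define \<phi> where "\<phi> n = char (distr M borel (\<xi> n)) (u n)" for n
  define E where "E n = expectation (\<lambda>x. min (6 * (\<xi> n x)\<^sup>2) (\<bar>u n\<bar> * \<bar>\<xi> n x\<bar>^3))" for n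
  have [measurable]: "\<xi> n \<in> borel_measurable M" for n using L2 by (rule L2_measurable)
  have breal: "filterlim (\<lambda>n. real (b n)) at_top sequentially"
    by (rule filterlim_compose[OF filterlim_real_sequentially b])
  have u0: "u \<longlonglongrightarrow> 0"
    unfolding u_def
    by (intro tendsto_divide_0[OF tendsto_const] filterlim_at_top_imp_at_infinity filterlim_compose[OF sqrt_at_top breal])
  have s0: "s \<ge> 0" by (rule tendsto_lowerbound[OF var]) auto
  \<comment> \<open>\<open>E n\<close> is the remainder term of the expansion. Up to |z| = 2 C the
    cubic term is at most 8 C^3 times |u|; beyond it |z| is at most twice its excess over
    \<open>C\<close>, which turns 6 z^2 into 24 times the squared excess.\<close>
  have E_le: "E n \<le> 8 * \<bar>u n\<bar> * C^3 + 24 * (nrm M (\<lambda>x. excess C (\<xi> n x)))\<^sup>2" if C: "C > 0" for C n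
  proof -
    have bd: "min (6 * z\<^sup>2) (v * \<bar>z\<bar>^3) \<le> 8 * v * C^3 + 24 * (excess C z)\<^sup>2" if v: "v \<ge> 0" for v z :: real
    proof (cases "\<bar>z\<bar> \<le> 2 * C")
      case True
      then have "\<bar>z\<bar>^3 \<le> (2 * C)^3" by (intro power_mono) auto
      then have "v * \<bar>z\<bar>^3 \<le> v * (8 * C^3)" using v by (intro mult_left_mono) (auto simp: power_mult_distrib)
      moreover have "0 \<le> 24 * (excess C z)\<^sup>2" by simp
      moreover have "min (6 * z\<^sup>2) (v * \<bar>z\<bar>^3) \<le> v * \<bar>z\<bar>^3" by simp
      ultimately show ?thesis by (simp only: mult.assoc mult.left_commute[of 8 v])
    next
      case False
      then have "\<bar>z\<bar> \<le> 2 * excess C z" by (simp add: excess_def)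
      from power_mono[OF this, of 2] have "z\<^sup>2 \<le> 4 * (excess C z)\<^sup>2" by (simp add: power_mult_distrib)
      moreover have "0 \<le> 8 * v * C^3" using v C by simp
      ultimately show ?thesis by (simp add: min_def)
    qed
    have L: "L2 M (\<lambda>x. excess C (\<xi> n x))" using C by (intro L2_excess L2) auto
    have "E n \<le> expectation (\<lambda>x. 8 * \<bar>u n\<bar> * C^3 + 24 * (excess C (\<xi> n x))\<^sup>2)"
      unfolding E_def
    proof (rule integral_mono)
      show "integrable M (\<lambda>x. 8 * \<bar>u n\<bar> * C^3 + 24 * (excess C (\<xi> n x))\<^sup>2)"
        using L by (simp add: L2_def)
      show "integrable M (\<lambda>x. min (6 * (\<xi> n x)\<^sup>2) (\<bar>u n\<bar> * \<bar>\<xi> n x\<bar> ^ 3))"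
        by (rule Bochner_Integration.integrable_bound[of M "\<lambda>x. 6 * (\<xi> n x)\<^sup>2"])
          (use L2 in \<open>auto simp: L2_def\<close>)
    qed (rule bd, simp)
    also have "\<dots> = 8 * \<bar>u n\<bar> * C^3 + 24 * (nrm M (\<lambda>x. excess C (\<xi> n x)))\<^sup>2"
      using L by (simp add: L2_def nrm_sq prob_space)
    finally show ?thesis .
  qed
  have E0: "E \<longlonglongrightarrow> 0"
  proof (rule LIMSEQ_I)
    fix e :: real assume e: "e > 0"
    \<comment> \<open>The 48 is twice the factor 24 of \<open>E_le\<close>, so that this part
      contributes at most e / 2.\<close>
    obtain C where C: "C > 0" "\<forall>\<^sub>F n in sequentially. nrm M (\<lambda>x. excess C (\<xi> n x)) \<le> sqrt (e / 48)"
      using ui e unfolding ui2_def by (meson divide_pos_pos real_sqrt_gt_zero zero_less_numeral)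
    have "(\<lambda>n. 8 * \<bar>u n\<bar> * C^3) \<longlonglongrightarrow> 8 * \<bar>0\<bar> * C^3"
      by (intro tendsto_intros u0)
    then have "(\<lambda>n. 8 * \<bar>u n\<bar> * C^3) \<longlonglongrightarrow> 0" by simp
    from order_tendstoD(2)[OF this, of "e / 2"] e
    have "\<forall>\<^sub>F n in sequentially. 8 * \<bar>u n\<bar> * C^3 < e / 2" by simp
    with C(2) have "\<forall>\<^sub>F n in sequentially. norm (E n - 0) < e"
    proof eventually_elim
      case (elim n)
      have "(nrm M (\<lambda>x. excess C (\<xi> n x)))\<^sup>2 \<le> (sqrt (e / 48))\<^sup>2"
        using elim(1) by (intro power_mono) auto
      then have "(nrm M (\<lambda>x. excess C (\<xi> n x)))\<^sup>2 \<le> e / 48" using e by simp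
      moreover have "E n \<ge> 0" unfolding E_def by (intro integral_nonneg_AE) auto
      ultimately show ?case using E_le[OF C(1), of n] elim(2) by simp
    qed
    then show "\<exists>no. \<forall>n\<ge>no. norm (E n - 0) < e" by (simp add: eventually_sequentially)
  qed
  define x where "x = - s * t\<^sup>2 / 2"
  \<comment> \<open>Powers of two numbers in the unit disc differ by at most \<open>b n\<close>
    times the difference of the bases. The approximating base 1 + x / b n lies in the disc only once
    \<open>b n\<close> is large.\<close>
  have small: "\<forall>\<^sub>F n in sequentially. \<bar>1 + x / real (b n)\<bar> \<le> 1 \<and> b n > 0"
    using filterlim_at_top[THEN iffD1, OF b, rule_format, of "nat \<lceil>\<bar>x\<bar>\<rceil> + 1"]
  proof eventually_elim
    case (elim n)
    then have "\<bar>x\<bar> \<le> real (b n)" "b n > 0" by linarith+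
    moreover have "x \<le> 0" using s0 by (simp add: x_def)
    ultimately show ?case by (auto simp: abs_le_iff field_simps)
  qed
  have main: "\<forall>\<^sub>F n in sequentially. cmod (\<phi> n ^ b n - (1 + complex_of_real x / of_nat (b n)) ^ b n) \<le>
      t\<^sup>2 / 6 * E n + t\<^sup>2 / 2 * \<bar>expectation (\<lambda>x. (\<xi> n x)\<^sup>2) - s\<bar>"
    using small
  proof eventually_elim
    case (elim n)
    define v where "v = expectation (\<lambda>x. (\<xi> n x)\<^sup>2)"
    define w where "w = 1 + x / real (b n)"
    have b0: "real (b n) > 0" using elim by simp
    have u2: "(u n)\<^sup>2 = t\<^sup>2 / real (b n)" using b0 by (simp add: u_def power_divide)
    have w: "w = 1 - (u n)\<^sup>2 * s / 2" by (simp add: w_def x_def u2 mult.commute)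
    interpret D: real_distribution "distr M borel (\<xi> n)" by (rule real_distribution_distr) simp
    have "cmod (\<phi> n - (1 - (u n)\<^sup>2 * v / 2)) \<le> (u n)\<^sup>2 / 6 * E n"
      unfolding \<phi>_def E_def
      using char_approx3'[OF _ L2_integrable[OF L2] L2_sq_integrable[OF L2] mean, of n v "distr M borel (\<xi> n)" "u n"] mean[of n]
      by (simp add: v_def)
    then have "cmod (\<phi> n - w) \<le> (u n)\<^sup>2 / 6 * E n + cmod (of_real ((1 - (u n)\<^sup>2 * v / 2) - w))"
      using norm_triangle_ineq[of "\<phi> n - (1 - (u n)\<^sup>2 * v / 2)" "of_real ((1 - (u n)\<^sup>2 * v / 2) - w)"] by simp
    also have "cmod (of_real ((1 - (u n)\<^sup>2 * v / 2) - w)) = (u n)\<^sup>2 / 2 * \<bar>v - s\<bar>"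
    proof -
      have "(1 - (u n)\<^sup>2 * v / 2) - w = (u n)\<^sup>2 / 2 * (s - v)" by (simp add: w algebra_simps)
      then show ?thesis by (simp only: norm_of_real abs_mult) (simp add: abs_minus_commute)
    qed
    finally have d: "cmod (\<phi> n - w) \<le> (u n)\<^sup>2 / 6 * E n + (u n)\<^sup>2 / 2 * \<bar>v - s\<bar>" .
    have "cmod (\<phi> n ^ b n - (complex_of_real w) ^ b n) \<le> real (b n) * cmod (\<phi> n - w)"
    proof (rule norm_power_diff)
      show "cmod (\<phi> n) \<le> 1" unfolding \<phi>_def by (rule D.cmod_char_le_1)
      show "cmod (complex_of_real w) \<le> 1" using elim by (simp only: norm_of_real w_def)
    qed
    also have "\<dots> \<le> real (b n) * ((u n)\<^sup>2 / 6 * E n + (u n)\<^sup>2 / 2 * \<bar>v - s\<bar>)"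
      using d by (intro mult_left_mono) auto
    also have "\<dots> = t\<^sup>2 / 6 * E n + t\<^sup>2 / 2 * \<bar>v - s\<bar>"
      using b0 by (simp add: u2 field_simps)
    finally show ?case by (simp add: w_def v_def)
  qed
  have "(\<lambda>n. t\<^sup>2 / 6 * E n + t\<^sup>2 / 2 * \<bar>expectation (\<lambda>x. (\<xi> n x)\<^sup>2) - s\<bar>) \<longlonglongrightarrow> t\<^sup>2 / 6 * 0 + t\<^sup>2 / 2 * \<bar>s - s\<bar>"
    by (intro tendsto_intros E0 var)
  then have "(\<lambda>n. t\<^sup>2 / 6 * E n + t\<^sup>2 / 2 * \<bar>expectation (\<lambda>x. (\<xi> n x)\<^sup>2) - s\<bar>) \<longlonglongrightarrow> 0" by simp
  from Lim_null_comparison[OF main this]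
  have 1: "(\<lambda>n. \<phi> n ^ b n - (1 + complex_of_real x / of_nat (b n)) ^ b n) \<longlonglongrightarrow> 0" .
  have "(\<lambda>n. complex_of_real ((1 + x / real n) ^ n)) \<longlonglongrightarrow> complex_of_real (exp x)"
    by (intro tendsto_of_real tendsto_exp_limit_sequentially)
  from filterlim_compose[OF this b]
  have 2: "(\<lambda>n. (1 + complex_of_real x / of_nat (b n)) ^ b n) \<longlonglongrightarrow> complex_of_real (exp x)" by simp
  have "(\<lambda>n. \<phi> n ^ b n) \<longlonglongrightarrow> complex_of_real (exp x)"
    using tendsto_add[OF 1 2] by simp
  then show ?thesis by (simp add: \<phi>_def u_def x_def)
qed

lemma (in prob_space) triangular_clt:
  fixes \<xi> :: "nat \<Rightarrow> 'a \<Rightarrow> real" and b :: "nat \<Rightarrow> nat" and \<zeta> :: "nat \<Rightarrow> 'i \<Rightarrow> 'a \<Rightarrow> real"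
  assumes L2: "\<And>n. L2 M (\<xi> n)" and mean: "\<And>n. expectation (\<xi> n) = 0"
    and var: "(\<lambda>n. expectation (\<lambda>x. (\<xi> n x)\<^sup>2)) \<longlonglongrightarrow> s"
    and ui: "ui2 M \<xi>" and b: "filterlim b at_top sequentially"
    and card: "\<And>n. card (J n) = b n"
    and indep: "\<And>n. indep_vars (\<lambda>_. borel) (\<zeta> n) (J n)"
    and law: "\<And>n j. j \<in> J n \<Longrightarrow> distr M borel (\<zeta> n j) = distr M borel (\<xi> n)"
  shows "(\<lambda>n. char (distr M borel (\<lambda>x. 1 / sqrt (real (b n)) * (\<Sum>j\<in>J n. \<zeta> n j x))) t)
      \<longlonglongrightarrow> complex_of_real (exp (- s * t\<^sup>2 / 2))"
proof -
  have "char (distr M borel (\<lambda>x. 1 / sqrt (real (b n)) * (\<Sum>j\<in>J n. \<zeta> n j x))) t =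
      char (distr M borel (\<xi> n)) (t / sqrt (real (b n))) ^ b n" for n
  proof -
    have [measurable]: "\<zeta> n j \<in> borel_measurable M" if "j \<in> J n" for j
      using indep[of n] that by (auto simp: indep_vars_def)
    have "char (distr M borel (\<lambda>x. 1 / sqrt (real (b n)) * (\<Sum>j\<in>J n. \<zeta> n j x))) t =
        char (distr M borel (\<lambda>x. \<Sum>j\<in>J n. \<zeta> n j x)) (1 / sqrt (real (b n)) * t)"
      by (intro char_cmult) measurable
    also have "\<dots> = (\<Prod>j\<in>J n. char (distr M borel (\<zeta> n j)) (1 / sqrt (real (b n)) * t))"
      by (rule char_distr_sum[OF indep])
    also have "\<dots> = char (distr M borel (\<xi> n)) (t / sqrt (real (b n))) ^ b n"
      using law[of _ n] by (simp add: card)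
    finally show ?thesis .
  qed
  then show ?thesis using triangular_clt_char[OF L2 mean var ui b, of t] by simp
qed

section \<open>The central limit theorem for partial sums\<close>

lemma cmod_iexp_diff_le: "cmod (iexp x - iexp y) \<le> \<bar>x - y\<bar>"
proof -
  have "iexp x - iexp y = iexp y * (iexp (x - y) - 1)"
    by (simp add: algebra_simps flip: exp_add)
  then have "cmod (iexp x - iexp y) = cmod (iexp (x - y) - 1)"
    by (simp only: norm_mult norm_exp_i_times mult_1)
  also have "\<dots> \<le> \<bar>x - y\<bar>"
    using iexp_approx1[of "x - y" 0] by simp
  finally show ?thesis .
qed

context prob_space
begin

lemma char_diff_L1:
  assumes [measurable]: "f \<in> borel_measurable M" "g \<in> borel_measurable M"
    and int: "integrable M (\<lambda>x. f x - g x)"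
  shows "cmod (char (distr M borel f) t - char (distr M borel g) t) \<le> \<bar>t\<bar> * (\<integral>x. \<bar>f x - g x\<bar> \<partial>M)"
proof -
  have "char (distr M borel f) t - char (distr M borel g) t = (\<integral>x. iexp (t * f x) - iexp (t * g x) \<partial>M)"
    by (simp add: char_def integral_distr integrable_iexp)
  also have "cmod \<dots> \<le> (\<integral>x. \<bar>t\<bar> * \<bar>f x - g x\<bar> \<partial>M)"
  proof (rule order_trans[OF integral_norm_bound integral_mono])
    show "integrable M (\<lambda>x. cmod (iexp (t * f x) - iexp (t * g x)))"
      by (intro integrable_norm Bochner_Integration.integrable_diff integrable_iexp) auto
    show "integrable M (\<lambda>x. \<bar>t\<bar> * \<bar>f x - g x\<bar>)" using int by simp
    fix x
    show "cmod (iexp (t * f x) - iexp (t * g x)) \<le> \<bar>t\<bar> * \<bar>f x - g x\<bar>"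
      using cmod_iexp_diff_le[of "t * f x" "t * g x"] by (simp flip: abs_mult right_diff_distrib)
  qed
  finally show ?thesis by simp
qed

lemma char_diff_event:
  assumes [measurable]: "f \<in> borel_measurable M" "g \<in> borel_measurable M" "A \<in> events"
    and eq: "\<And>x. x \<in> space M \<Longrightarrow> x \<notin> A \<Longrightarrow> f x = g x"
  shows "cmod (char (distr M borel f) t - char (distr M borel g) t) \<le> 2 * prob A"
proof -
  have "char (distr M borel f) t - char (distr M borel g) t = (\<integral>x. iexp (t * f x) - iexp (t * g x) \<partial>M)"
    by (simp add: char_def integral_distr integrable_iexp)
  also have "cmod \<dots> \<le> (\<integral>x. 2 * indicator A x \<partial>M)"
  proof (rule order_trans[OF integral_norm_bound integral_mono])
    show "integrable M (\<lambda>x. cmod (iexp (t * f x) - iexp (t * g x)))"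
      by (intro integrable_norm Bochner_Integration.integrable_diff integrable_iexp) auto
    fix x assume "x \<in> space M"
    then show "cmod (iexp (t * f x) - iexp (t * g x)) \<le> 2 * indicator A x"
      using eq[of x] norm_triangle_ineq4[of "iexp (t * f x)" "iexp (t * g x)"]
      by (cases "x \<in> A") auto
  qed (simp add: less_top[symmetric])
  finally show ?thesis by simp
qed

lemma char_limit_L1:
  assumes [measurable]: "\<And>n. f n \<in> borel_measurable M" "\<And>n. g n \<in> borel_measurable M"
    and int: "\<And>n. integrable M (\<lambda>x. f n x - g n x)"
    and lim: "(\<lambda>n. \<integral>x. \<bar>f n x - g n x\<bar> \<partial>M) \<longlonglongrightarrow> 0"
    and g: "(\<lambda>n. char (distr M borel (g n)) t) \<longlonglongrightarrow> c"
  shows "(\<lambda>n. char (distr M borel (f n)) t) \<longlonglongrightarrow> c"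
proof -
  have "(\<lambda>n. char (distr M borel (f n)) t - char (distr M borel (g n)) t) \<longlonglongrightarrow> 0"
  proof (rule Lim_null_comparison)
    show "\<forall>\<^sub>F n in sequentially. cmod (char (distr M borel (f n)) t - char (distr M borel (g n)) t)
        \<le> \<bar>t\<bar> * (\<integral>x. \<bar>f n x - g n x\<bar> \<partial>M)"
      by (intro always_eventually allI char_diff_L1 int) auto
    show "(\<lambda>n. \<bar>t\<bar> * (\<integral>x. \<bar>f n x - g n x\<bar> \<partial>M)) \<longlonglongrightarrow> 0"
      using tendsto_mult_left[OF lim, of "\<bar>t\<bar>"] by simp
  qed
  from tendsto_add[OF this g] show ?thesis by simp
qed

lemma char_limit_L2:
  assumes L2: "\<And>n. L2 M (f n)" "\<And>n. L2 M (g n)"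
    and lim: "(\<lambda>n. nrm M (\<lambda>x. f n x - g n x)) \<longlonglongrightarrow> 0"
    and g: "(\<lambda>n. char (distr M borel (g n)) t) \<longlonglongrightarrow> c"
  shows "(\<lambda>n. char (distr M borel (f n)) t) \<longlonglongrightarrow> c"
proof (rule char_limit_L1[OF _ _ _ _ g])
  show "f n \<in> borel_measurable M" "g n \<in> borel_measurable M" for n
    using L2 by (auto dest: L2_measurable)
  show "integrable M (\<lambda>x. f n x - g n x)" for n by (intro L2_integrable L2_diff L2)
  show "(\<lambda>n. \<integral>x. \<bar>f n x - g n x\<bar> \<partial>M) \<longlonglongrightarrow> 0"
    by (rule tendsto_sandwich[OF _ _ tendsto_const lim])
      (auto intro!: always_eventually integral_abs_le_nrm L2_diff L2)
qed

end

lemma second_moment_limit: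
  assumes L2: "\<And>n. L2 M (f n)" "\<And>n. L2 M (g n)"
    and lim: "(\<lambda>n. nrm M (\<lambda>x. f n x - g n x)) \<longlonglongrightarrow> 0"
    and g: "(\<lambda>n. \<integral>x. (g n x)\<^sup>2 \<partial>M) \<longlonglongrightarrow> s"
  shows "(\<lambda>n. \<integral>x. (f n x)\<^sup>2 \<partial>M) \<longlonglongrightarrow> s"
proof -
  have g': "(\<lambda>n. nrm M (g n)) \<longlonglongrightarrow> sqrt s"
    unfolding nrm_def by (intro tendsto_real_sqrt g)
  have "(\<lambda>n. nrm M (f n) - nrm M (g n)) \<longlonglongrightarrow> 0"
  proof (rule Lim_null_comparison[OF _ lim], intro always_eventually allI)
    fix n
    have "nrm M (f n) \<le> nrm M (\<lambda>x. f n x - g n x) + nrm M (g n)"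
      using nrm_triangle[OF L2_diff[OF L2(1)[of n] L2(2)[of n]] L2(2)[of n]] by simp
    moreover have "nrm M (g n) \<le> nrm M (\<lambda>x. g n x - f n x) + nrm M (f n)"
      using nrm_triangle[OF L2_diff[OF L2(2)[of n] L2(1)[of n]] L2(1)[of n]] by simp
    ultimately show "norm (nrm M (f n) - nrm M (g n)) \<le> nrm M (\<lambda>x. f n x - g n x)"
      by (simp add: nrm_commute[of M "g n"] abs_le_iff)
  qed
  from tendsto_add[OF this g'] have "(\<lambda>n. nrm M (f n)) \<longlonglongrightarrow> sqrt s" by simp
  from tendsto_power[OF this, of 2] have "(\<lambda>n. (nrm M (f n))\<^sup>2) \<longlonglongrightarrow> (sqrt s)\<^sup>2" .
  moreover have "s \<ge> 0" by (rule tendsto_lowerbound[OF g]) auto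
  ultimately show ?thesis by (simp add: nrm_sq)
qed

section \<open>Independent surrogates of block sums and the limit theorem for one long block\<close>

context noise
begin

text \<open>All noise up to the distance of \<open>t\<close> from the nearer end lies inside the
  block, and each such distance occurs at most twice. Hence the factor 2 and a bound without the
  block length.\<close>

lemma block_CE_error:
  assumes F: "wdep \<tau> F" and sm: "summable \<tau>"
  shows "(\<Sum>t\<in>{lo..hi}. nrm P (\<lambda>x. F (shift t x) - CE {lo..hi} (\<lambda>x. F (shift t x)) x)) \<le> 2 * suminf \<tau>"
proof -
  define \<phi> where "\<phi> t = nat (min (t - lo) (hi - t))" for t
  have "(\<Sum>t\<in>{lo..hi}. nrm P (\<lambda>x. F (shift t x) - CE {lo..hi} (\<lambda>x. F (shift t x)) x)) \<le> (\<Sum>t\<in>{lo..hi}. \<tau> (\<phi> t))"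
    by (intro sum_mono wdep_shift_bound F) (auto simp: \<phi>_def)
  also have "\<dots> \<le> real 2 * suminf \<tau>"
  proof (intro fiber_sum_le sm wdep_nonneg[OF F])
    fix r
    have "{t \<in> {lo..hi}. \<phi> t = r} \<subseteq> set [lo + int r, hi - int r]"
      by (auto simp: \<phi>_def min_def split: if_splits)
    from card_mono[OF _ this] card_length[of "[lo + int r, hi - int r]"]
    show "card {t \<in> {lo..hi}. \<phi> t = r} \<le> 2" by simp
  qed simp
  finally show ?thesis by simp
qed

text \<open>The independent surrogate of the block sum: every summand is averaged over the noise
  outside its own block, so distinct blocks use disjoint noise.\<close>

definition bsum :: "((int \<Rightarrow> real) \<Rightarrow> real) \<Rightarrow> nat \<Rightarrow> nat \<Rightarrow> (int \<Rightarrow> real) \<Rightarrow> real" where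
  "bsum F K j x = (\<Sum>t\<in>block K j. CE (block K j) (\<lambda>x. F (shift t x)) x)"

lemma block_shift: "block K j = (\<lambda>t. t + (int j - 1) * int K) ` block K 1"
  unfolding block_def image_add_atLeastAtMost' by (simp add: algebra_simps)

lemma block_one: "block K 1 = {1..int K}"
  by (simp add: block_def)

lemma finite_block [simp]: "finite (block K j)"
  by (simp add: block_def)

lemma card_block [simp]: "card (block K j) = K"
  by (simp add: block_def algebra_simps)

lemma disjoint_blocks: "disjoint_family_on (block K) J"
  unfolding disjoint_family_on_def
proof (intro ballI impI)
  fix i j :: nat assume "i \<noteq> j"
  have aux: "block K i \<inter> block K j = {}" if "i < j" for i j
  proof -
    from that have "int i * int K \<le> (int j - 1) * int K" by (intro mult_right_mono) auto
    then show ?thesis by (auto simp: block_def)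
  qed
  show "block K i \<inter> block K j = {}"
    using aux[of i j] aux[of j i] \<open>i \<noteq> j\<close> by (cases "i < j") auto
qed

lemma CE_block_shift:
  assumes [measurable]: "F \<in> borel_measurable P"
  shows "CE (block K j) (\<lambda>x. F (shift (t + (int j - 1) * int K) x)) x =
    CE (block K 1) (\<lambda>x. F (shift t x)) (shift ((int j - 1) * int K) x)"
proof -
  let ?d = "(int j - 1) * int K"
  have "CE (block K j) (\<lambda>x. F (shift t (shift ?d x))) x = CE {u. u + ?d \<in> block K j} (\<lambda>x. F (shift t x)) (shift ?d x)"
    by (rule CE_shift) simp
  also have "{u. u + ?d \<in> block K j} = block K 1"
    by (auto simp: block_def algebra_simps)
  finally show ?thesis by (simp add: shift_shift)
qed

lemma bsum_shift:
  assumes "F \<in> borel_measurable P"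
  shows "bsum F K j x = bsum F K 1 (shift ((int j - 1) * int K) x)"
proof -
  let ?d = "(int j - 1) * int K"
  have "bsum F K j x = (\<Sum>t\<in>(\<lambda>t. t + ?d) ` block K 1. CE (block K j) (\<lambda>x. F (shift t x)) x)"
    unfolding bsum_def by (rule sum.cong[OF block_shift refl])
  also have "\<dots> = (\<Sum>t\<in>block K 1. CE (block K j) (\<lambda>x. F (shift (t + ?d) x)) x)"
    by (subst sum.reindex) (auto simp: inj_on_def)
  also have "\<dots> = bsum F K 1 (shift ?d x)"
    unfolding bsum_def by (intro sum.cong refl CE_block_shift assms)
  finally show ?thesis .
qed

lemma bsum_depends: "depends (block K j) (bsum F K j)"
  unfolding depends_def bsum_def
  by (intro allI impI sum.cong refl depends_CE[unfolded depends_def, rule_format]) auto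

lemma L2_bsum: "L2 P F \<Longrightarrow> L2 P (bsum F K j)"
  unfolding bsum_def[abs_def] by (intro L2_sum L2_CE L2_shift)

lemma bsum_error:
  assumes F: "wdep \<tau> F" and sm: "summable \<tau>"
  shows "nrm P (\<lambda>x. (\<Sum>t\<in>block K j. F (shift t x)) - bsum F K j x) \<le> 2 * suminf \<tau>"
proof -
  note L2 = L2_shift[OF wdep_L2[OF F]]
  have "nrm P (\<lambda>x. (\<Sum>t\<in>block K j. F (shift t x)) - bsum F K j x) =
      nrm P (\<lambda>x. \<Sum>t\<in>block K j. F (shift t x) - CE (block K j) (\<lambda>x. F (shift t x)) x)"
    by (simp add: bsum_def sum_subtractf)
  also have "\<dots> \<le> (\<Sum>t\<in>block K j. nrm P (\<lambda>x. F (shift t x) - CE (block K j) (\<lambda>x. F (shift t x)) x))"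
    by (intro nrm_sum L2_diff L2_CE L2)
  also have "\<dots> \<le> 2 * suminf \<tau>"
    unfolding block_def by (rule block_CE_error[OF F sm])
  finally show ?thesis .
qed

lemma distr_shift_comp:
  assumes "f \<in> borel_measurable P"
  shows "distr P borel (\<lambda>x. f (shift t x)) = distr P borel f"
  using distr_distr[of f P borel "shift t" P] assms by (simp add: distr_shift comp_def)

text \<open>No gaps are left between the sub-blocks: their surrogates are exactly independent, and
  the price per sub-block is bounded. The row entries inherit uniform integrability and the limiting
  variance from shorter normalised sums of the same process.\<close>

lemma nsum_clt:
  assumes F: "wdep \<tau> F" and sm: "summable \<tau>" and mean: "(\<integral>x. F x \<partial>P) = 0"
    and var: "(\<lambda>l. \<integral>x. (nsum F l x)\<^sup>2 \<partial>P) \<longlonglongrightarrow> s"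
  shows "(\<lambda>l. char (distr P borel (nsum F l)) t) \<longlonglongrightarrow> complex_of_real (exp (- s * t\<^sup>2 / 2))"
proof -
  note L2 = wdep_L2[OF F]
  have meas [measurable]: "F \<in> borel_measurable P" using L2 by (rule L2_measurable)
  \<comment> \<open>From p^4 <= l all needed orders follow: p tends to infinity, p / sqrt l is at
    most 1 / p, and the sub-block length l div p is at least p^3.\<close>
  define p where "p l = nat \<lfloor>sqrt (sqrt (real l))\<rfloor>" for l
  define K where "K l = l div p l" for l
  have p4: "p l ^ 4 \<le> l" for l
  proof -
    have "real (p l) \<le> sqrt (sqrt (real l))" by (simp add: p_def)
    then have "real (p l) ^ 4 \<le> sqrt (sqrt (real l)) ^ 4" by (intro power_mono) auto
    also have "\<dots> = (sqrt (sqrt (real l)) ^ 2) ^ 2" by (simp only: power_mult[symmetric]) simp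
    also have "\<dots> = real l" by simp
    finally show ?thesis by (metis of_nat_le_iff of_nat_power)
  qed
  have p_top: "filterlim p at_top sequentially"
    unfolding p_def
    by (intro filterlim_compose[OF filterlim_nat_sequentially] filterlim_compose[OF filterlim_floor_sequentially]
      filterlim_compose[OF sqrt_at_top] filterlim_real_sequentially)
  have p_pos: "\<forall>\<^sub>F l in sequentially. p l > 0"
    using filterlim_at_top[THEN iffD1, OF p_top, rule_format, of 1] by eventually_elim simp
  have p3: "p l ^ 3 \<le> K l" if "p l > 0" for l
  proof -
    have "p l ^ 3 * p l \<le> l" using p4[of l] by (simp add: eval_nat_numeral)
    then show ?thesis using that by (simp add: K_def less_eq_div_iff_mult_less_eq)
  qed
  have K_top: "filterlim K at_top sequentially"
  proof (rule filterlim_at_top_mono[OF p_top])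
    show "\<forall>\<^sub>F l in sequentially. p l \<le> K l"
      using p_pos
    proof eventually_elim
      case (elim l)
      have "p l ^ 1 \<le> p l ^ 3" using elim by (intro power_increasing) auto
      with p3[OF elim] show ?case by simp
    qed
  qed
  have inv_p: "(\<lambda>l. 1 / real (p l)) \<longlonglongrightarrow> 0"
    by (intro tendsto_divide_0[OF tendsto_const] filterlim_at_top_imp_at_infinity
      filterlim_compose[OF filterlim_real_sequentially] p_top)
  have p_sqrt: "(\<lambda>l. real (p l) / sqrt (real l)) \<longlonglongrightarrow> 0"
  proof (rule Lim_null_comparison[OF _ inv_p])
    show "\<forall>\<^sub>F l in sequentially. norm (real (p l) / sqrt (real l)) \<le> 1 / real (p l)"
      using p_pos
    proof eventually_elim
      case (elim l)
      have "(real (p l) ^ 2) ^ 2 = real (p l ^ 4)" by (simp flip: power_mult)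
      also have "\<dots> \<le> real l" using p4[of l] by (simp only: of_nat_le_iff)
      finally have "real (p l) ^ 2 \<le> sqrt (real l)" by (rule real_le_rsqrt)
      moreover have "real (p l) ^ 2 > 0" using elim by simp
      ultimately have "real (p l) * real (p l) \<le> 1 * sqrt (real l)" "0 < sqrt (real l)"
        unfolding power2_eq_square by linarith+
      then have "real (p l) * real (p l) / sqrt (real l) \<le> 1" by (simp add: pos_divide_le_eq)
      then show ?case using elim by (simp add: pos_le_divide_eq)
    qed
  qed
  have p_frac: "(\<lambda>l. real (p l * K l) / real l) \<longlonglongrightarrow> 1"
  proof -
    have "(\<lambda>l. real (p l * K l) / real l - 1) \<longlonglongrightarrow> 0"
    proof (rule Lim_null_comparison[OF _ p_sqrt])
      show "\<forall>\<^sub>F l in sequentially. norm (real (p l * K l) / real l - 1) \<le> real (p l) / sqrt (real l)"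
        using p_pos eventually_gt_at_top[of 0]
      proof eventually_elim
        case (elim l)
        have "p l * K l + l mod p l = l" by (simp add: K_def)
        then have "real l = real (p l * K l) + real (l mod p l)" by (metis of_nat_add)
        then have "real (p l * K l) / real l - 1 = - (real (l mod p l) / real l)"
          using elim by (simp add: field_simps)
        then have "norm (real (p l * K l) / real l - 1) = real (l mod p l) / real l" by simp
        also have "\<dots> \<le> real (p l) / real l"
          using elim by (intro divide_right_mono) (auto intro: less_imp_le)
        also have "\<dots> \<le> real (p l) / sqrt (real l)"
        proof (rule divide_left_mono)
          have "1 * sqrt (real l) \<le> sqrt (real l) * sqrt (real l)"
            using elim by (intro mult_right_mono) auto
          then show "sqrt (real l) \<le> real l" by simp
        qed (use elim in auto)
        finally show ?case .
      qed
    qed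
    from tendsto_add[OF this tendsto_const[of 1]] show ?thesis by simp
  qed
  \<comment> \<open>The factor sqrt (p / l) is chosen so that the normalisation 1 / sqrt p of a row
    with p entries turns into 1 / sqrt l. \<open>\<eta>\<close> is the same entry without averaging,
    and \<open>\<zeta> l j\<close> its copy on the j-th sub-block.\<close>
  define \<xi> where "\<xi> l x = sqrt (real (p l) / real l) * bsum F (K l) 1 x" for l x
  define \<eta> where "\<eta> l x = sqrt (real (p l) / real l) * (\<Sum>t\<in>block (K l) 1. F (shift t x))" for l x
  define \<zeta> where "\<zeta> l j x = sqrt (real (p l) / real l) * bsum F (K l) j x" for l j x
  have L2s: "L2 P (\<xi> l)" "L2 P (\<eta> l)" for l
    unfolding \<xi>_def[abs_def] \<eta>_def[abs_def] by (intro L2_cmult L2_bsum L2_sum L2_shift L2)+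
  have frac0: "(\<lambda>l. sqrt (real (p l) / real l)) \<longlonglongrightarrow> 0"
  proof -
    have "(\<lambda>l. real (p l) / sqrt (real l) * (1 / sqrt (real l))) \<longlonglongrightarrow> 0 * 0"
      by (intro tendsto_mult p_sqrt tendsto_divide_0[OF tendsto_const] filterlim_at_top_imp_at_infinity
        filterlim_compose[OF sqrt_at_top filterlim_real_sequentially])
    then have "(\<lambda>l. real (p l) / real l) \<longlonglongrightarrow> 0" by simp
    from tendsto_real_sqrt[OF this] show ?thesis by simp
  qed
  have \<xi>\<eta>: "(\<lambda>l. nrm P (\<lambda>x. \<xi> l x - \<eta> l x)) \<longlonglongrightarrow> 0"
  proof (rule Lim_null_comparison)
    show "\<forall>\<^sub>F l in sequentially. norm (nrm P (\<lambda>x. \<xi> l x - \<eta> l x)) \<le> sqrt (real (p l) / real l) * (2 * suminf \<tau>)"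
    proof (intro always_eventually allI)
      fix l
      have "nrm P (\<lambda>x. \<xi> l x - \<eta> l x) = sqrt (real (p l) / real l) * nrm P (\<lambda>x. bsum F (K l) 1 x - (\<Sum>t\<in>block (K l) 1. F (shift t x)))"
        unfolding \<xi>_def \<eta>_def right_diff_distrib[symmetric] nrm_cmult by simp
      also have "\<dots> \<le> sqrt (real (p l) / real l) * (2 * suminf \<tau>)"
        unfolding nrm_commute[of P "bsum F (K l) 1"]
        by (intro mult_left_mono bsum_error F sm) simp
      finally show "norm (nrm P (\<lambda>x. \<xi> l x - \<eta> l x)) \<le> sqrt (real (p l) / real l) * (2 * suminf \<tau>)"
        by simp
    qed
    show "(\<lambda>l. sqrt (real (p l) / real l) * (2 * suminf \<tau>)) \<longlonglongrightarrow> 0"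
      using tendsto_mult_right[OF frac0, of "2 * suminf \<tau>"] by simp
  qed
  have \<eta>_eq: "\<eta> l x = sqrt (real (p l * K l) / real l) * nsum F (K l) x" for l x
  proof (cases "K l = 0")
    case True
    then show ?thesis by (simp add: \<eta>_def nsum_def block_def)
  next
    case False
    then show ?thesis
      by (simp add: \<eta>_def nsum_def block_one[unfolded One_nat_def] real_sqrt_mult real_sqrt_divide)
  qed
  have pK_le: "real (p l * K l) / real l \<le> 1" for l
  proof (cases "l = 0")
    case False
    have "p l * K l \<le> l" by (simp add: K_def)
    then have "real (p l * K l) \<le> real l" by (simp only: of_nat_le_iff)
    then show ?thesis using False by simp
  qed simp
  have "ui2 P (\<lambda>l. nsum F (K l))"
    by (rule ui2_subseq[OF ui2_nsum[OF F sm mean] K_top])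
  then have "ui2 P \<eta>"
  proof (rule ui2_lipschitz[where K=1 and c=0])
    fix l x
    have "sqrt (real (p l * K l) / real l) \<le> 1" using pK_le[of l] by simp
    then have "sqrt (real (p l * K l) / real l) * \<bar>nsum F (K l) x\<bar> \<le> 1 * \<bar>nsum F (K l) x\<bar>"
      by (intro mult_right_mono) auto
    then show "\<bar>\<eta> l x\<bar> \<le> 1 * \<bar>nsum F (K l) x\<bar> + 0" by (simp add: \<eta>_eq abs_mult)
  qed (use L2s L2_nsum[OF L2] in \<open>auto dest: L2_measurable\<close>)
  then have ui: "ui2 P \<xi>" by (intro ui2_perturb[OF L2s _ \<xi>\<eta>])
  have "(\<lambda>l. real (p l * K l) / real l * (\<integral>x. (nsum F (K l) x)\<^sup>2 \<partial>P)) \<longlonglongrightarrow> 1 * s"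
    by (intro tendsto_mult p_frac filterlim_compose[OF var K_top])
  moreover have "(\<integral>x. (\<eta> l x)\<^sup>2 \<partial>P) = real (p l * K l) / real l * (\<integral>x. (nsum F (K l) x)\<^sup>2 \<partial>P)" for l
    by (simp add: \<eta>_eq power_mult_distrib)
  ultimately have "(\<lambda>l. \<integral>x. (\<eta> l x)\<^sup>2 \<partial>P) \<longlonglongrightarrow> s" by simp
  then have var\<xi>: "(\<lambda>l. \<integral>x. (\<xi> l x)\<^sup>2 \<partial>P) \<longlonglongrightarrow> s"
    by (rule second_moment_limit[OF L2s \<xi>\<eta>])
  have mean\<xi>: "(\<integral>x. \<xi> l x \<partial>P) = 0" for l
  proof -
    have "integrable P (CE A (\<lambda>x. F (shift t x)))" for A t
      by (intro P.L2_integrable L2_CE L2_shift L2)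
    then show ?thesis
      by (simp add: \<xi>_def bsum_def integral_CE L2_shift L2 integral_shift mean)
  qed
  have main: "(\<lambda>l. char (distr P borel (\<lambda>x. 1 / sqrt (real (p l)) * (\<Sum>j\<in>{1..p l}. \<zeta> l j x))) t)
      \<longlonglongrightarrow> complex_of_real (exp (- s * t\<^sup>2 / 2))"
  proof (rule P.triangular_clt[OF L2s(1) mean\<xi> var\<xi> ui p_top])
    fix l
    show "card {1..p l} = p l" by simp
    show "P.indep_vars (\<lambda>_. borel) (\<zeta> l) {1..p l}"
    proof (rule indep_depends[OF _ _ disjoint_blocks[of "K l"]])
      show "\<zeta> l j \<in> borel_measurable P" for j
        unfolding \<zeta>_def[abs_def] by (intro L2_measurable L2_cmult L2_bsum L2)
      show "depends (block (K l) j) (\<zeta> l j)" for j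
        using bsum_depends[of "K l" j F] unfolding depends_def \<zeta>_def by metis
    qed
    show "distr P borel (\<zeta> l j) = distr P borel (\<xi> l)" for j
      using distr_shift_comp[of "\<xi> l" "(int j - 1) * int (K l)"] L2_measurable[OF L2s(1)]
      unfolding \<zeta>_def[abs_def] \<xi>_def[abs_def] bsum_shift[OF meas, of _ j] by simp
  qed
  define G where "G l x = 1 / sqrt (real (p l)) * (\<Sum>j\<in>{1..p l}. \<zeta> l j x)" for l x
  have G2: "L2 P (G l)" for l
    unfolding G_def[abs_def] \<zeta>_def[abs_def] by (intro L2_cmult L2_sum L2_bsum L2)
  show ?thesis
  proof (rule P.char_limit_L2[OF L2_nsum[OF L2] G2])
    show "(\<lambda>l. char (distr P borel (G l)) t) \<longlonglongrightarrow> complex_of_real (exp (- s * t\<^sup>2 / 2))"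
      using main by (simp add: G_def[abs_def])
    show "(\<lambda>l. nrm P (\<lambda>x. nsum F l x - G l x)) \<longlonglongrightarrow> 0"
    proof (rule Lim_null_comparison)
      \<comment> \<open>Each of the p sub-blocks contributes the bound of \<open>bsum_error\<close>,
        and fewer than p summands are left over after the last full sub-block, each of norm
        \<open>nrm P F\<close>.\<close>
      show "\<forall>\<^sub>F l in sequentially. norm (nrm P (\<lambda>x. nsum F l x - G l x)) \<le>
          real (p l) / sqrt (real l) * (2 * suminf \<tau> + nrm P F)"
        using p_pos
      proof eventually_elim
        case (elim l)
        define D where "D j x = (\<Sum>t\<in>block (K l) j. F (shift t x)) - bsum F (K l) j x" for j x
        define R where "R x = (\<Sum>t\<in>{int (p l * K l) + 1..int l}. F (shift t x))" for x
        have D2: "L2 P (D j)" for j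
          unfolding D_def[abs_def] by (intro L2_diff L2_sum L2_shift L2_bsum L2)
        have R2: "L2 P R" unfolding R_def[abs_def] by (intro L2_sum L2_shift L2)
        have pKl: "p l * K l \<le> l" by (simp add: K_def)
        have blocks: "(\<Sum>j\<in>{1..q}. \<Sum>t\<in>block (K l) j. F (shift t x)) = (\<Sum>t\<in>{1..int (q * K l)}. F (shift t x))" for q x
        proof (induction q)
          case (Suc q)
          define a where "a = int (q * K l)"
          have "a \<ge> 0" unfolding a_def by (rule of_nat_0_le_iff)
          have blk: "block (K l) (Suc q) = {a + 1..a + int (K l)}"
            by (simp add: block_def a_def algebra_simps)
          have sq: "int (Suc q * K l) = a + int (K l)" by (simp add: a_def)
          have "{1..a + int (K l)} = {1..a} \<union> {a + 1..a + int (K l)}" using \<open>a \<ge> 0\<close> by auto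
          then have "{1..int (Suc q * K l)} = {1..int (q * K l)} \<union> block (K l) (Suc q)"
            unfolding blk sq a_def[symmetric] .
          moreover have "{1..int (q * K l)} \<inter> block (K l) (Suc q) = {}"
            unfolding blk a_def[symmetric] by auto
          ultimately show ?case using Suc by (simp add: sum.union_disjoint)
        qed simp
        have "nsum F l x - G l x = 1 / sqrt (real l) * ((\<Sum>j\<in>{1..p l}. D j x) + R x)" for x
        proof -
          have "{1..int l} = {1..int a} \<union> {int a + 1..int l}" if "a \<le> l" for a using that by auto
          from this[OF pKl] have "{1..int l} = {1..int (p l * K l)} \<union> {int (p l * K l) + 1..int l}" .
          then have "(\<Sum>t\<in>{1..int l}. F (shift t x)) = (\<Sum>t\<in>{1..int (p l * K l)}. F (shift t x)) + R x"
            unfolding R_def by (simp only:) (rule sum.union_disjoint, auto)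
          also have "(\<Sum>t\<in>{1..int (p l * K l)}. F (shift t x)) = (\<Sum>j\<in>{1..p l}. D j x) + (\<Sum>j\<in>{1..p l}. bsum F (K l) j x)"
            unfolding blocks[symmetric] by (simp add: D_def sum_subtractf)
          moreover have "G l x = 1 / sqrt (real l) * (\<Sum>j\<in>{1..p l}. bsum F (K l) j x)"
            unfolding G_def \<zeta>_def sum_distrib_left[symmetric] using elim by (simp add: real_sqrt_divide)
          ultimately show ?thesis by (simp add: nsum_def add_divide_distrib)
        qed
        then have "nrm P (\<lambda>x. nsum F l x - G l x) = 1 / sqrt (real l) * nrm P (\<lambda>x. (\<Sum>j\<in>{1..p l}. D j x) + R x)"
          by (simp only: nrm_cmult) simp
        also have "nrm P (\<lambda>x. (\<Sum>j\<in>{1..p l}. D j x) + R x) \<le> real (p l) * (2 * suminf \<tau>) + real (p l) * nrm P F"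
        proof -
          have "nrm P (\<lambda>x. (\<Sum>j\<in>{1..p l}. D j x) + R x) \<le> nrm P (\<lambda>x. \<Sum>j\<in>{1..p l}. D j x) + nrm P R"
            by (intro nrm_triangle L2_sum D2 R2)
          moreover have "nrm P (\<lambda>x. \<Sum>j\<in>{1..p l}. D j x) \<le> real (p l) * (2 * suminf \<tau>)"
          proof -
            have "nrm P (\<lambda>x. \<Sum>j\<in>{1..p l}. D j x) \<le> (\<Sum>j\<in>{1..p l}. nrm P (D j))" by (intro nrm_sum D2)
            also have "\<dots> \<le> of_nat (card {1..p l}) * (2 * suminf \<tau>)"
              by (intro sum_bounded_above) (simp add: D_def[abs_def] bsum_error[OF F sm])
            finally show ?thesis by simp
          qed
          moreover have "nrm P R \<le> real (p l) * nrm P F"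
          proof -
            have "nrm P R \<le> (\<Sum>t\<in>{int (p l * K l) + 1..int l}. nrm P (\<lambda>x. F (shift t x)))"
              unfolding R_def[abs_def] by (intro nrm_sum L2_shift L2)
            also have "\<dots> = real (l - p l * K l) * nrm P F"
            proof -
              have "card {int a + 1..int l} = l - a" for a by simp
              from this[of "p l * K l"] show ?thesis by (simp only: nrm_shift meas sum_constant)
            qed
            also have "\<dots> \<le> real (p l) * nrm P F"
            proof (rule mult_right_mono)
              have "l - p l * K l = l mod p l" by (simp add: K_def minus_mult_div_eq_mod)
              also have "\<dots> \<le> p l" using elim by (simp add: less_imp_le)
              finally show "real (l - p l * K l) \<le> real (p l)" by simp
            qed simp
            finally show ?thesis .
          qed
          ultimately show ?thesis by linarith
        qed
        finally have "nrm P (\<lambda>x. nsum F l x - G l x) \<le> 1 / sqrt (real l) * (real (p l) * (2 * suminf \<tau>) + real (p l) * nrm P F)"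
          by (simp add: divide_right_mono)
        also have "\<dots> = real (p l) / sqrt (real l) * (2 * suminf \<tau> + nrm P F)"
          by (simp add: algebra_simps add_divide_distrib)
        finally show ?case by simp
      qed
      show "(\<lambda>l. real (p l) / sqrt (real l) * (2 * suminf \<tau> + nrm P F)) \<longlonglongrightarrow> 0"
        using tendsto_mult_right[OF p_sqrt, of "2 * suminf \<tau> + nrm P F"] by simp
    qed
  qed
qed

end

section \<open>Block statistics\<close>

text \<open>Scaling a standard normal variable includes \<sigma> = 0 as a point mass, so the
  characteristic function needs no case distinction.\<close>

definition real_gauss :: "real \<Rightarrow> real measure" where
  "real_gauss \<sigma> = distr std_normal_distribution borel (\<lambda>x. \<sigma> * x)"

lemma real_distribution_gauss: "real_distribution (real_gauss \<sigma>)"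
proof -
  interpret real_distribution std_normal_distribution by (rule real_dist_normal_dist)
  show ?thesis unfolding real_gauss_def by (rule real_distribution_distr) simp
qed

lemma char_gauss: "char (real_gauss \<sigma>) t = complex_of_real (exp (- \<sigma>\<^sup>2 * t\<^sup>2 / 2))"
proof -
  have "distr std_normal_distribution borel (\<lambda>x. x) = std_normal_distribution"
    by (rule distr_id2) simp
  then show ?thesis
    unfolding real_gauss_def by (subst char_cmult) (simp_all add: char_std_normal_distribution power_mult_distrib)
qed

lemma centred_normal_eq_gauss: "v \<ge> 0 \<Longrightarrow> centred_normal v = real_gauss (sqrt v)"
proof (cases "v = 0")
  case True
  interpret real_distribution std_normal_distribution by (rule real_dist_normal_dist)
  show ?thesis
    using True by (simp add: centred_normal_def real_gauss_def distr_const)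
next
  case False
  assume "v \<ge> 0"
  with False have v: "v > 0" by simp
  interpret S: real_distribution std_normal_distribution by (rule real_dist_normal_dist)
  have "distributed std_normal_distribution lborel (\<lambda>x. x) (\<lambda>x. ennreal (std_normal_density x))"
    by (auto simp: distributed_def distr_id2)
  from S.normal_density_affine[OF this, of "sqrt v" 0] v
  have "distributed std_normal_distribution lborel (\<lambda>x. sqrt v * x) (\<lambda>x. ennreal (normal_density 0 (sqrt v) x))"
    by simp
  then have "distr std_normal_distribution lborel (\<lambda>x. sqrt v * x) = density lborel (\<lambda>x. ennreal (normal_density 0 (sqrt v) x))"
    by (rule distributed_distr_eq_density)
  moreover have "distr std_normal_distribution lborel (\<lambda>x. sqrt v * x) = distr std_normal_distribution borel (\<lambda>x. sqrt v * x)"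
    by (rule distr_cong) auto
  ultimately show ?thesis using False by (simp add: centred_normal_def real_gauss_def)
qed

lemma L2_std_normal: "L2 std_normal_distribution (\<lambda>x. \<sigma> * x)"
  by (intro L2_cmult) (simp add: L2_def integrable_std_normal_distribution_moment)

context noise
begin

lemma wdep_cmult:
  assumes "wdep \<tau> F"
  shows "wdep (\<lambda>r. \<bar>c\<bar> * \<tau> r) (\<lambda>x. c * F x)"
  unfolding wdep_def
proof (intro conjI allI impI)
  show "L2 P (\<lambda>x. c * F x)" by (intro L2_cmult wdep_L2[OF assms])
  fix r and A :: "int set" assume A: "{- int r..int r} \<subseteq> A"
  have "nrm P (\<lambda>x. c * F x - CE A (\<lambda>x. c * F x) x) = \<bar>c\<bar> * nrm P (\<lambda>x. F x - CE A F x)"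
    by (simp add: CE_cmult nrm_cmult flip: right_diff_distrib)
  also have "\<dots> \<le> \<bar>c\<bar> * \<tau> r" by (intro mult_left_mono wdepD[OF assms A]) simp
  finally show "nrm P (\<lambda>x. c * F x - CE A (\<lambda>x. c * F x) x) \<le> \<bar>c\<bar> * \<tau> r" .
qed

lemma wdep_lincomb:
  assumes "finite I" "\<And>k. k \<in> I \<Longrightarrow> wdep \<tau> (F k)"
  shows "wdep (\<lambda>r. (\<Sum>k\<in>I. \<bar>d k\<bar>) * \<tau> r) (\<lambda>x. \<Sum>k\<in>I. d k * F k x)"
  using assms
proof (induction I)
  case empty
  show ?case by (simp add: wdep_def CE_const P.L2_const nrm_def)
next
  case (insert k I)
  have "wdep (\<lambda>r. \<bar>-1\<bar> * ((\<Sum>k\<in>I. \<bar>d k\<bar>) * \<tau> r)) (\<lambda>x. (-1) * (\<Sum>k\<in>I. d k * F k x))"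
    using insert by (intro wdep_cmult) auto
  with wdep_diff[OF wdep_cmult[of \<tau> "F k" "d k"] this] insert
  show ?case by (simp add: algebra_simps)
qed

end

text \<open>The setting after transport and cutoff: \<open>F k\<close> will be the power of X_0
  placed in coordinate k, \<open>G\<close> the product of g and the cutoff, \<open>d\<close> the
  gradient at \<open>v0\<close>. Differentiability of \<open>G\<close> is asked at \<open>v0\<close>
  alone, since the delta method looks nowhere else; the Lipschitz bound handles the rest.\<close>

locale block_means = noise \<mu> for \<mu> :: "real measure" +
  fixes F :: "'m::finite \<Rightarrow> (int \<Rightarrow> real) \<Rightarrow> real" and \<tau> :: "nat \<Rightarrow> real" and v0 :: "real^'m"
    and G :: "real^'m \<Rightarrow> real" and L :: real and d :: "'m \<Rightarrow> real" and s :: real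
  assumes wdep_F: "\<And>k. wdep \<tau> (F k)" and summable_\<tau>: "summable \<tau>"
    and v0: "\<And>k. v0 $ k = (\<integral>x. F k x \<partial>P)"
    and G_lip: "\<And>x y. \<bar>G x - G y\<bar> \<le> L * norm (x - y)" and G_v0: "G v0 = 0"
    and G_deriv: "(G has_derivative (\<lambda>v. \<Sum>k\<in>UNIV. d k * v $ k)) (at v0)"
    and lrv: "(\<lambda>l. \<integral>x. (nsum (\<lambda>x. \<Sum>k\<in>UNIV. d k * (F k x - v0 $ k)) l x)\<^sup>2 \<partial>P) \<longlonglongrightarrow> s"
begin

definition BM :: "nat \<Rightarrow> nat \<Rightarrow> (int \<Rightarrow> real) \<Rightarrow> real^'m" where
  "BM l j x = (\<chi> k. 1 / real l * (\<Sum>t\<in>block l j. F k (shift t x)))"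

text \<open>\<open>BT\<close> and \<open>WT\<close> are the surrogates of \<open>BM\<close> and
  \<open>W\<close> built from \<open>bsum\<close>; over different blocks they are independent and
  identically distributed.\<close>

definition BT :: "nat \<Rightarrow> nat \<Rightarrow> (int \<Rightarrow> real) \<Rightarrow> real^'m" where
  "BT l j x = (\<chi> k. 1 / real l * bsum (F k) l j x)"

definition W :: "nat \<Rightarrow> nat \<Rightarrow> (int \<Rightarrow> real) \<Rightarrow> real" where
  "W l j x = sqrt (real l) * G (BM l j x)"

definition WT :: "nat \<Rightarrow> nat \<Rightarrow> (int \<Rightarrow> real) \<Rightarrow> real" where
  "WT l j x = sqrt (real l) * G (BT l j x)"

definition Fc :: "'m \<Rightarrow> (int \<Rightarrow> real) \<Rightarrow> real" where
  "Fc k x = F k x - v0 $ k"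

text \<open>A majorant for everything about the first block: it dominates sqrt l times the deviation
  of the block mean from \<open>v0\<close>, is bounded in L2 by \<open>NB\<close>, and is
  asymptotically uniformly integrable.\<close>

definition N :: "nat \<Rightarrow> (int \<Rightarrow> real) \<Rightarrow> real" where
  "N l x = (\<Sum>k\<in>UNIV. \<bar>nsum (Fc k) l x\<bar>)"

definition NB :: real where
  "NB = (\<Sum>k\<in>UNIV. sqrt ((nrm P (Fc k))\<^sup>2 + 8 * nrm P (Fc k) * suminf \<tau>))"

lemma L_nonneg: "L \<ge> 0"
proof -
  have "\<bar>G (axis undefined 1) - G 0\<bar> \<le> L * norm (axis undefined 1 - 0 :: real^'m)" by (rule G_lip)
  then show ?thesis by simp
qed

lemma L2_F: "L2 P (F k)" by (rule wdep_L2[OF wdep_F])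

lemma F_measurable [measurable]: "F k \<in> borel_measurable P" by (rule L2_measurable[OF L2_F])

lemma G_measurable [measurable]: "G \<in> borel_measurable borel"
proof (rule borel_measurable_continuous_onI)
  have "L-lipschitz_on UNIV G"
    using G_lip L_nonneg by (auto simp: lipschitz_on_def dist_norm)
  then show "continuous_on UNIV G" by (rule lipschitz_on_continuous_on)
qed

lemma measurable_vec [measurable]:
  assumes "\<And>k. (\<lambda>x. f x k) \<in> borel_measurable P"
  shows "(\<lambda>x. \<chi> k. f x k :: real^'m) \<in> borel_measurable P"
  by (rule borel_measurable_euclidean_space[THEN iffD2])
    (auto simp: Basis_vec_def inner_axis assms)

lemma BM_measurable [measurable]: "BM l j \<in> borel_measurable P"
  unfolding BM_def[abs_def] by measurable

lemma bsum_measurable [measurable]: "bsum (F k) l j \<in> borel_measurable P"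
  by (rule L2_measurable[OF L2_bsum[OF L2_F]])

lemma BT_measurable [measurable]: "BT l j \<in> borel_measurable P"
  unfolding BT_def[abs_def] by measurable

lemma W_measurable [measurable]: "W l j \<in> borel_measurable P"
  unfolding W_def[abs_def] by measurable

lemma WT_measurable [measurable]: "WT l j \<in> borel_measurable P"
  unfolding WT_def[abs_def] by measurable

lemma wdep_Fc: "wdep \<tau> (Fc k)"
  unfolding Fc_def[abs_def] by (rule wdep_diff_const[OF wdep_F])

lemma mean_Fc: "(\<integral>x. Fc k x \<partial>P) = 0"
  using P.L2_integrable[OF L2_F] by (simp add: Fc_def v0 prob_UNIV)

lemma L2_nsum_Fc: "L2 P (nsum (Fc k) l)"
  by (rule L2_nsum[OF wdep_L2[OF wdep_Fc]])

lemma L2_N: "L2 P (N l)"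
  unfolding N_def[abs_def] by (intro L2_sum L2_abs L2_nsum_Fc)

lemma nrm_N_le: "nrm P (N l) \<le> NB"
proof -
  have "nrm P (N l) \<le> (\<Sum>k\<in>UNIV. nrm P (\<lambda>x. \<bar>nsum (Fc k) l x\<bar>))"
    unfolding N_def[abs_def] by (intro nrm_sum L2_abs L2_nsum_Fc)
  also have "\<dots> \<le> NB"
    unfolding NB_def nrm_abs by (intro sum_mono nrm_nsum_le wdep_Fc summable_\<tau> mean_Fc)
  finally show ?thesis .
qed

lemma N_nonneg: "N l x \<ge> 0"
  by (simp add: N_def sum_nonneg)

lemma ui2_N: "ui2 P N"
  unfolding N_def[abs_def]
proof (intro ui2_sum L2_abs L2_nsum_Fc)
  fix k
  show "ui2 P (\<lambda>n x. \<bar>nsum (Fc k) n x\<bar>)"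
    by (rule ui2_lipschitz[OF ui2_nsum[OF wdep_Fc summable_\<tau> mean_Fc] L2_nsum_Fc, where K=1 and c=0])
      (auto intro: L2_measurable L2_abs L2_nsum_Fc)
qed

lemma BM_minus_v0:
  assumes "l > 0"
  shows "(BM l 1 x - v0) $ k = 1 / sqrt (real l) * nsum (Fc k) l x"
proof -
  have "(\<Sum>t\<in>block l 1. Fc k (shift t x)) = (\<Sum>t\<in>block l 1. F k (shift t x)) - real l * v0 $ k"
    by (simp add: Fc_def sum_subtractf)
  then have "(BM l 1 x - v0) $ k = 1 / real l * (\<Sum>t\<in>block l 1. Fc k (shift t x))"
    using assms by (simp add: BM_def field_simps)
  also have "\<dots> = 1 / sqrt (real l) * nsum (Fc k) l x"
    using assms by (simp add: nsum_def block_one[unfolded One_nat_def])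
  finally show ?thesis .
qed

lemma norm_BM_le: "sqrt (real l) * norm (BM l 1 x - v0) \<le> N l x"
proof (cases "l = 0")
  case False
  have "norm (BM l 1 x - v0) \<le> (\<Sum>k\<in>UNIV. \<bar>(BM l 1 x - v0) $ k\<bar>)" by (rule norm_le_l1_cart)
  also have "\<dots> = 1 / sqrt (real l) * N l x"
    using False by (simp only: BM_minus_v0) (simp add: N_def abs_mult sum_divide_distrib)
  finally show ?thesis using False by (simp add: field_simps)
qed (simp add: N_nonneg)

lemma abs_W_le: "\<bar>W l 1 x\<bar> \<le> L * N l x"
proof -
  have "\<bar>W l 1 x\<bar> = sqrt (real l) * \<bar>G (BM l 1 x) - G v0\<bar>" by (simp add: W_def G_v0 abs_mult)
  also have "\<dots> \<le> sqrt (real l) * (L * norm (BM l 1 x - v0))" by (intro mult_left_mono G_lip) simp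
  also have "\<dots> = L * (sqrt (real l) * norm (BM l 1 x - v0))" by simp
  also have "\<dots> \<le> L * N l x" by (intro mult_left_mono norm_BM_le L_nonneg)
  finally show ?thesis .
qed

lemma BM_shift: "BM l j x = BM l 1 (shift ((int j - 1) * int l) x)"
  unfolding BM_def
  by (subst block_shift, subst sum.reindex) (auto simp: inj_on_def shift_shift)

lemma W_shift: "W l j x = W l 1 (shift ((int j - 1) * int l) x)"
  by (simp add: W_def BM_shift[of l j])

lemma WT_shift: "WT l j x = WT l 1 (shift ((int j - 1) * int l) x)"
  by (simp add: WT_def BT_def bsum_shift[OF F_measurable, of _ l j])

lemma L2_W: "L2 P (W l j)"
proof -
  have "L2 P (W l 1)"
    by (rule L2_bound(1)[OF L2_cmult[OF L2_N, of L l]])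
      (use abs_W_le[of l] L_nonneg N_nonneg[of l] in \<open>auto simp: abs_mult\<close>)
  from L2_shift[OF this] show ?thesis by (simp add: W_shift[of l j, abs_def])
qed

definition WC :: real where
  "WC = L * real CARD('m) * (2 * suminf \<tau>)"

text \<open>The orders are sqrt l from the statistic, 1 / l from the mean and a bounded error of
  each coordinate's block sum, hence 1 / sqrt l in total.\<close>

lemma W_WT:
  shows "L2 P (\<lambda>x. W l j x - WT l j x)" "nrm P (\<lambda>x. W l j x - WT l j x) \<le> WC / sqrt (real l)"
proof -
  define D where "D k x = (\<Sum>t\<in>block l j. F k (shift t x)) - bsum (F k) l j x" for k x
  have D2: "L2 P (D k)" for k
    unfolding D_def[abs_def] by (intro L2_diff L2_sum L2_shift L2_bsum L2_F)
  have bd: "\<bar>W l j x - WT l j x\<bar> \<le> L / sqrt (real l) * (\<Sum>k\<in>UNIV. \<bar>D k x\<bar>)" for x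
  proof (cases "l = 0")
    case False
    have "\<bar>W l j x - WT l j x\<bar> = sqrt (real l) * \<bar>G (BM l j x) - G (BT l j x)\<bar>"
      by (simp add: W_def WT_def abs_mult flip: right_diff_distrib)
    also have "\<dots> \<le> sqrt (real l) * (L * norm (BM l j x - BT l j x))"
      by (intro mult_left_mono G_lip) simp
    also have "\<dots> \<le> sqrt (real l) * (L * (\<Sum>k\<in>UNIV. \<bar>(BM l j x - BT l j x) $ k\<bar>))"
      by (intro mult_left_mono norm_le_l1_cart L_nonneg) simp
    also have "(\<Sum>k\<in>UNIV. \<bar>(BM l j x - BT l j x) $ k\<bar>) = 1 / real l * (\<Sum>k\<in>UNIV. \<bar>D k x\<bar>)"
    proof -
      have "(BM l j x - BT l j x) $ k = 1 / real l * D k x" for k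
        by (simp add: BM_def BT_def D_def diff_divide_distrib)
      then show ?thesis by (simp add: abs_mult sum_distrib_left)
    qed
    also have "sqrt (real l) * (L * (1 / real l * (\<Sum>k\<in>UNIV. \<bar>D k x\<bar>))) = L / sqrt (real l) * (\<Sum>k\<in>UNIV. \<bar>D k x\<bar>)"
      using False real_div_sqrt[of "real l"] by (simp add: field_simps)
    finally show ?thesis .
  qed (simp add: W_def WT_def)
  have L2: "L2 P (\<lambda>x. L / sqrt (real l) * (\<Sum>k\<in>UNIV. \<bar>D k x\<bar>))"
    by (intro L2_cmult L2_sum L2_abs D2)
  have ae: "AE x in P. \<bar>W l j x - WT l j x\<bar> \<le> \<bar>L / sqrt (real l) * (\<Sum>k\<in>UNIV. \<bar>D k x\<bar>)\<bar>"
    using bd by (intro AE_I2 order_trans[OF _ abs_ge_self])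
  show "L2 P (\<lambda>x. W l j x - WT l j x)" by (rule L2_bound(1)[OF L2 _ ae]) simp
  have "nrm P (\<lambda>x. W l j x - WT l j x) \<le> nrm P (\<lambda>x. L / sqrt (real l) * (\<Sum>k\<in>UNIV. \<bar>D k x\<bar>))"
    by (rule L2_bound(2)[OF L2 _ ae]) simp
  also have "\<dots> = L / sqrt (real l) * nrm P (\<lambda>x. \<Sum>k\<in>UNIV. \<bar>D k x\<bar>)"
    unfolding nrm_cmult using L_nonneg by simp
  also have "\<dots> \<le> L / sqrt (real l) * (real CARD('m) * (2 * suminf \<tau>))"
  proof (rule mult_left_mono)
    have "nrm P (\<lambda>x. \<Sum>k\<in>UNIV. \<bar>D k x\<bar>) \<le> (\<Sum>k\<in>UNIV. nrm P (\<lambda>x. \<bar>D k x\<bar>))"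
      by (intro nrm_sum L2_abs D2)
    also have "\<dots> \<le> of_nat (card (UNIV :: 'm set)) * (2 * suminf \<tau>)"
      unfolding nrm_abs D_def[abs_def] by (intro sum_bounded_above bsum_error wdep_F summable_\<tau>)
    finally show "nrm P (\<lambda>x. \<Sum>k\<in>UNIV. \<bar>D k x\<bar>) \<le> real CARD('m) * (2 * suminf \<tau>)" by simp
  qed (simp add: L_nonneg)
  finally show "nrm P (\<lambda>x. W l j x - WT l j x) \<le> WC / sqrt (real l)" by (simp add: WC_def)
qed

lemma L2_WT: "L2 P (WT l j)"
  using L2_diff[OF L2_W[of l j] W_WT(1)[of l j]] by simp

lemma inv_sqrt_0: "(\<lambda>l. c / sqrt (real l)) \<longlonglongrightarrow> 0"
  by (intro tendsto_divide_0[OF tendsto_const] filterlim_at_top_imp_at_infinity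
      filterlim_compose[OF sqrt_at_top filterlim_real_sequentially])

lemma W_WT_lim: "(\<lambda>l. nrm P (\<lambda>x. W l j x - WT l j x)) \<longlonglongrightarrow> 0"
  by (rule Lim_null_comparison[OF _ inv_sqrt_0[of WC]]) (auto intro!: always_eventually W_WT(2))

lemma ui2_WT: "ui2 P (\<lambda>l. WT l 1)"
proof (rule ui2_perturb[OF L2_WT L2_W])
  show "ui2 P (\<lambda>l. W l 1)"
  \<comment> \<open>\<open>L + 1\<close> because \<open>ui2_lipschitz\<close> asks for a positive
    factor and \<open>L\<close> may be 0.\<close>
  proof (rule ui2_lipschitz[OF ui2_N L2_N, where K="L + 1" and c=0])
    fix l x
    show "\<bar>W l 1 x\<bar> \<le> (L + 1) * \<bar>N l x\<bar> + 0"
      using abs_W_le[of l x] N_nonneg[of l x] by (simp add: distrib_right)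
  qed (use L_nonneg in auto)
  show "(\<lambda>l. nrm P (\<lambda>x. WT l 1 x - W l 1 x)) \<longlonglongrightarrow> 0"
    using W_WT_lim[of 1] unfolding nrm_commute[of P "W _ 1"] .
qed

lemma nrm_WT_bound: "\<exists>B. \<forall>l. nrm P (WT l 1) \<le> B"
proof -
  have "nrm P (W l 1) \<le> L * NB" for l
  proof -
    have "nrm P (W l 1) \<le> nrm P (\<lambda>x. L * N l x)"
      by (rule L2_bound(2)[OF L2_cmult[OF L2_N]])
        (use abs_W_le[of l] L_nonneg N_nonneg[of l] in \<open>auto simp: abs_mult\<close>)
    also have "\<dots> = L * nrm P (N l)" using L_nonneg by (simp add: nrm_cmult)
    also have "\<dots> \<le> L * NB" by (intro mult_left_mono nrm_N_le L_nonneg)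
    finally show ?thesis .
  qed
  moreover have "nrm P (WT l 1) \<le> nrm P (W l 1) + nrm P (\<lambda>x. W l 1 x - WT l 1 x)" for l
    using nrm_triangle_diff[OF L2_W[of l 1] W_WT(1)[of l 1]] by simp
  moreover have "nrm P (\<lambda>x. W l 1 x - WT l 1 x) \<le> \<bar>WC\<bar>" for l
  proof -
    have "WC / sqrt (real l) \<le> \<bar>WC\<bar> / 1"
    proof (cases "l = 0")
      case False
      then have "WC / sqrt (real l) \<le> \<bar>WC\<bar> / sqrt (real l)" by (intro divide_right_mono) auto
      also have "\<dots> \<le> \<bar>WC\<bar> / 1" using False by (intro divide_left_mono) auto
      finally show ?thesis .
    qed simp
    then show ?thesis using W_WT(2)[of l 1] by simp
  qed
  ultimately show ?thesis by (intro exI[of _ "L * NB + \<bar>WC\<bar>"]) (meson add_mono order_trans)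
qed

lemma WT_depends: "depends (block l j) (WT l j)"
  unfolding depends_def WT_def BT_def
proof (intro allI impI)
  fix x y :: "int \<Rightarrow> real" assume "\<forall>u\<in>block l j. x u = y u"
  then have "bsum (F k) l j x = bsum (F k) l j y" for k
    using bsum_depends[of l j "F k"] unfolding depends_def by blast
  then show "sqrt (real l) * G (\<chi> k. 1 / real l * bsum (F k) l j x) = sqrt (real l) * G (\<chi> k. 1 / real l * bsum (F k) l j y)"
    by simp
qed

lemma WT_indep: "P.indep_vars (\<lambda>_. borel) (WT l) J"
  by (rule indep_depends[OF WT_measurable WT_depends disjoint_blocks])

lemma WT_law: "distr P borel (WT l j) = distr P borel (WT l 1)"
  using distr_shift_comp[OF WT_measurable, of l 1 "(int j - 1) * int l"]
  by (simp add: WT_shift[of l j, abs_def])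

section \<open>Delta method and weak convergence for a single block statistic\<close>

definition Y :: "(int \<Rightarrow> real) \<Rightarrow> real" where
  "Y x = (\<Sum>k\<in>UNIV. d k * Fc k x)"

lemma nsum_Y: "nsum Y l x = (\<Sum>k\<in>UNIV. d k * nsum (Fc k) l x)"
proof -
  have "(\<Sum>t\<in>{1..int l}. Y (shift t x)) = (\<Sum>k\<in>UNIV. \<Sum>t\<in>{1..int l}. d k * Fc k (shift t x))"
    unfolding Y_def by (rule sum.swap)
  then have "nsum Y l x = 1 / sqrt (real l) * (\<Sum>k\<in>UNIV. d k * (\<Sum>t\<in>{1..int l}. Fc k (shift t x)))"
    by (simp add: nsum_def sum_distrib_left)
  also have "\<dots> = (\<Sum>k\<in>UNIV. d k * nsum (Fc k) l x)"
    unfolding sum_distrib_left[of "1 / sqrt (real l)"] by (intro sum.cong refl) (simp add: nsum_def)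
  finally show ?thesis .
qed

text \<open>Near \<open>v0\<close> the linearisation error is at most \<epsilon> N. Elsewhere N is
  at least \<delta> sqrt l, so the crude linear bound in N may be multiplied by N / (\<delta> sqrt
  l). The resulting square is why the convergence is stated in L1: only N^2 has a bounded
  integral.\<close>

lemma delta_method: "(\<lambda>l. \<integral>x. \<bar>W l 1 x - nsum Y l x\<bar> \<partial>P) \<longlonglongrightarrow> 0"
proof (rule LIMSEQ_I)
  fix e :: real assume e: "e > 0"
  define d1 where "d1 = (\<Sum>k\<in>UNIV. \<bar>d k\<bar>)"
  have d1: "d1 \<ge> 0" by (simp add: d1_def sum_nonneg)
  have NB: "NB \<ge> 0" using nrm_N_le[of 0] nrm_nonneg order_trans by blast
  \<comment> \<open>Makes \<epsilon> NB at most e / 2; the added 1 covers NB = 0.\<close>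
  define \<epsilon> where "\<epsilon> = e / (2 * (NB + 1))"
  have \<epsilon>: "\<epsilon> > 0" using e NB by (simp add: \<epsilon>_def)
  obtain \<delta> where \<delta>: "\<delta> > 0"
    "\<And>y. norm (y - v0) < \<delta> \<Longrightarrow> norm (G y - G v0 - (\<Sum>k\<in>UNIV. d k * (y - v0) $ k)) \<le> \<epsilon> * norm (y - v0)"
    using G_deriv[unfolded has_derivative_at_alt] \<epsilon> by blast
  have bd: "\<bar>W l 1 x - nsum Y l x\<bar> \<le> \<epsilon> * N l x + (L + d1) / (\<delta> * sqrt (real l)) * (N l x)\<^sup>2" if l: "l > 0" for l x
  proof -
    define v where "v = BM l 1 x - v0"
    have sl: "sqrt (real l) > 0" using l by simp
    have vk: "sqrt (real l) * v $ k = nsum (Fc k) l x" for k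
      unfolding v_def BM_minus_v0[OF l] using sl by simp
    have eq: "W l 1 x - nsum Y l x = sqrt (real l) * (G (BM l 1 x) - G v0 - (\<Sum>k\<in>UNIV. d k * v $ k))"
      by (simp add: W_def G_v0 nsum_Y right_diff_distrib sum_distrib_left vk[symmetric] mult.left_commute)
    have vN: "sqrt (real l) * norm v \<le> N l x" unfolding v_def by (rule norm_BM_le)
    show ?thesis
    proof (cases "norm v < \<delta>")
      case True
      then have "\<bar>G (BM l 1 x) - G v0 - (\<Sum>k\<in>UNIV. d k * v $ k)\<bar> \<le> \<epsilon> * norm v"
        using \<delta>(2)[of "BM l 1 x"] by (simp add: v_def)
      then have "\<bar>W l 1 x - nsum Y l x\<bar> \<le> sqrt (real l) * (\<epsilon> * norm v)"
        unfolding eq abs_mult using sl by (simp add: mult_left_mono)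
      also have "\<dots> = \<epsilon> * (sqrt (real l) * norm v)" by simp
      also have "\<dots> \<le> \<epsilon> * N l x" using \<epsilon> by (intro mult_left_mono vN) simp
      also have "\<dots> \<le> \<epsilon> * N l x + (L + d1) / (\<delta> * sqrt (real l)) * (N l x)\<^sup>2"
        using L_nonneg d1 \<delta>(1) by simp
      finally show ?thesis .
    next
      case False
      have "\<bar>nsum Y l x\<bar> \<le> (\<Sum>k\<in>UNIV. \<bar>d k\<bar> * N l x)"
        unfolding nsum_Y
      proof (rule order_trans[OF sum_abs sum_mono])
        fix k
        have "\<bar>nsum (Fc k) l x\<bar> \<le> N l x" unfolding N_def by (rule member_le_sum) auto
        then show "\<bar>d k * nsum (Fc k) l x\<bar> \<le> \<bar>d k\<bar> * N l x" by (simp add: abs_mult mult_left_mono)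
      qed
      also have "\<dots> = d1 * N l x" by (simp add: d1_def sum_distrib_right)
      finally have "\<bar>W l 1 x - nsum Y l x\<bar> \<le> (L + d1) * N l x"
        using abs_W_le[of l x] by (simp add: algebra_simps)
      also have "\<dots> \<le> (L + d1) * (N l x * (N l x / (\<delta> * sqrt (real l))))"
      proof (intro mult_left_mono)
        have "\<delta> * sqrt (real l) \<le> N l x"
        proof -
          have "\<delta> * sqrt (real l) \<le> norm v * sqrt (real l)" using False by (intro mult_right_mono) auto
          with vN show ?thesis by (simp add: mult.commute)
        qed
        then have "1 \<le> N l x / (\<delta> * sqrt (real l))" using \<delta>(1) sl by (simp add: pos_le_divide_eq)
        from mult_left_mono[OF this N_nonneg[of l x]] show "N l x \<le> N l x * (N l x / (\<delta> * sqrt (real l)))" by simp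
      qed (use L_nonneg d1 in simp)
      also have "\<dots> = (L + d1) / (\<delta> * sqrt (real l)) * (N l x)\<^sup>2" by (simp add: power2_eq_square)
      also have "\<dots> \<le> \<epsilon> * N l x + (L + d1) / (\<delta> * sqrt (real l)) * (N l x)\<^sup>2"
        using \<epsilon> N_nonneg[of l x] by simp
      finally show ?thesis .
    qed
  qed
  have "(\<lambda>l. ((L + d1) / \<delta> * NB\<^sup>2) / sqrt (real l)) \<longlonglongrightarrow> 0" by (rule inv_sqrt_0)
  from order_tendstoD(2)[OF this, of "e / 2"] e
  have "\<forall>\<^sub>F l in sequentially. ((L + d1) / \<delta> * NB\<^sup>2) / sqrt (real l) < e / 2" by simp
  then have "\<forall>\<^sub>F l in sequentially. norm ((\<integral>x. \<bar>W l 1 x - nsum Y l x\<bar> \<partial>P) - 0) < e"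
    using eventually_gt_at_top[of 0]
  proof eventually_elim
    case (elim l)
    have L2Y: "L2 P (nsum Y l)"
      unfolding nsum_Y[abs_def] by (intro L2_sum L2_cmult L2_nsum_Fc)
    have "(\<integral>x. \<bar>W l 1 x - nsum Y l x\<bar> \<partial>P) \<le> (\<integral>x. \<epsilon> * N l x + (L + d1) / (\<delta> * sqrt (real l)) * (N l x)\<^sup>2 \<partial>P)"
    proof (rule integral_mono[OF _ _ bd[OF elim(2)]])
      show "integrable P (\<lambda>x. \<bar>W l 1 x - nsum Y l x\<bar>)"
        by (intro integrable_abs P.L2_integrable L2_diff L2_W L2Y)
      show "integrable P (\<lambda>x. \<epsilon> * N l x + (L + d1) / (\<delta> * sqrt (real l)) * (N l x)\<^sup>2)"
        by (intro Bochner_Integration.integrable_add integrable_mult_right P.L2_integrable L2_N L2_sq_integrable)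
    qed
    also have "\<dots> = \<epsilon> * (\<integral>x. N l x \<partial>P) + (L + d1) / (\<delta> * sqrt (real l)) * (nrm P (N l))\<^sup>2"
      unfolding nrm_sq using P.L2_integrable[OF L2_N] L2_sq_integrable[OF L2_N] by simp
    also have "\<dots> \<le> \<epsilon> * NB + (L + d1) / (\<delta> * sqrt (real l)) * NB\<^sup>2"
    proof (intro add_mono mult_left_mono power_mono nrm_N_le)
      show "(\<integral>x. N l x \<partial>P) \<le> NB"
        using P.abs_integral_le_nrm[OF L2_N[of l]] nrm_N_le[of l] by linarith
    qed (use \<epsilon> L_nonneg d1 \<delta>(1) in auto)
    also have "\<epsilon> * NB \<le> e / 2" using e NB by (simp add: \<epsilon>_def field_simps)
    also have "(L + d1) / (\<delta> * sqrt (real l)) * NB\<^sup>2 = ((L + d1) / \<delta> * NB\<^sup>2) / sqrt (real l)" by simp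
    finally have "(\<integral>x. \<bar>W l 1 x - nsum Y l x\<bar> \<partial>P) < e" using elim(1) by linarith
    then show ?case by simp
  qed
  then show "\<exists>no. \<forall>l\<ge>no. norm ((\<integral>x. \<bar>W l 1 x - nsum Y l x\<bar> \<partial>P) - 0) < e"
    by (simp add: eventually_sequentially)
qed

lemma WT_char: "(\<lambda>l. char (distr P borel (WT l 1)) t) \<longlonglongrightarrow> complex_of_real (exp (- s * t\<^sup>2 / 2))"
proof -
  have wY: "wdep (\<lambda>r. (\<Sum>k\<in>UNIV. \<bar>d k\<bar>) * \<tau> r) Y"
    unfolding Y_def[abs_def] by (intro wdep_lincomb wdep_Fc) simp
  have smY: "summable (\<lambda>r. (\<Sum>k\<in>UNIV. \<bar>d k\<bar>) * \<tau> r)" by (intro summable_mult summable_\<tau>)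
  have meanY: "(\<integral>x. Y x \<partial>P) = 0"
    using P.L2_integrable[OF wdep_L2[OF wdep_Fc]] by (simp add: Y_def mean_Fc)
  have varY: "(\<lambda>l. \<integral>x. (nsum Y l x)\<^sup>2 \<partial>P) \<longlonglongrightarrow> s"
    using lrv by (simp add: Y_def[abs_def] Fc_def[abs_def])
  note L2Y = L2_nsum[OF wdep_L2[OF wY]]
  have W: "(\<lambda>l. char (distr P borel (W l 1)) t) \<longlonglongrightarrow> complex_of_real (exp (- s * t\<^sup>2 / 2))"
    by (rule P.char_limit_L1[OF _ _ _ delta_method nsum_clt[OF wY smY meanY varY]])
      (auto intro: P.L2_integrable L2_diff L2_W L2Y L2_measurable)
  show ?thesis
  proof (rule P.char_limit_L2[OF L2_WT L2_W _ W])
    show "(\<lambda>l. nrm P (\<lambda>x. WT l 1 x - W l 1 x)) \<longlonglongrightarrow> 0"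
      using W_WT_lim[of 1] unfolding nrm_commute[of P "W _ 1"] .
  qed
qed

lemma WT_weak_conv:
  assumes "s = \<sigma>\<^sup>2"
  shows "weak_conv_m (\<lambda>l. distr P borel (WT l 1)) (real_gauss \<sigma>)"
proof (rule levy_continuity)
  show "real_distribution (distr P borel (WT l 1))" for l by (rule P.real_distribution_distr) simp
  show "(\<lambda>l. char (distr P borel (WT l 1)) t) \<longlonglongrightarrow> char (real_gauss \<sigma>) t" for t
    using WT_char[of t] by (simp add: char_gauss assms)
qed (rule real_distribution_gauss)

end

section \<open>The Hoeffding decomposition\<close>

text \<open>Hoeffding decomposition of \<open>h\<close> under the law \<open>\<nu>\<close>: \<open>psi\<close> is the linear and \<open>hdeg\<close> the degenerate term.\<close>

definition hbar :: "(real \<times> real \<Rightarrow> real) \<Rightarrow> real measure \<Rightarrow> real \<Rightarrow> real" where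
  "hbar h \<nu> w = (\<integral>y. h (w, y) \<partial>\<nu>)"

definition hmean :: "(real \<times> real \<Rightarrow> real) \<Rightarrow> real measure \<Rightarrow> real" where
  "hmean h \<nu> = (\<integral>w. hbar h \<nu> w \<partial>\<nu>)"

definition psi :: "(real \<times> real \<Rightarrow> real) \<Rightarrow> real measure \<Rightarrow> real \<Rightarrow> real" where
  "psi h \<nu> w = hbar h \<nu> w - hmean h \<nu>"

definition hdeg :: "(real \<times> real \<Rightarrow> real) \<Rightarrow> real measure \<Rightarrow> real \<Rightarrow> real \<Rightarrow> real" where
  "hdeg h \<nu> w y = h (w, y) - hbar h \<nu> w - hbar h \<nu> y + hmean h \<nu>"

locale lip_kernel =
  fixes h :: "real \<times> real \<Rightarrow> real" and Lh :: real
  assumes h_lip: "\<bar>h (a, b) - h (c, d)\<bar> \<le> Lh * (\<bar>a - c\<bar> + \<bar>b - d\<bar>)"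
    and h_sym: "h (a, b) = h (b, a)"
begin

lemma Lh_nonneg: "Lh \<ge> 0"
  using h_lip[of 1 0 0 0] by simp

lemma h_measurable_borel: "h \<in> borel_measurable borel"
proof (rule borel_measurable_continuous_onI)
  have "(2 * Lh)-lipschitz_on UNIV h"
  proof (rule lipschitz_onI)
    fix x y :: "real \<times> real"
    have "dist (h x) (h y) \<le> Lh * (\<bar>fst x - fst y\<bar> + \<bar>snd x - snd y\<bar>)"
      using h_lip[of "fst x" "snd x" "fst y" "snd y"] by (simp add: dist_real_def)
    also have "\<dots> \<le> Lh * (dist x y + dist x y)"
      using dist_fst_le[of x y] dist_snd_le[of x y]
      by (intro mult_left_mono add_mono Lh_nonneg) (simp_all add: dist_real_def)
    finally show "dist (h x) (h y) \<le> 2 * Lh * dist x y" by simp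
  qed (use Lh_nonneg in simp)
  then show "continuous_on UNIV h" by (rule lipschitz_on_continuous_on)
qed

lemma h_measurable [measurable]:
  assumes [measurable]: "f \<in> borel_measurable M" "g \<in> borel_measurable M"
  shows "(\<lambda>x. h (f x, g x)) \<in> borel_measurable M"
proof -
  have "(\<lambda>x. (f x, g x)) \<in> borel_measurable M" by measurable
  from measurable_compose[OF this h_measurable_borel] show ?thesis .
qed

lemma abs_h_le: "\<bar>h (a, b)\<bar> \<le> \<bar>h (0, 0)\<bar> + Lh * (\<bar>a\<bar> + \<bar>b\<bar>)"
  using h_lip[of a b 0 0] unfolding diff_0_right by linarith

lemma L2_h:
  assumes "prob_space M" "L2 M f" "L2 M g"
  shows "L2 M (\<lambda>x. h (f x, g x))"
proof (rule L2_bound(1))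
  interpret prob_space M by fact
  show "L2 M (\<lambda>x. \<bar>h (0, 0)\<bar> + Lh * (\<bar>f x\<bar> + \<bar>g x\<bar>))"
    by (intro L2_add L2_const L2_cmult L2_abs assms)
  show "(\<lambda>x. h (f x, g x)) \<in> borel_measurable M"
    using assms by (intro h_measurable) (auto dest: L2_measurable)
  show "AE x in M. \<bar>h (f x, g x)\<bar> \<le> \<bar>\<bar>h (0, 0)\<bar> + Lh * (\<bar>f x\<bar> + \<bar>g x\<bar>)\<bar>"
    by (intro AE_I2 order_trans[OF abs_h_le abs_ge_self])
qed

end

locale lip_law = lip_kernel h Lh for h Lh +
  fixes \<nu> :: "real measure"
  assumes prob_nu: "prob_space \<nu>" and sets_nu: "sets \<nu> = sets borel"
    and L2_nu: "L2 \<nu> (\<lambda>x. x)"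
begin

sublocale nu: prob_space \<nu> by (rule prob_nu)

definition m :: real where "m = nrm \<nu> (\<lambda>x. x)"

lemma measurable_nu: "f \<in> borel_measurable borel \<Longrightarrow> f \<in> borel_measurable \<nu>"
  using measurable_cong_sets[OF sets_nu refl] by blast

lemma m_nonneg: "m \<ge> 0" by (simp add: m_def)

lemma abs_int: "integrable \<nu> (\<lambda>y. \<bar>y\<bar>)" "(\<integral>y. \<bar>y\<bar> \<partial>\<nu>) \<le> m"
  using nu.L2_integrable[OF L2_nu] nu.integral_abs_le_nrm[OF L2_nu] by (auto simp: m_def)

lemma integral_abs_le:
  fixes f :: "real \<Rightarrow> real"
  assumes f: "f \<in> borel_measurable borel" and bd: "\<And>y. \<bar>f y\<bar> \<le> c + K * \<bar>y\<bar>" and "K \<ge> 0"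
  shows "integrable \<nu> f" "\<bar>\<integral>y. f y \<partial>\<nu>\<bar> \<le> c + K * m"
proof -
  have int: "integrable \<nu> (\<lambda>y. c + K * \<bar>y\<bar>)" using abs_int by simp
  show i: "integrable \<nu> f"
    by (rule Bochner_Integration.integrable_bound[OF int measurable_nu[OF f]])
      (use bd in \<open>auto intro!: AE_I2 order_trans[OF _ abs_ge_self]\<close>)
  have "\<bar>\<integral>y. f y \<partial>\<nu>\<bar> \<le> (\<integral>y. \<bar>f y\<bar> \<partial>\<nu>)" by (rule integral_abs_bound)
  also have "\<dots> \<le> (\<integral>y. c + K * \<bar>y\<bar> \<partial>\<nu>)" using i int bd by (intro integral_mono) auto
  also have "\<dots> = c + K * (\<integral>y. \<bar>y\<bar> \<partial>\<nu>)" using abs_int by (simp add: nu.prob_space)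
  also have "\<dots> \<le> c + K * m" using abs_int(2) \<open>K \<ge> 0\<close> by (intro add_left_mono mult_left_mono)
  finally show "\<bar>\<integral>y. f y \<partial>\<nu>\<bar> \<le> c + K * m" .
qed

lemma int_h: "integrable \<nu> (\<lambda>y. h (w, y))"
  by (rule integral_abs_le(1)[where c="\<bar>h (0, 0)\<bar> + Lh * \<bar>w\<bar>" and K=Lh])
    (use abs_h_le[of w] Lh_nonneg in \<open>auto simp: algebra_simps\<close>)

lemma hbar_lip: "\<bar>hbar h \<nu> w - hbar h \<nu> w'\<bar> \<le> Lh * \<bar>w - w'\<bar>"
proof -
  have "hbar h \<nu> w - hbar h \<nu> w' = (\<integral>y. h (w, y) - h (w', y) \<partial>\<nu>)"
    using int_h by (simp add: hbar_def)
  also have "\<bar>\<dots>\<bar> \<le> Lh * \<bar>w - w'\<bar> + 0 * m"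
  proof (rule integral_abs_le(2))
    show "\<bar>h (w, y) - h (w', y)\<bar> \<le> Lh * \<bar>w - w'\<bar> + 0 * \<bar>y\<bar>" for y
      using h_lip[of w y w' y] by simp
  qed simp_all
  finally show ?thesis by simp
qed

lemma hbar_measurable_borel: "hbar h \<nu> \<in> borel_measurable borel"
proof (rule borel_measurable_continuous_onI)
  have "Lh-lipschitz_on UNIV (hbar h \<nu>)"
    using hbar_lip Lh_nonneg by (auto simp: lipschitz_on_def dist_real_def)
  then show "continuous_on UNIV (hbar h \<nu>)" by (rule lipschitz_on_continuous_on)
qed

lemma hbar_measurable [measurable]: "f \<in> borel_measurable M \<Longrightarrow> (\<lambda>x. hbar h \<nu> (f x)) \<in> borel_measurable M"
  using measurable_compose hbar_measurable_borel by blast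

lemma psi_measurable [measurable]: 
  assumes [measurable]: "f \<in> borel_measurable M" shows "(\<lambda>x. psi h \<nu> (f x)) \<in> borel_measurable M"
  unfolding psi_def by measurable

lemma hdeg_measurable [measurable]:
  assumes [measurable]: "f \<in> borel_measurable M" "g \<in> borel_measurable M"
  shows "(\<lambda>x. hdeg h \<nu> (f x) (g x)) \<in> borel_measurable M"
  unfolding hdeg_def by measurable

lemma int_hbar: "integrable \<nu> (hbar h \<nu>)"
proof (rule integral_abs_le(1)[where K=Lh and c="\<bar>hbar h \<nu> 0\<bar>"])
  fix y
  show "\<bar>hbar h \<nu> y\<bar> \<le> \<bar>hbar h \<nu> 0\<bar> + Lh * \<bar>y\<bar>" using hbar_lip[of y 0] by simp
qed (simp_all add: hbar_measurable_borel Lh_nonneg)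

lemma psi_mean: "(\<integral>w. psi h \<nu> w \<partial>\<nu>) = 0"
  using int_hbar by (simp add: psi_def hmean_def nu.prob_space)

text \<open>\<open>psi\<close> is an average of differences of \<open>hbar\<close>, so constants
  drop out. The bound uses the law only through its second moment and is thus uniform over the laws
  of all block lengths.\<close>

lemma abs_psi_le: "\<bar>psi h \<nu> w\<bar> \<le> Lh * (\<bar>w\<bar> + m)"
proof -
  have "psi h \<nu> w = (\<integral>w'. hbar h \<nu> w - hbar h \<nu> w' \<partial>\<nu>)"
    using int_hbar by (simp add: psi_def hmean_def nu.prob_space)
  also have "\<bar>\<dots>\<bar> \<le> Lh * \<bar>w\<bar> + Lh * m"
  proof (rule integral_abs_le(2))
    fix y
    have "\<bar>hbar h \<nu> w - hbar h \<nu> y\<bar> \<le> Lh * \<bar>w - y\<bar>" by (rule hbar_lip)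
    also have "\<dots> \<le> Lh * (\<bar>w\<bar> + \<bar>y\<bar>)" by (intro mult_left_mono Lh_nonneg) simp
    finally show "\<bar>hbar h \<nu> w - hbar h \<nu> y\<bar> \<le> Lh * \<bar>w\<bar> + Lh * \<bar>y\<bar>" by (simp add: algebra_simps)
  qed (simp_all add: hbar_measurable_borel Lh_nonneg)
  finally show ?thesis by (simp add: algebra_simps)
qed

lemma hdeg_int: "(\<integral>y. hdeg h \<nu> w y \<partial>\<nu>) = 0"
  unfolding hdeg_def using int_h[of w] int_hbar
  by (simp add: hbar_def[of h \<nu> w] hmean_def[symmetric] nu.prob_space)

lemma hdeg_sym: "hdeg h \<nu> w y = hdeg h \<nu> y w"
  by (simp add: hdeg_def h_sym[of w y])

text \<open>The bound is free of \<open>w\<close>: the first two terms form h (w, y) minus its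
  average over the second argument, and the other two are - psi at \<open>y\<close>.\<close>

lemma abs_hdeg_le: "\<bar>hdeg h \<nu> w y\<bar> \<le> 2 * Lh * (\<bar>y\<bar> + m)"
proof -
  have "h (w, y) - hbar h \<nu> w = (\<integral>y'. h (w, y) - h (w, y') \<partial>\<nu>)"
    using int_h by (simp add: hbar_def nu.prob_space)
  also have "\<bar>\<dots>\<bar> \<le> Lh * \<bar>y\<bar> + Lh * m"
  proof (rule integral_abs_le(2))
    fix y'
    have "\<bar>h (w, y) - h (w, y')\<bar> \<le> Lh * (\<bar>w - w\<bar> + \<bar>y - y'\<bar>)" by (rule h_lip)
    also have "\<dots> \<le> Lh * (\<bar>y\<bar> + \<bar>y'\<bar>)" by (intro mult_left_mono Lh_nonneg) simp
    finally show "\<bar>h (w, y) - h (w, y')\<bar> \<le> Lh * \<bar>y\<bar> + Lh * \<bar>y'\<bar>" by (simp add: algebra_simps)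
  qed (simp_all add: Lh_nonneg)
  finally have 1: "\<bar>h (w, y) - hbar h \<nu> w\<bar> \<le> Lh * (\<bar>y\<bar> + m)" by (simp add: algebra_simps)
  have "hdeg h \<nu> w y = (h (w, y) - hbar h \<nu> w) - psi h \<nu> y" by (simp add: hdeg_def psi_def)
  then show ?thesis using 1 abs_psi_le[of y] by (simp add: mult.assoc)
qed

end

text \<open>The index \<open>k\<close> occurs once among the four arguments. Integrating that
  coordinate first gives 0 by degeneracy, with the remaining coordinates held fixed under the
  product law.\<close>

lemma (in lip_law) hdeg_orthogonal:
  fixes T :: "'i \<Rightarrow> 'w \<Rightarrow> real"
  assumes "prob_space M" and I: "finite I" and ind: "prob_space.indep_vars M (\<lambda>_. borel) T I"
    and law: "\<And>i. i \<in> I \<Longrightarrow> distr M borel (T i) = \<nu>"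
    and mem: "j \<in> I" "k \<in> I" "j' \<in> I" "k' \<in> I" and k: "k \<noteq> j" "k \<noteq> j'" "k \<noteq> k'"
    and int: "integrable M (\<lambda>x. hdeg h \<nu> (T j x) (T k x) * hdeg h \<nu> (T j' x) (T k' x))"
  shows "(\<integral>x. hdeg h \<nu> (T j x) (T k x) * hdeg h \<nu> (T j' x) (T k' x) \<partial>M) = 0"
proof -
  interpret M: prob_space M by fact
  define f where "f z = hdeg h \<nu> (z j) (z k) * hdeg h \<nu> (z j') (z k')" for z :: "'i \<Rightarrow> real"
  have [measurable]: "(\<lambda>z. z i) \<in> borel_measurable (PiM I (\<lambda>_. borel))" if "i \<in> I" for i
    using that by (rule measurable_component_singleton)
  have T: "T i \<in> borel_measurable M" if "i \<in> I" for i
    using ind that by (auto simp: M.indep_vars_def)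
  have f_meas: "f \<in> borel_measurable (PiM I (\<lambda>_. borel))"
    unfolding f_def[abs_def] using mem by measurable
  have T_meas: "(\<lambda>x. \<lambda>i\<in>I. T i x) \<in> measurable M (PiM I (\<lambda>_. borel))"
    by (rule measurable_restrict) (rule T)
  have "distr M (PiM I (\<lambda>_. borel)) (\<lambda>x. \<lambda>i\<in>I. T i x) = PiM I (\<lambda>i. distr M borel (T i))"
    using M.indep_vars_iff_distr_eq_PiM'[of I T "\<lambda>_. borel"] ind T mem(1) by auto
  also have "\<dots> = PiM I (\<lambda>_. \<nu>)" by (rule PiM_cong) (simp_all add: law)
  finally have D: "distr M (PiM I (\<lambda>_. borel)) (\<lambda>x. \<lambda>i\<in>I. T i x) = PiM I (\<lambda>_. \<nu>)" .
  have fT: "f (\<lambda>i\<in>I. T i x) = hdeg h \<nu> (T j x) (T k x) * hdeg h \<nu> (T j' x) (T k' x)" for x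
    using mem by (simp add: f_def)
  have "integrable (PiM I (\<lambda>_. \<nu>)) f"
    unfolding D[symmetric] using integrable_distr_eq[OF T_meas f_meas] int by (simp add: fT)
  moreover have I': "I = insert k (I - {k})" using mem by auto
  ultimately have int': "integrable (PiM (insert k (I - {k})) (\<lambda>_. \<nu>)) f" by simp
  interpret product_sigma_finite "\<lambda>_::'i. \<nu>"
    by unfold_locales
  have "(\<integral>x. hdeg h \<nu> (T j x) (T k x) * hdeg h \<nu> (T j' x) (T k' x) \<partial>M) = (\<integral>z. f z \<partial>PiM I (\<lambda>_. \<nu>))"
    unfolding D[symmetric] integral_distr[OF T_meas f_meas] fT ..
  also have "\<dots> = (\<integral>z. f z \<partial>PiM (insert k (I - {k})) (\<lambda>_. \<nu>))" using I' by simp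
  also have "\<dots> = (\<integral>z. (\<integral>y. f (z(k := y)) \<partial>\<nu>) \<partial>PiM (I - {k}) (\<lambda>_. \<nu>))"
    by (rule product_integral_insert[OF _ _ int']) (use I in auto)
  also have "(\<lambda>z. \<integral>y. f (z(k := y)) \<partial>\<nu>) = (\<lambda>z. 0)"
    using k by (simp add: f_def hdeg_int)
  finally show ?thesis by simp
qed

text \<open>For each ordered pair at most two products survive, with the pair itself and with its
  transpose. The second moment thus grows like the number of pairs and not like its square, which
  makes the degenerate part negligible.\<close>

lemma (in lip_law) degenerate_second_moment:
  assumes "prob_space M" and ind: "prob_space.indep_vars M (\<lambda>_. borel) T {1..b::nat}"
    and law: "\<And>i. i \<in> {1..b} \<Longrightarrow> distr M borel (T i) = \<nu>"
  defines "S \<equiv> {(j, k). j \<in> {1..b} \<and> k \<in> {1..b} \<and> j \<noteq> k}"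
  shows "(\<And>j k. (j, k) \<in> S \<Longrightarrow> L2 M (\<lambda>x. hdeg h \<nu> (T j x) (T k x)))"
    and "(\<integral>x. (\<Sum>(j, k)\<in>S. hdeg h \<nu> (T j x) (T k x))\<^sup>2 \<partial>M) \<le> 2 * real (card S) * (4 * Lh * m)\<^sup>2"
proof -
  interpret M: prob_space M by fact
  have T [measurable]: "T i \<in> borel_measurable M" if "i \<in> {1..b}" for i
    using ind that by (auto simp: M.indep_vars_def)
  have id: "(\<lambda>x. x) \<in> borel_measurable (borel :: real measure)" by simp
  have T2: "L2 M (T i)" "nrm M (T i) = m" if "i \<in> {1..b}" for i
    using L2_distr[OF T[OF that] id] nrm_distr[OF T[OF that] id] L2_nu law[OF that] by (simp_all add: m_def)
  have L2: "L2 M (\<lambda>x. hdeg h \<nu> (T j x) (T k x)) \<and> nrm M (\<lambda>x. hdeg h \<nu> (T j x) (T k x)) \<le> 4 * Lh * m"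
    if "j \<in> {1..b}" "k \<in> {1..b}" for j k
  proof -
    have B: "L2 M (\<lambda>x. 2 * Lh * (\<bar>T k x\<bar> + m))"
      by (intro L2_cmult L2_add L2_abs M.L2_const T2 that)
    have ae: "AE x in M. \<bar>hdeg h \<nu> (T j x) (T k x)\<bar> \<le> \<bar>2 * Lh * (\<bar>T k x\<bar> + m)\<bar>"
      by (intro AE_I2 order_trans[OF abs_hdeg_le abs_ge_self])
    have me: "(\<lambda>x. hdeg h \<nu> (T j x) (T k x)) \<in> borel_measurable M"
      using that by (intro hdeg_measurable T)
    have "nrm M (\<lambda>x. \<bar>T k x\<bar> + m) \<le> nrm M (\<lambda>x. \<bar>T k x\<bar>) + nrm M (\<lambda>x. m)"
      by (intro nrm_triangle L2_abs M.L2_const T2 that)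
    then have "nrm M (\<lambda>x. \<bar>T k x\<bar> + m) \<le> 2 * m"
      using T2(2)[OF that(2)] m_nonneg by (simp add: nrm_abs M.nrm_const)
    then have "nrm M (\<lambda>x. 2 * Lh * (\<bar>T k x\<bar> + m)) \<le> 2 * Lh * (2 * m)"
      unfolding nrm_cmult using Lh_nonneg by (intro mult_mono) auto
    then show ?thesis using L2_bound[OF B me ae] by auto
  qed
  show "L2 M (\<lambda>x. hdeg h \<nu> (T j x) (T k x))" if "(j, k) \<in> S" for j k
    using L2[of j k] that by (auto simp: S_def)
  define H where "H p x = hdeg h \<nu> (T (fst p) x) (T (snd p) x)" for p x
  have H: "L2 M (H p)" "nrm M (H p) \<le> 4 * Lh * m" if "p \<in> S" for p
    using L2[of "fst p" "snd p"] that by (auto simp: S_def H_def[abs_def])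
  have fin: "finite S" unfolding S_def by (rule finite_subset[of _ "{1..b} \<times> {1..b}"]) auto
  have Hint: "integrable M (\<lambda>x. H p x * H q x)" if "p \<in> S" "q \<in> S" for p q
    by (intro L2_mult_integrable H that)
  \<comment> \<open>Unless \<open>q\<close> is \<open>p\<close> or its transpose, one of the two
    indices of \<open>p\<close> is missing in \<open>q\<close>. If it is the first one, symmetry of
    \<open>hdeg\<close> moves it to the second place.\<close>
  have zero: "(\<integral>x. H p x * H q x \<partial>M) = 0" if pqS: "p \<in> S" "q \<in> S" and nswap: "q \<notin> {p, prod.swap p}" for p q
  proof -
    obtain j k j' k' where pq: "p = (j, k)" "q = (j', k')" by (metis surj_pair)
    have jk: "j \<in> {1..b}" "k \<in> {1..b}" "j' \<in> {1..b}" "k' \<in> {1..b}" "j \<noteq> k" "j' \<noteq> k'"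
      using pqS by (auto simp: S_def pq)
    consider "k \<noteq> j'" "k \<noteq> k'" | "j \<noteq> j'" "j \<noteq> k'"
      using nswap jk by (auto simp: pq)
    then show ?thesis
    proof cases
      case 1
      then show ?thesis
        using hdeg_orthogonal[OF assms(1) _ ind law, of j k j' k'] jk Hint[OF pqS] by (simp add: H_def pq)
    next
      case 2
      have "(\<lambda>x. H p x * H q x) = (\<lambda>x. hdeg h \<nu> (T k x) (T j x) * hdeg h \<nu> (T j' x) (T k' x))"
        by (simp add: H_def pq hdeg_sym[of "T j _"])
      then show ?thesis
        using hdeg_orthogonal[OF assms(1) _ ind law, of k j j' k'] jk Hint[OF pqS] 2 by simp
    qed
  qed
  have "(\<integral>x. (\<Sum>(j, k)\<in>S. hdeg h \<nu> (T j x) (T k x))\<^sup>2 \<partial>M) = (\<integral>x. (\<Sum>p\<in>S. \<Sum>q\<in>S. H p x * H q x) \<partial>M)"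
    by (simp add: H_def power2_eq_square sum_product case_prod_beta)
  also have "\<dots> = (\<Sum>p\<in>S. \<Sum>q\<in>S. \<integral>x. H p x * H q x \<partial>M)"
    using Hint by simp
  also have "\<dots> \<le> (\<Sum>p\<in>S. 2 * (4 * Lh * m)\<^sup>2)"
  proof (rule sum_mono)
    fix p assume p: "p \<in> S"
    have "(\<Sum>q\<in>S. \<integral>x. H p x * H q x \<partial>M) = (\<Sum>q\<in>S \<inter> {p, prod.swap p}. \<integral>x. H p x * H q x \<partial>M)"
      using fin zero[OF p] by (intro sum.mono_neutral_right) auto
    also have "\<dots> \<le> of_nat (card (S \<inter> {p, prod.swap p})) * (4 * Lh * m)\<^sup>2"
    proof (rule sum_bounded_above)
      fix q assume q: "q \<in> S \<inter> {p, prod.swap p}"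
      have "(\<integral>x. H p x * H q x \<partial>M) \<le> nrm M (H p) * nrm M (H q)"
        using cauchy_schwarz_integral[OF H(1) H(1), of p q] p q by auto
      also have "\<dots> \<le> (4 * Lh * m) * (4 * Lh * m)"
        using H(2)[OF p] H(2)[of q] q Lh_nonneg m_nonneg by (intro mult_mono) simp_all
      finally show "(\<integral>x. H p x * H q x \<partial>M) \<le> (4 * Lh * m)\<^sup>2" by (simp add: power2_eq_square)
    qed
    also have "\<dots> \<le> 2 * (4 * Lh * m)\<^sup>2"
    proof (rule mult_right_mono)
      have "card (S \<inter> {p, prod.swap p}) \<le> card {p, prod.swap p}" by (rule card_mono) auto
      also have "\<dots> \<le> 2" by (simp add: card_insert_if)
      finally show "real (card (S \<inter> {p, prod.swap p})) \<le> 2" by simp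
    qed simp
    finally show "(\<Sum>q\<in>S. \<integral>x. H p x * H q x \<partial>M) \<le> 2 * (4 * Lh * m)\<^sup>2" .
  qed
  finally show "(\<integral>x. (\<Sum>(j, k)\<in>S. hdeg h \<nu> (T j x) (T k x))\<^sup>2 \<partial>M) \<le> 2 * real (card S) * (4 * Lh * m)\<^sup>2"
    by simp
qed

section \<open>Sums over off-diagonal index pairs, and tools for passing to the limit law\<close>

lemma card_off_diag: "card {(j, k). j \<in> {1..b::nat} \<and> k \<in> {1..b} \<and> j \<noteq> k} = b * (b - 1)"
proof -
  have "{(j, k). j \<in> {1..b} \<and> k \<in> {1..b} \<and> j \<noteq> k} = Sigma {1..b} (\<lambda>j. {1..b} - {j})" by auto
  then show ?thesis by (simp add: card_SigmaI)
qed

lemma sum_off_diag_fst: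
  fixes p :: "nat \<Rightarrow> real"
  shows "(\<Sum>(j, k)\<in>{(j, k). j \<in> {1..b} \<and> k \<in> {1..b} \<and> j \<noteq> k}. p j) = real (b - 1) * (\<Sum>j\<in>{1..b}. p j)"
proof -
  have "{(j, k). j \<in> {1..b} \<and> k \<in> {1..b} \<and> j \<noteq> k} = Sigma {1..b} (\<lambda>j. {1..b} - {j})" by auto
  then have "(\<Sum>(j, k)\<in>{(j, k). j \<in> {1..b} \<and> k \<in> {1..b} \<and> j \<noteq> k}. p j) = (\<Sum>j\<in>{1..b}. \<Sum>k\<in>{1..b} - {j}. p j)"
    by (simp only:) (rule sum.Sigma[symmetric], auto)
  also have "\<dots> = (\<Sum>j\<in>{1..b}. real (b - 1) * p j)" by (intro sum.cong refl) simp
  also have "\<dots> = real (b - 1) * (\<Sum>j\<in>{1..b}. p j)" by (simp only: sum_distrib_left)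
  finally show ?thesis .
qed

lemma sum_off_diag_snd:
  fixes p :: "nat \<Rightarrow> real"
  shows "(\<Sum>(j, k)\<in>{(j, k). j \<in> {1..b} \<and> k \<in> {1..b} \<and> j \<noteq> k}. p k) = real (b - 1) * (\<Sum>j\<in>{1..b}. p j)"
  unfolding sum_off_diag_fst[symmetric]
  by (rule sum.reindex_bij_witness[of _ prod.swap prod.swap]) auto

text \<open>A form of Vitali's theorem. The clipped variables converge by dominated convergence;
  what clipping removes is at most the excess, which is small eventually by \<open>ui2\<close> and
  small for the limit by \<open>excess_small\<close>.\<close>

lemma L2_limit_ui2:
  assumes "prob_space M" and L2: "\<And>n. L2 M (Y n)" "L2 M Y'"
    and lim: "\<And>x. x \<in> space M \<Longrightarrow> (\<lambda>n. Y n x) \<longlonglongrightarrow> Y' x" and ui: "ui2 M Y"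
  shows "(\<lambda>n. nrm M (\<lambda>x. Y n x - Y' x)) \<longlonglongrightarrow> 0"
proof (rule LIMSEQ_I)
  interpret prob_space M by fact
  have [measurable]: "Y n \<in> borel_measurable M" "Y' \<in> borel_measurable M" for n
    using L2 by (auto dest: L2_measurable)
  fix e :: real assume e: "e > 0"
  obtain C1 where C1: "C1 > 0" "\<forall>\<^sub>F n in sequentially. nrm M (\<lambda>x. excess C1 (Y n x)) \<le> e / 4"
    using ui e unfolding ui2_def by (meson zero_less_divide_iff zero_less_numeral)
  obtain C2 where C2: "C2 > 0" "nrm M (\<lambda>x. excess C2 (Y' x)) \<le> e / 4"
    using excess_small[OF L2(2), of "e / 4"] e by auto
  define C where "C = max C1 C2"
  have C: "C > 0" using C1 by (simp add: C_def)
  have mono: "nrm M (\<lambda>x. excess C (f x)) \<le> nrm M (\<lambda>x. excess c (f x))" if "L2 M f" "c \<le> C" "c \<ge> 0" for f c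
  proof (rule nrm_excess_mono)
    show "L2 M (\<lambda>x. excess c (f x))" using that by (intro L2_excess)
  qed (use that in \<open>auto intro: L2_measurable simp: excess_def\<close>)
  define \<phi> where "\<phi> z = max (- C) (min C z)" for z
  have [measurable]: "\<phi> \<in> borel_measurable borel" unfolding \<phi>_def by measurable
  have \<phi>bd: "\<bar>\<phi> z\<bar> \<le> C" for z using C by (auto simp: \<phi>_def)
  have "(\<lambda>n. \<integral>x. (\<phi> (Y n x) - \<phi> (Y' x))\<^sup>2 \<partial>M) \<longlonglongrightarrow> (\<integral>x. 0 \<partial>M)"
  proof (rule integral_dominated_convergence[where w="\<lambda>x. (2 * C)\<^sup>2"])
    show "AE x in M. (\<lambda>n. (\<phi> (Y n x) - \<phi> (Y' x))\<^sup>2) \<longlonglongrightarrow> 0"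
    proof (rule AE_I2)
      fix x assume "x \<in> space M"
      then have "(\<lambda>n. (\<phi> (Y n x) - \<phi> (Y' x))\<^sup>2) \<longlonglongrightarrow> (\<phi> (Y' x) - \<phi> (Y' x))\<^sup>2"
        unfolding \<phi>_def by (intro tendsto_intros lim)
      then show "(\<lambda>n. (\<phi> (Y n x) - \<phi> (Y' x))\<^sup>2) \<longlonglongrightarrow> 0" by simp
    qed
    show "AE x in M. norm ((\<phi> (Y n x) - \<phi> (Y' x))\<^sup>2) \<le> (2 * C)\<^sup>2" for n
    proof (rule AE_I2)
      fix x
      have "\<bar>\<phi> (Y n x) - \<phi> (Y' x)\<bar> \<le> 2 * C" using \<phi>bd[of "Y n x"] \<phi>bd[of "Y' x"] by linarith
      from power_mono[OF this, of 2] show "norm ((\<phi> (Y n x) - \<phi> (Y' x))\<^sup>2) \<le> (2 * C)\<^sup>2" by simp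
    qed
  qed simp_all
  then have "(\<lambda>n. nrm M (\<lambda>x. \<phi> (Y n x) - \<phi> (Y' x))) \<longlonglongrightarrow> 0"
    unfolding nrm_def using tendsto_real_sqrt by fastforce
  from order_tendstoD(2)[OF this, of "e / 4"] e
  have "\<forall>\<^sub>F n in sequentially. nrm M (\<lambda>x. \<phi> (Y n x) - \<phi> (Y' x)) < e / 4" by simp
  with C1(2) have "\<forall>\<^sub>F n in sequentially. norm (nrm M (\<lambda>x. Y n x - Y' x) - 0) < e"
  proof eventually_elim
    case (elim n)
    have p2: "L2 M (\<lambda>x. \<phi> (f x))" if "f \<in> borel_measurable M" for f
      by (rule L2_bounded[of _ C]) (use \<phi>bd that in auto)
    have R: "L2 M (\<lambda>x. \<bar>\<phi> (Y n x) - \<phi> (Y' x)\<bar> + (excess C (Y n x) + excess C (Y' x)))"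
      using C by (intro L2_add L2_abs L2_diff p2 L2_excess L2) auto
    have "nrm M (\<lambda>x. Y n x - Y' x) \<le> nrm M (\<lambda>x. \<bar>\<phi> (Y n x) - \<phi> (Y' x)\<bar> + (excess C (Y n x) + excess C (Y' x)))"
    proof (rule L2_bound(2)[OF R])
      show "AE x in M. \<bar>Y n x - Y' x\<bar> \<le> \<bar>\<bar>\<phi> (Y n x) - \<phi> (Y' x)\<bar> + (excess C (Y n x) + excess C (Y' x))\<bar>"
      proof (rule AE_I2)
        fix x
        have "\<bar>z - \<phi> z\<bar> \<le> excess C z" for z using C by (auto simp: \<phi>_def excess_def)
        from this[of "Y n x"] this[of "Y' x"]
        show "\<bar>Y n x - Y' x\<bar> \<le> \<bar>\<bar>\<phi> (Y n x) - \<phi> (Y' x)\<bar> + (excess C (Y n x) + excess C (Y' x))\<bar>" by linarith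
      qed
    qed simp
    also have "\<dots> \<le> nrm M (\<lambda>x. \<bar>\<phi> (Y n x) - \<phi> (Y' x)\<bar>) + nrm M (\<lambda>x. excess C (Y n x) + excess C (Y' x))"
      using C by (intro nrm_triangle L2_add L2_abs L2_diff p2 L2_excess L2) auto
    also have "nrm M (\<lambda>x. \<bar>\<phi> (Y n x) - \<phi> (Y' x)\<bar>) = nrm M (\<lambda>x. \<phi> (Y n x) - \<phi> (Y' x))" by (rule nrm_abs)
    also have "nrm M (\<lambda>x. excess C (Y n x) + excess C (Y' x)) \<le> nrm M (\<lambda>x. excess C (Y n x)) + nrm M (\<lambda>x. excess C (Y' x))"
      using C by (intro nrm_triangle L2_excess L2) auto
    also have "nrm M (\<lambda>x. excess C (Y n x)) \<le> e / 4"
      using mono[OF L2(1)[of n], of C1] C1(1) elim(1) by (simp add: C_def)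
    also have "nrm M (\<lambda>x. excess C (Y' x)) \<le> e / 4"
      using mono[OF L2(2), of C2] C2 by (simp add: C_def)
    finally have "nrm M (\<lambda>x. Y n x - Y' x) < e" using elim(2) e by linarith
    then show ?case by simp
  qed
  then show "\<exists>no. \<forall>n\<ge>no. norm (nrm M (\<lambda>x. Y n x - Y' x) - 0) < e"
    by (simp add: eventually_sequentially)
qed

context lip_kernel
begin

lemma lip_law_distr:
  assumes "prob_space M" "L2 M V"
  shows "lip_law h Lh (distr M borel V)"
proof -
  interpret prob_space M by fact
  have [measurable]: "V \<in> borel_measurable M" using assms(2) by (rule L2_measurable)
  show ?thesis
  proof (intro lip_law.intro lip_law_axioms.intro)
    show "prob_space (distr M borel V)" by (rule prob_space_distr) simp
    show "L2 (distr M borel V) (\<lambda>x. x)" using assms(2) by (subst L2_distr) auto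
  qed (unfold_locales, simp)
qed

lemma hbar_distr:
  assumes "V \<in> borel_measurable M"
  shows "hbar h (distr M borel V) w = (\<integral>x. h (w, V x) \<partial>M)"
  unfolding hbar_def by (intro integral_distr assms h_measurable) auto

text \<open>The integrand changes with the law, so weak convergence alone does not apply. Skorohod's
  theorem realises the laws by convergent variables on one space, uniform integrability makes them
  converge in L2, and the Lipschitz property carries this to \<open>hbar\<close>,
  \<open>hmean\<close> and \<open>psi\<close>. The hypothesis \<open>ui\<close> ranges over all
  carriers because the space appears only inside the proof.\<close>

lemma psi_second_moment_limit:
  fixes \<nu> :: "nat \<Rightarrow> real measure" and \<nu>' :: "real measure"
  assumes conv: "weak_conv_m \<nu> \<nu>'"
    and law: "\<And>l. lip_law h Lh (\<nu> l)" "lip_law h Lh \<nu>'"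
    and ui: "\<And>(\<Omega> :: real measure) Y. (\<And>l. Y l \<in> borel_measurable \<Omega>) \<Longrightarrow> (\<And>l. distr \<Omega> borel (Y l) = \<nu> l) \<Longrightarrow> ui2 \<Omega> Y"
  shows "(\<lambda>l. \<integral>w. (psi h (\<nu> l) w)\<^sup>2 \<partial>\<nu> l) \<longlonglongrightarrow> (\<integral>w. (psi h \<nu>' w)\<^sup>2 \<partial>\<nu>')"
proof -
  have rd: "real_distribution \<nu>''" if "lip_law h Lh \<nu>''" for \<nu>''
  proof -
    interpret lip_law h Lh \<nu>'' by fact
    show ?thesis
      using sets_eq_imp_space_eq[OF sets_nu]
      by (intro real_distribution.intro real_distribution_axioms.intro prob_nu) (simp_all add: sets_nu)
  qed
  obtain \<Omega> :: "real measure" and Y Y' where Sk: "prob_space \<Omega> \<and> (\<forall>l. Y l \<in> borel_measurable \<Omega>) \<and>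
      (\<forall>l. distr \<Omega> borel (Y l) = \<nu> l) \<and> Y' \<in> measurable \<Omega> lborel \<and> distr \<Omega> borel Y' = \<nu>' \<and>
      (\<forall>x\<in>space \<Omega>. (\<lambda>l. Y l x) \<longlonglongrightarrow> Y' x)"
    using Skorohod[OF rd[OF law(1)] rd[OF law(2)] conv] by (elim exE)
  have \<Omega>: "prob_space \<Omega>"
    and Y: "\<And>l. Y l \<in> borel_measurable \<Omega>" "\<And>l. distr \<Omega> borel (Y l) = \<nu> l"
    and Y': "Y' \<in> measurable \<Omega> lborel" "distr \<Omega> borel Y' = \<nu>'"
    and lim: "\<And>x. x \<in> space \<Omega> \<Longrightarrow> (\<lambda>l. Y l x) \<longlonglongrightarrow> Y' x"
    using Sk[THEN conjunct1] Sk[THEN conjunct2, THEN conjunct1, THEN spec]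
      Sk[THEN conjunct2, THEN conjunct2, THEN conjunct1, THEN spec]
      Sk[THEN conjunct2, THEN conjunct2, THEN conjunct2, THEN conjunct1]
      Sk[THEN conjunct2, THEN conjunct2, THEN conjunct2, THEN conjunct2, THEN conjunct1]
      Sk[THEN conjunct2, THEN conjunct2, THEN conjunct2, THEN conjunct2, THEN conjunct2, THEN bspec]
    by - assumption+
  interpret \<Omega>: prob_space \<Omega> by fact
  have [measurable]: "Y l \<in> borel_measurable \<Omega>" "Y' \<in> borel_measurable \<Omega>" for l
    using Y(1) Y'(1) by auto
  have L2: "L2 \<Omega> (Y l)" "L2 \<Omega> Y'" for l
  proof -
    have *: "L2 \<Omega> Z" if "Z \<in> borel_measurable \<Omega>" "lip_law h Lh (distr \<Omega> borel Z)" for Z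
      by (rule L2_distr[THEN iffD1, OF that(1) _ lip_law.L2_nu[OF that(2)]]) simp
    show "L2 \<Omega> (Y l)" by (rule *) (simp_all only: Y law)
    show "L2 \<Omega> Y'" by (rule *) (use Y'(1) in simp, simp only: Y' law)
  qed
  define \<delta> where "\<delta> l = nrm \<Omega> (\<lambda>x. Y l x - Y' x)" for l
  have \<delta>0: "\<delta> \<longlonglongrightarrow> 0"
    unfolding \<delta>_def by (intro L2_limit_ui2 \<Omega> L2 lim ui Y)
  have \<delta>nn: "\<delta> l \<ge> 0" for l by (simp add: \<delta>_def)
  have L1: "(\<integral>x. \<bar>Y l x - Y' x\<bar> \<partial>\<Omega>) \<le> \<delta> l" "integrable \<Omega> (\<lambda>x. \<bar>Y l x - Y' x\<bar>)" for l
    unfolding \<delta>_def by (intro \<Omega>.integral_abs_le_nrm L2_diff L2) (intro integrable_abs \<Omega>.L2_integrable L2_diff L2)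
  have int_h: "integrable \<Omega> (\<lambda>x. h (w, Y l x))" "integrable \<Omega> (\<lambda>x. h (w, Y' x))" for w l
    by (intro \<Omega>.L2_integrable L2_h \<Omega> \<Omega>.L2_const L2)+
  \<comment> \<open>The first term pays for the change of the argument, the second for the change of
    the law.\<close>
  have hb: "\<bar>hbar h (\<nu> l) w - hbar h \<nu>' w'\<bar> \<le> Lh * \<bar>w - w'\<bar> + Lh * \<delta> l" for l w w'
  proof -
    have "hbar h (\<nu> l) w - hbar h \<nu>' w' = (\<integral>x. h (w, Y l x) - h (w', Y' x) \<partial>\<Omega>)"
      using int_h hbar_distr[of "Y l" \<Omega>] hbar_distr[of Y' \<Omega>] by (simp add: Y(2) Y'(2))
    also have "\<bar>\<dots>\<bar> \<le> (\<integral>x. \<bar>h (w, Y l x) - h (w', Y' x)\<bar> \<partial>\<Omega>)" by (rule integral_abs_bound)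
    also have "\<dots> \<le> (\<integral>x. Lh * \<bar>w - w'\<bar> + Lh * \<bar>Y l x - Y' x\<bar> \<partial>\<Omega>)"
      proof (intro integral_mono)
      show "\<bar>h (w, Y l x) - h (w', Y' x)\<bar> \<le> Lh * \<bar>w - w'\<bar> + Lh * \<bar>Y l x - Y' x\<bar>" for x
        using h_lip[of w "Y l x" w' "Y' x"] by (simp add: distrib_left)
    qed (use int_h L1(2)[of l] in auto)
    also have "\<dots> = Lh * \<bar>w - w'\<bar> + Lh * (\<integral>x. \<bar>Y l x - Y' x\<bar> \<partial>\<Omega>)"
      using L1(2)[of l] by (simp add: \<Omega>.prob_space)
    also have "\<dots> \<le> Lh * \<bar>w - w'\<bar> + Lh * \<delta> l"
      by (intro add_left_mono mult_left_mono L1 Lh_nonneg)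
    finally show ?thesis .
  qed
  have int_hbar: "integrable \<Omega> (\<lambda>x. hbar h (\<nu> l) (Y l x))" "integrable \<Omega> (\<lambda>x. hbar h \<nu>' (Y' x))" for l
    using lip_law.int_hbar[OF law(1)[of l]] lip_law.int_hbar[OF law(2)]
      lip_law.hbar_measurable_borel[OF law(1)[of l]] lip_law.hbar_measurable_borel[OF law(2)]
      integrable_distr_eq[of "Y l" \<Omega> borel "hbar h (\<nu> l)"] integrable_distr_eq[of Y' \<Omega> borel "hbar h \<nu>'"]
    by (simp_all add: Y(2) Y'(2))
  have hm: "\<bar>hmean h (\<nu> l) - hmean h \<nu>'\<bar> \<le> 2 * Lh * \<delta> l" for l
  proof -
    have "hmean h (\<nu> l) = (\<integral>x. hbar h (\<nu> l) (Y l x) \<partial>\<Omega>)" "hmean h \<nu>' = (\<integral>x. hbar h \<nu>' (Y' x) \<partial>\<Omega>)"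
      unfolding hmean_def
      using integral_distr[of "Y l" \<Omega> borel "hbar h (\<nu> l)"] integral_distr[of Y' \<Omega> borel "hbar h \<nu>'"]
        lip_law.hbar_measurable_borel[OF law(1)[of l]] lip_law.hbar_measurable_borel[OF law(2)]
      by (simp_all add: Y(2) Y'(2))
    then have "hmean h (\<nu> l) - hmean h \<nu>' = (\<integral>x. hbar h (\<nu> l) (Y l x) - hbar h \<nu>' (Y' x) \<partial>\<Omega>)"
      using int_hbar by simp
    also have "\<bar>\<dots>\<bar> \<le> (\<integral>x. \<bar>hbar h (\<nu> l) (Y l x) - hbar h \<nu>' (Y' x)\<bar> \<partial>\<Omega>)" by (rule integral_abs_bound)
    also have "\<dots> \<le> (\<integral>x. Lh * \<bar>Y l x - Y' x\<bar> + Lh * \<delta> l \<partial>\<Omega>)"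
      using int_hbar L1(2)[of l] hb by (intro integral_mono) auto
    also have "\<dots> = Lh * (\<integral>x. \<bar>Y l x - Y' x\<bar> \<partial>\<Omega>) + Lh * \<delta> l"
      using L1(2)[of l] by (simp add: \<Omega>.prob_space)
    also have "\<dots> \<le> Lh * \<delta> l + Lh * \<delta> l"
      by (intro add_right_mono mult_left_mono L1 Lh_nonneg)
    finally show ?thesis by simp
  qed
  \<comment> \<open>The 3 collects one \<delta> from \<open>hb\<close> and two from
    \<open>hm\<close>.\<close>
  have psi: "\<bar>psi h (\<nu> l) (Y l x) - psi h \<nu>' (Y' x)\<bar> \<le> Lh * \<bar>Y l x - Y' x\<bar> + 3 * Lh * \<delta> l" for l x
    using hb[of l "Y l x" "Y' x"] hm[of l] unfolding psi_def by linarith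
  have psiY [measurable]: "(\<lambda>x. psi h (\<nu> l) (Y l x)) \<in> borel_measurable \<Omega>" "(\<lambda>x. psi h \<nu>' (Y' x)) \<in> borel_measurable \<Omega>" for l
    by (intro lip_law.psi_measurable[OF law(1)] lip_law.psi_measurable[OF law(2)]; simp)+
  have psi2: "L2 \<Omega> (\<lambda>x. psi h \<nu>'' (Z x))" if "lip_law h Lh \<nu>''" "L2 \<Omega> Z" for \<nu>'' Z
  proof (rule L2_bound(1))
    show "L2 \<Omega> (\<lambda>x. Lh * (\<bar>Z x\<bar> + lip_law.m \<nu>''))" by (intro L2_cmult L2_add L2_abs that \<Omega>.L2_const)
    show "(\<lambda>x. psi h \<nu>'' (Z x)) \<in> borel_measurable \<Omega>"
      by (intro lip_law.psi_measurable[OF that(1)] L2_measurable[OF that(2)])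
    show "AE x in \<Omega>. \<bar>psi h \<nu>'' (Z x)\<bar> \<le> \<bar>Lh * (\<bar>Z x\<bar> + lip_law.m \<nu>'')\<bar>"
      by (intro AE_I2 order_trans[OF lip_law.abs_psi_le[OF that(1)] abs_ge_self])
  qed
  note psiL2 = psi2[OF law(1) L2(1)] psi2[OF law(2) L2(2)]
  have nrm_psi: "nrm \<Omega> (\<lambda>x. psi h (\<nu> l) (Y l x) - psi h \<nu>' (Y' x)) \<le> 4 * Lh * \<delta> l" for l
  proof -
    have B: "L2 \<Omega> (\<lambda>x. Lh * \<bar>Y l x - Y' x\<bar> + 3 * Lh * \<delta> l)"
      by (intro L2_add L2_cmult L2_abs L2_diff L2 \<Omega>.L2_const)
    have "nrm \<Omega> (\<lambda>x. psi h (\<nu> l) (Y l x) - psi h \<nu>' (Y' x)) \<le> nrm \<Omega> (\<lambda>x. Lh * \<bar>Y l x - Y' x\<bar> + 3 * Lh * \<delta> l)"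
      by (rule L2_bound(2)[OF B]) (auto intro!: AE_I2 order_trans[OF psi abs_ge_self])
    also have "\<dots> \<le> nrm \<Omega> (\<lambda>x. Lh * \<bar>Y l x - Y' x\<bar>) + nrm \<Omega> (\<lambda>x. 3 * Lh * \<delta> l)"
      by (intro nrm_triangle L2_cmult L2_abs L2_diff L2 \<Omega>.L2_const)
    also have "\<dots> = 4 * Lh * \<delta> l"
      unfolding nrm_cmult nrm_abs \<Omega>.nrm_const using Lh_nonneg \<delta>nn[of l] by (simp add: \<delta>_def)
    finally show ?thesis .
  qed
  have lim_sq: "(\<lambda>l. \<integral>x. (psi h (\<nu> l) (Y l x))\<^sup>2 \<partial>\<Omega>) \<longlonglongrightarrow> (\<integral>x. (psi h \<nu>' (Y' x))\<^sup>2 \<partial>\<Omega>)"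
  proof (rule second_moment_limit[where g="\<lambda>l x. psi h \<nu>' (Y' x)"])
    show "(\<lambda>l. nrm \<Omega> (\<lambda>x. psi h (\<nu> l) (Y l x) - psi h \<nu>' (Y' x))) \<longlonglongrightarrow> 0"
    proof (rule Lim_null_comparison)
      show "\<forall>\<^sub>F l in sequentially. norm (nrm \<Omega> (\<lambda>x. psi h (\<nu> l) (Y l x) - psi h \<nu>' (Y' x))) \<le> 4 * Lh * \<delta> l"
        using nrm_psi by simp
      show "(\<lambda>l. 4 * Lh * \<delta> l) \<longlonglongrightarrow> 0" using tendsto_mult_left[OF \<delta>0, of "4 * Lh"] by simp
    qed
  qed (use psiL2 in auto)
  have eq: "(\<integral>w. (psi h \<nu>'' w)\<^sup>2 \<partial>\<nu>'') = (\<integral>x. (psi h \<nu>'' (Z x))\<^sup>2 \<partial>\<Omega>)"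
    if "lip_law h Lh \<nu>''" "Z \<in> borel_measurable \<Omega>" "distr \<Omega> borel Z = \<nu>''" for Z \<nu>''
  proof -
    have "(\<lambda>w. (psi h \<nu>'' w)\<^sup>2) \<in> borel_measurable borel"
      using lip_law.psi_measurable[OF that(1), of "\<lambda>x. x" borel] by simp
    from integral_distr[OF that(2) this] show ?thesis by (simp add: that(3))
  qed
  have "(\<integral>w. (psi h (\<nu> l) w)\<^sup>2 \<partial>\<nu> l) = (\<integral>x. (psi h (\<nu> l) (Y l x))\<^sup>2 \<partial>\<Omega>)" for l
    by (rule eq[OF law(1) Y])
  moreover have "(\<integral>w. (psi h \<nu>' w)\<^sup>2 \<partial>\<nu>') = (\<integral>x. (psi h \<nu>' (Y' x))\<^sup>2 \<partial>\<Omega>)"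
    by (rule eq[OF law(2) _ Y'(2)]) simp
  ultimately show ?thesis using lim_sq by simp
qed

end

text \<open>For b at least 2 the centred U-statistic times sqrt b is the row sum of 2 psi divided by
  sqrt b, plus a degenerate remainder of norm at most C / sqrt (b - 1).\<close>

lemma (in lip_kernel) ustat_clt:
  fixes V :: "nat \<Rightarrow> 'a \<Rightarrow> real" and T :: "nat \<Rightarrow> nat \<Rightarrow> 'a \<Rightarrow> real" and b l :: "nat \<Rightarrow> nat"
  assumes "prob_space M" and V2: "\<And>i. L2 M (V i)" and ui: "ui2 M V" and bd: "\<And>i. nrm M (V i) \<le> B"
    and conv: "weak_conv_m (\<lambda>i. distr M borel (V i)) (real_gauss \<sigma>)"
    and b: "filterlim b at_top sequentially" and l: "filterlim l at_top sequentially"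
    and ind: "\<And>n. prob_space.indep_vars M (\<lambda>_. borel) (T n) {1..b n}"
    and law: "\<And>n j. j \<in> {1..b n} \<Longrightarrow> distr M borel (T n j) = distr M borel (V (l n))"
  shows "(\<lambda>n. char (distr M borel (\<lambda>x. sqrt (real (b n)) *
        (off_diag_mean (b n) (\<lambda>j k. h (T n j x, T n k x)) - hmean h (distr M borel (V (l n)))))) t)
    \<longlonglongrightarrow> complex_of_real (exp (- (4 * (\<integral>w. (psi h (real_gauss \<sigma>) w)\<^sup>2 \<partial>real_gauss \<sigma>)) * t\<^sup>2 / 2))"
proof -
  interpret M: prob_space M by fact
  define \<nu> where "\<nu> i = distr M borel (V i)" for i
  define \<Gamma> where "\<Gamma> = (\<integral>w. (psi h (real_gauss \<sigma>) w)\<^sup>2 \<partial>real_gauss \<sigma>)"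
  have V_meas [measurable]: "V i \<in> borel_measurable M" for i using V2 by (rule L2_measurable)
  have lawV: "lip_law h Lh (\<nu> i)" for i
    unfolding \<nu>_def by (rule lip_law_distr[OF assms(1) V2])
  have lawG: "lip_law h Lh (real_gauss \<sigma>)"
    unfolding real_gauss_def
    by (rule lip_law_distr[OF real_distribution.axioms(1)[OF real_dist_normal_dist] L2_std_normal])
  have m: "lip_law.m (\<nu> i) = nrm M (V i)" for i
    unfolding lip_law.m_def[OF lawV] unfolding \<nu>_def by (rule nrm_distr) simp_all
  have B: "B \<ge> 0" using bd[of 0] nrm_nonneg order_trans by blast
  have psi_meas [measurable]: "psi h (\<nu> i) \<in> borel_measurable borel" for i
    by (rule lip_law.psi_measurable[OF lawV, of "\<lambda>x. x" borel]) simp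
  have lim: "(\<lambda>i. \<integral>w. (psi h (\<nu> i) w)\<^sup>2 \<partial>\<nu> i) \<longlonglongrightarrow> \<Gamma>"
    unfolding \<Gamma>_def
  proof (rule psi_second_moment_limit[OF _ lawV lawG])
    show "weak_conv_m \<nu> (real_gauss \<sigma>)" using conv by (simp add: \<nu>_def[abs_def])
    fix \<Omega> :: "real measure" and Y
    assume Y: "\<And>l. Y l \<in> borel_measurable \<Omega>" "\<And>l. distr \<Omega> borel (Y l) = \<nu> l"
    show "ui2 \<Omega> Y" by (rule ui2_distr[OF V_meas Y(1) _ ui]) (simp add: Y(2) \<nu>_def)
  qed
  define \<xi> where "\<xi> n x = psi h (\<nu> (l n)) (V (l n) x)" for n x
  have \<xi>_le: "\<bar>psi h (\<nu> i) (V i x)\<bar> \<le> Lh * (\<bar>V i x\<bar> + B)" for i x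
  proof -
    have "\<bar>psi h (\<nu> i) (V i x)\<bar> \<le> Lh * (\<bar>V i x\<bar> + lip_law.m (\<nu> i))" by (rule lip_law.abs_psi_le[OF lawV])
    also have "\<dots> \<le> Lh * (\<bar>V i x\<bar> + B)" unfolding m by (intro mult_left_mono add_left_mono bd Lh_nonneg)
    finally show ?thesis .
  qed
  have psi2: "L2 M (\<lambda>x. psi h (\<nu> i) (Z x))" if "L2 M Z" for i Z
  proof (rule L2_bound(1))
    show "L2 M (\<lambda>x. Lh * (\<bar>Z x\<bar> + lip_law.m (\<nu> i)))" by (intro L2_cmult L2_add L2_abs that M.L2_const)
    show "(\<lambda>x. psi h (\<nu> i) (Z x)) \<in> borel_measurable M"
      using L2_measurable[OF that] by simp
    show "AE x in M. \<bar>psi h (\<nu> i) (Z x)\<bar> \<le> \<bar>Lh * (\<bar>Z x\<bar> + lip_law.m (\<nu> i))\<bar>"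
      by (intro AE_I2 order_trans[OF lip_law.abs_psi_le[OF lawV] abs_ge_self])
  qed
  have \<xi>2: "L2 M (\<xi> n)" for n unfolding \<xi>_def[abs_def] by (rule psi2[OF V2])
  have mean: "M.expectation (\<xi> n) = 0" for n
  proof -
    have "(\<integral>w. psi h (\<nu> (l n)) w \<partial>distr M borel (V (l n))) = M.expectation (\<xi> n)"
      unfolding \<xi>_def[abs_def] by (rule integral_distr) simp_all
    then show ?thesis using lip_law.psi_mean[OF lawV[of "l n"]] by (simp add: \<nu>_def[symmetric])
  qed
  have var: "(\<lambda>n. M.expectation (\<lambda>x. (\<xi> n x)\<^sup>2)) \<longlonglongrightarrow> \<Gamma>"
  proof -
    have "(\<integral>w. (psi h (\<nu> (l n)) w)\<^sup>2 \<partial>\<nu> (l n)) = M.expectation (\<lambda>x. (\<xi> n x)\<^sup>2)" for n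
      using integral_distr[of "V (l n)" M borel "\<lambda>w. (psi h (\<nu> (l n)) w)\<^sup>2"]
      by (simp add: \<xi>_def \<nu>_def[symmetric])
    then show ?thesis using filterlim_compose[OF lim l] by simp
  qed
  have ui\<xi>: "ui2 M \<xi>"
  proof -
    have "ui2 M (\<lambda>i x. psi h (\<nu> i) (V i x))"
    proof (rule ui2_lipschitz[OF ui V2, where K="Lh + 1" and c="Lh * B"])
      fix i x
      show "\<bar>psi h (\<nu> i) (V i x)\<bar> \<le> (Lh + 1) * \<bar>V i x\<bar> + Lh * B"
        using \<xi>_le[of i x] by (simp add: algebra_simps)
    qed (use Lh_nonneg B in auto)
    from ui2_subseq[OF this l] show ?thesis by (simp add: \<xi>_def[abs_def])
  qed
  have T_meas [measurable]: "T n j \<in> borel_measurable M" if "j \<in> {1..b n}" for n j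
    using ind that by (auto simp: M.indep_vars_def)
  have T2: "L2 M (T n j)" if "j \<in> {1..b n}" for n j
    using L2_distr[OF T_meas[OF that], of "\<lambda>x. x"] L2_distr[OF V_meas, of "\<lambda>x. x" "l n"] V2[of "l n"] law[OF that]
    by simp
  define \<zeta> where "\<zeta> n j x = psi h (\<nu> (l n)) (T n j x)" for n j x
  \<comment> \<open>Each index occurs in both places of the kernel, which doubles the linear term.
    The factor is moved into the argument 2 t, and its square is the 4 in the limiting
    variance.\<close>
  have main: "(\<lambda>n. char (distr M borel (\<lambda>x. 1 / sqrt (real (b n)) * (\<Sum>j\<in>{1..b n}. \<zeta> n j x))) (2 * t))
      \<longlonglongrightarrow> complex_of_real (exp (- \<Gamma> * (2 * t)\<^sup>2 / 2))"
  proof (rule M.triangular_clt[OF \<xi>2 mean var ui\<xi> b])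
    fix n
    show "card {1..b n} = b n" by simp
    show "M.indep_vars (\<lambda>_. borel) (\<zeta> n) {1..b n}"
      unfolding \<zeta>_def[abs_def] by (rule M.indep_vars_compose2[OF ind]) simp
    fix j assume j: "j \<in> {1..b n}"
    have "distr M borel (\<zeta> n j) = distr (distr M borel (T n j)) borel (psi h (\<nu> (l n)))"
      using T_meas[OF j] by (subst distr_distr) (auto simp: comp_def \<zeta>_def[abs_def])
    also have "\<dots> = distr M borel (\<xi> n)"
      unfolding law[OF j] by (subst distr_distr) (auto simp: comp_def \<xi>_def[abs_def])
    finally show "distr M borel (\<zeta> n j) = distr M borel (\<xi> n)" .
  qed
  define g where "g n x = 2 * (1 / sqrt (real (b n)) * (\<Sum>j\<in>{1..b n}. \<zeta> n j x))" for n x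
  define f where "f n x = sqrt (real (b n)) * (off_diag_mean (b n) (\<lambda>j k. h (T n j x, T n k x)) - hmean h (\<nu> (l n)))" for n x
  have \<zeta>2: "L2 M (\<zeta> n j)" if "j \<in> {1..b n}" for n j
    unfolding \<zeta>_def[abs_def] by (intro psi2 T2 that)
  have g2: "L2 M (g n)" for n
    unfolding g_def[abs_def] by (intro L2_cmult L2_sum \<zeta>2)
  have f2: "L2 M (f n)" for n
    unfolding f_def[abs_def] off_diag_mean_def
    by (intro L2_cmult L2_diff M.L2_const L2_sum) (auto intro!: L2_h assms(1) T2)
  have g_char: "(\<lambda>n. char (distr M borel (g n)) t) \<longlonglongrightarrow> complex_of_real (exp (- (4 * \<Gamma>) * t\<^sup>2 / 2))"
  proof -
    have "char (distr M borel (g n)) t = char (distr M borel (\<lambda>x. 1 / sqrt (real (b n)) * (\<Sum>j\<in>{1..b n}. \<zeta> n j x))) (2 * t)" for n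
    proof -
      have "(\<lambda>x. 1 / sqrt (real (b n)) * (\<Sum>j\<in>{1..b n}. \<zeta> n j x)) \<in> borel_measurable M"
        by (intro L2_measurable L2_cmult L2_sum \<zeta>2)
      then show ?thesis unfolding g_def[abs_def] by (rule char_cmult)
    qed
    then show ?thesis using main by (simp add: power_mult_distrib)
  qed
  \<comment> \<open>The square root of the factor 2 in \<open>degenerate_second_moment\<close>,
    times the bound for the norm of a single degenerate term.\<close>
  define C where "C = sqrt 2 * (4 * Lh * B)"
  have fg: "(\<lambda>n. nrm M (\<lambda>x. f n x - g n x)) \<longlonglongrightarrow> 0"
  proof (rule Lim_null_comparison)
    have "filterlim (\<lambda>n. real (b n) - 1) at_top sequentially"
    proof -
      have "filterlim (\<lambda>n. -1 + real (b n)) at_top sequentially"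
        by (rule filterlim_tendsto_add_at_top[OF tendsto_const])
          (rule filterlim_compose[OF filterlim_real_sequentially b])
      then show ?thesis by simp
    qed
    then show "(\<lambda>n. C / sqrt (real (b n) - 1)) \<longlonglongrightarrow> 0"
      by (intro tendsto_divide_0[OF tendsto_const] filterlim_at_top_imp_at_infinity filterlim_compose[OF sqrt_at_top])
    show "\<forall>\<^sub>F n in sequentially. norm (nrm M (\<lambda>x. f n x - g n x)) \<le> C / sqrt (real (b n) - 1)"
      using filterlim_at_top[THEN iffD1, OF b, rule_format, of 2]
    proof eventually_elim
      case (elim n)
      define S where "S = {(j, k). j \<in> {1..b n} \<and> k \<in> {1..b n} \<and> j \<noteq> k}"
      define \<beta> where "\<beta> = real (b n)"
      define D where "D x = (\<Sum>(j, k)\<in>S. hdeg h (\<nu> (l n)) (T n j x) (T n k x))" for x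
      have \<beta>: "\<beta> \<ge> 2" using elim by (simp add: \<beta>_def)
      have b1: "real (b n - 1) = \<beta> - 1" using elim by (simp add: \<beta>_def of_nat_diff)
      have cardS: "real (card S) = \<beta> * (\<beta> - 1)"
        unfolding S_def card_off_diag of_nat_mult b1 by (simp add: \<beta>_def)
      have law': "distr M borel (T n i) = \<nu> (l n)" if "i \<in> {1..b n}" for i using law[OF that] by (simp add: \<nu>_def)
      note deg = lip_law.degenerate_second_moment[OF lawV assms(1) ind law', folded S_def]
      have finS: "finite S" unfolding S_def by (rule finite_subset[of _ "{1..b n} \<times> {1..b n}"]) auto
      have D2: "L2 M D"
        unfolding D_def[abs_def]
      proof (intro L2_sum)
        fix p assume "p \<in> S"
        then show "L2 M (\<lambda>x. case p of (j, k) \<Rightarrow> hdeg h (\<nu> (l n)) (T n j x) (T n k x))"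
          using deg(1)[of "fst p" "snd p"] by (simp add: case_prod_beta)
      qed
      have "(nrm M D)\<^sup>2 \<le> 2 * real (card S) * (4 * Lh * lip_law.m (\<nu> (l n)))\<^sup>2"
        using deg(2) by (simp add: nrm_sq D_def)
      also have "\<dots> \<le> 2 * real (card S) * (4 * Lh * B)\<^sup>2"
        unfolding m using bd[of "l n"] Lh_nonneg by (intro mult_left_mono power_mono) auto
      finally have "nrm M D \<le> sqrt (2 * real (card S) * (4 * Lh * B)\<^sup>2)"
        by (rule real_le_rsqrt)
      also have "\<dots> = C * sqrt (\<beta> * (\<beta> - 1))"
        using Lh_nonneg B by (simp add: real_sqrt_mult cardS C_def abs_mult)
      finally have nD: "nrm M D \<le> C * sqrt (\<beta> * (\<beta> - 1))" .
      have "f n x - g n x = sqrt \<beta> / (\<beta> * (\<beta> - 1)) * D x" for x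
      proof -
        let ?\<mu> = "hmean h (\<nu> (l n))"
        have "(\<Sum>(j, k)\<in>S. h (T n j x, T n k x)) = (\<Sum>(j, k)\<in>S. hdeg h (\<nu> (l n)) (T n j x) (T n k x) + \<zeta> n j x + \<zeta> n k x + ?\<mu>)"
          by (intro sum.cong refl) (auto simp: hdeg_def \<zeta>_def psi_def)
        also have "\<dots> = D x + (\<Sum>(j, k)\<in>S. \<zeta> n j x) + (\<Sum>(j, k)\<in>S. \<zeta> n k x) + real (card S) * ?\<mu>"
          by (simp add: D_def case_prod_beta sum.distrib)
        also have "\<dots> = D x + 2 * (\<beta> - 1) * (\<Sum>j\<in>{1..b n}. \<zeta> n j x) + \<beta> * (\<beta> - 1) * ?\<mu>"
          unfolding cardS unfolding S_def sum_off_diag_fst sum_off_diag_snd b1 by (simp add: algebra_simps)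
        finally have "(\<Sum>(j, k)\<in>S. h (T n j x, T n k x)) = D x + 2 * (\<beta> - 1) * (\<Sum>j\<in>{1..b n}. \<zeta> n j x) + \<beta> * (\<beta> - 1) * ?\<mu>" .
        then have odm: "off_diag_mean (b n) (\<lambda>j k. h (T n j x, T n k x)) =
            1 / (\<beta> * (\<beta> - 1)) * (D x + 2 * (\<beta> - 1) * (\<Sum>j\<in>{1..b n}. \<zeta> n j x) + \<beta> * (\<beta> - 1) * ?\<mu>)"
          by (simp add: off_diag_mean_def S_def \<beta>_def)
        have "off_diag_mean (b n) (\<lambda>j k. h (T n j x, T n k x)) - ?\<mu> =
            D x / (\<beta> * (\<beta> - 1)) + 2 / \<beta> * (\<Sum>j\<in>{1..b n}. \<zeta> n j x)"
        proof -
          have "1 / (\<beta> * c) * (d + 2 * c * s + \<beta> * c * u) - u = d / (\<beta> * c) + 2 / \<beta> * s"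
            if "c \<noteq> 0" for c d s u using \<beta> that by (simp add: field_simps)
          from this[of "\<beta> - 1"] \<beta> show ?thesis by (simp only: odm)
        qed
        moreover have "sqrt \<beta> * (2 / \<beta>) = 2 * (1 / sqrt \<beta>)"
          using \<beta> real_div_sqrt[of \<beta>] by (simp add: field_simps)
        then have "sqrt \<beta> * (2 / \<beta> * (\<Sum>j\<in>{1..b n}. \<zeta> n j x)) = g n x"
          unfolding g_def \<beta>_def[symmetric] by (simp only: mult.assoc[symmetric])
        ultimately show ?thesis
          unfolding f_def \<beta>_def[symmetric] by (simp add: distrib_left)
      qed
      then have "nrm M (\<lambda>x. f n x - g n x) = sqrt \<beta> / (\<beta> * (\<beta> - 1)) * nrm M D"
        using \<beta> by (simp only: nrm_cmult) (simp add: abs_mult)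
      also have "\<dots> \<le> sqrt \<beta> / (\<beta> * (\<beta> - 1)) * (C * sqrt (\<beta> * (\<beta> - 1)))"
        using nD \<beta> by (intro mult_left_mono) auto
      also have "\<dots> = C / sqrt (\<beta> - 1)"
      proof -
        have s: "sqrt \<beta> * sqrt \<beta> = \<beta>" "sqrt (\<beta> - 1) * sqrt (\<beta> - 1) = \<beta> - 1" using \<beta> by auto
        have "sqrt \<beta> * (C * sqrt (\<beta> * (\<beta> - 1))) * sqrt (\<beta> - 1) = C * ((sqrt \<beta> * sqrt \<beta>) * (sqrt (\<beta> - 1) * sqrt (\<beta> - 1)))"
          by (simp only: real_sqrt_mult mult_ac)
        also have "\<dots> = C * (\<beta> * (\<beta> - 1))" by (simp only: s)
        finally show ?thesis using \<beta> by (simp add: field_simps)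
      qed
      finally show ?case by (simp add: \<beta>_def)
    qed
  qed
  from M.char_limit_L2[OF f2 g2 fg g_char] show ?thesis
    by (simp add: f_def[abs_def] \<nu>_def \<Gamma>_def)
qed

section \<open>The limiting variance as a second moment of the linear term\<close>

lemma distr_pair_snd:
  assumes "prob_space M" "sigma_finite_measure N"
  shows "distr (M \<Otimes>\<^sub>M N) N snd = N"
proof (rule measure_eqI)
  interpret M: prob_space M by fact
  interpret N: sigma_finite_measure N by fact
  fix A assume A: "A \<in> sets (distr (M \<Otimes>\<^sub>M N) N snd)"
  then have "snd -` A \<inter> space (M \<Otimes>\<^sub>M N) = space M \<times> A"
    by (auto simp: space_pair_measure dest: sets.sets_into_space)
  with A show "emeasure (distr (M \<Otimes>\<^sub>M N) N snd) A = emeasure N A"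
    by (simp add: emeasure_distr N.emeasure_pair_measure_Times M.emeasure_space_1)
qed simp

text \<open>Given the shared middle variable the two factors are independent, and by symmetry of
  \<open>h\<close> both have conditional mean psi after centring. The covariance is therefore the
  second moment of psi.\<close>

lemma (in lip_kernel) gamma_sq_eq:
  "gamma_sq h \<sigma> = (\<integral>w. (psi h (real_gauss \<sigma>) w)\<^sup>2 \<partial>real_gauss \<sigma>)"
proof -
  let ?S = "std_normal_distribution"
  interpret S: prob_space ?S by (rule real_distribution.axioms(1)[OF real_dist_normal_dist])
  interpret SS: pair_prob_space ?S ?S ..
  interpret SSS: pair_prob_space ?S "?S \<Otimes>\<^sub>M ?S" ..
  interpret law: lip_law h Lh "real_gauss \<sigma>"
    unfolding real_gauss_def by (rule lip_law_distr[OF S.prob_space_axioms L2_std_normal])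
  let ?p = "\<lambda>y. psi h (real_gauss \<sigma>) (\<sigma> * y)"
  define \<mu> where "\<mu> = hmean h (real_gauss \<sigma>)"
  have pU: "measure ?S UNIV = 1" using S.prob_space by simp
  have p2: "L2 ?S ?p"
  proof (rule L2_bound(1))
    show "L2 ?S (\<lambda>x. Lh * (\<bar>\<sigma> * x\<bar> + law.m))" by (intro L2_cmult L2_add L2_abs L2_std_normal S.L2_const)
    show "AE x in ?S. \<bar>?p x\<bar> \<le> \<bar>Lh * (\<bar>\<sigma> * x\<bar> + law.m)\<bar>"
      by (intro AE_I2 order_trans[OF law.abs_psi_le abs_ge_self])
  qed simp
  have hb: "hbar h (real_gauss \<sigma>) w = (\<integral>x. h (w, \<sigma> * x) \<partial>?S)" for w
    unfolding real_gauss_def by (rule hbar_distr) simp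
  have \<mu>: "\<mu> = (\<integral>y. hbar h (real_gauss \<sigma>) (\<sigma> * y) \<partial>?S)"
    unfolding \<mu>_def hmean_def
    using integral_distr[of "\<lambda>x. \<sigma> * x" ?S borel "hbar h (real_gauss \<sigma>)"]
    by (simp add: law.hbar_measurable_borel real_gauss_def[symmetric])
  have inth: "integrable ?S (\<lambda>x. h (w, \<sigma> * x))" for w
    by (intro S.L2_integrable L2_h S.prob_space_axioms S.L2_const L2_std_normal)

  have p: "?p y = (\<integral>x. h (\<sigma> * x, \<sigma> * y) - \<mu> \<partial>?S)" for y
    using inth[of "\<sigma> * y"] by (simp add: psi_def \<mu>_def hb h_sym[of "\<sigma> * _" "\<sigma> * y"] pU)
  have fst_eq: "distr (?S \<Otimes>\<^sub>M N) ?S fst = ?S" if "prob_space N" for N :: "'z measure"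
    using prob_space.distr_pair_fst[OF that, of ?S] .
  have swap: "distr (?S \<Otimes>\<^sub>M (?S \<Otimes>\<^sub>M ?S)) (?S \<Otimes>\<^sub>M ?S) snd = ?S \<Otimes>\<^sub>M ?S"
    "distr (?S \<Otimes>\<^sub>M ?S) ?S snd = ?S"
    by (rule distr_pair_snd[OF S.prob_space_axioms SS.sigma_finite_measure_axioms]
      distr_pair_snd[OF S.prob_space_axioms S.sigma_finite_measure_axioms])+
  define X1 where "X1 = (\<lambda>u :: real \<times> real \<times> real. \<sigma> * fst u)"
  define X2 where "X2 = (\<lambda>u :: real \<times> real \<times> real. \<sigma> * fst (snd u))"
  define X3 where "X3 = (\<lambda>u :: real \<times> real \<times> real. \<sigma> * snd (snd u))"
  let ?Q = "?S \<Otimes>\<^sub>M ?S" and ?R = "?S \<Otimes>\<^sub>M (?S \<Otimes>\<^sub>M ?S)"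
  have Q12: "L2 ?Q (\<lambda>q. \<sigma> * fst q)" "L2 ?Q (\<lambda>q. \<sigma> * snd q)"
    using L2_distr[of fst ?Q ?S "\<lambda>x. \<sigma> * x"] L2_distr[of snd ?Q ?S "\<lambda>x. \<sigma> * x"] L2_std_normal[of \<sigma>]
      fst_eq[OF S.prob_space_axioms] swap(2) by simp_all
  have X1: "L2 ?R X1"
    using L2_distr[of fst ?R ?S "\<lambda>x. \<sigma> * x"] L2_std_normal[of \<sigma>] fst_eq[OF SS.prob_space_axioms]
    by (simp add: X1_def)
  have X23: "L2 ?R X2" "L2 ?R X3"
    using L2_distr[of snd ?R ?Q "\<lambda>q. \<sigma> * fst q"] L2_distr[of snd ?R ?Q "\<lambda>q. \<sigma> * snd q"] Q12 swap(1)
    by (simp_all add: X2_def X3_def)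
  have H12: "L2 ?R (\<lambda>u. h (X1 u, X2 u))" and H23: "L2 ?R (\<lambda>u. h (X2 u, X3 u))"
    and HQ: "L2 ?Q (\<lambda>q. h (\<sigma> * fst q, \<sigma> * snd q))"
    by (rule L2_h[OF SSS.prob_space_axioms X1 X23(1)] L2_h[OF SSS.prob_space_axioms X23] L2_h[OF SS.prob_space_axioms Q12])+
  have intQ: "(\<integral>q. h (\<sigma> * fst q, \<sigma> * snd q) \<partial>?Q) = \<mu>"
    unfolding \<mu> hb using SS.integral_fst'[OF SS.L2_integrable[OF HQ]] by simp
  have E23: "(\<integral>u. h (X2 u, X3 u) \<partial>?R) = \<mu>"
  proof -
    have "(\<integral>u. h (X2 u, X3 u) \<partial>?R) = (\<integral>x. \<integral>q. h (\<sigma> * fst q, \<sigma> * snd q) \<partial>?Q \<partial>?S)"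
      using SSS.integral_fst'[OF SSS.L2_integrable[OF H23]] by (simp add: X2_def X3_def)
    then show ?thesis unfolding intQ by (simp add: pU)
  qed
  have E12: "(\<integral>u. h (X1 u, X2 u) \<partial>?R) = \<mu>"
  proof -
    have "(\<integral>q. h (w, \<sigma> * fst q) \<partial>?Q) = hbar h (real_gauss \<sigma>) w" for w
      using integral_distr[of fst ?Q ?S "\<lambda>y. h (w, \<sigma> * y)"] fst_eq[OF S.prob_space_axioms] by (simp add: hb)
    then show ?thesis
      unfolding \<mu> using SSS.integral_fst'[OF SSS.L2_integrable[OF H12]] by (simp add: X1_def X2_def)
  qed
  let ?A = "\<lambda>u. h (X1 u, X2 u) - \<mu>" and ?B = "\<lambda>u. h (X2 u, X3 u) - \<mu>"
  have AB: "integrable ?R (\<lambda>u. ?A u * ?B u)"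
    by (intro L2_mult_integrable L2_diff H12 H23 SSS.L2_const)
  have pQ: "integrable ?Q (\<lambda>q. ?p (fst q) * (h (\<sigma> * fst q, \<sigma> * snd q) - \<mu>))"
  proof (intro L2_mult_integrable L2_diff HQ SS.L2_const)
    show "L2 ?Q (\<lambda>q. ?p (fst q))"
      using L2_distr[of fst ?Q ?S ?p] p2 fst_eq[OF S.prob_space_axioms] by simp
  qed
  have "gamma_sq h \<sigma> = (\<integral>u. ?A u * ?B u \<partial>?R)"
    unfolding gamma_sq_def covariance_def
    using E12 E23 by (simp add: X1_def X2_def X3_def case_prod_unfold)
  \<comment> \<open>The outer variables are integrated out one at a time, here the first, so that
    each leaves one factor psi of the middle variable.\<close>
  also have "\<dots> = (\<integral>q. (\<integral>x. ?A (x, q) * ?B (x, q) \<partial>?S) \<partial>?Q)"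
    using SSS.integral_snd[of "\<lambda>x q. ?A (x, q) * ?B (x, q)"] AB by (simp add: case_prod_unfold)
  also have "\<dots> = (\<integral>q. ?p (fst q) * (h (\<sigma> * fst q, \<sigma> * snd q) - \<mu>) \<partial>?Q)"
    by (simp add: X1_def X2_def X3_def p)
  also have "\<dots> = (\<integral>y. (\<integral>z. ?p y * (h (\<sigma> * y, \<sigma> * z) - \<mu>) \<partial>?S) \<partial>?S)"
    using SS.integral_fst'[OF pQ] by simp
  also have "\<dots> = (\<integral>y. (?p y)\<^sup>2 \<partial>?S)"
  proof (rule Bochner_Integration.integral_cong[OF refl])
    fix y
    have "(\<integral>z. h (\<sigma> * y, \<sigma> * z) - \<mu> \<partial>?S) = ?p y"
      unfolding p by (simp add: h_sym[of "\<sigma> * y"])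
    then show "(\<integral>z. ?p y * (h (\<sigma> * y, \<sigma> * z) - \<mu>) \<partial>?S) = (?p y)\<^sup>2"
      by (simp add: power2_eq_square)
  qed
  also have "\<dots> = (\<integral>w. (psi h (real_gauss \<sigma>) w)\<^sup>2 \<partial>real_gauss \<sigma>)"
    using integral_distr[of "\<lambda>x. \<sigma> * x" ?S borel "\<lambda>w. (psi h (real_gauss \<sigma>) w)\<^sup>2"]
    by (simp add: real_gauss_def[symmetric])
  finally show ?thesis .
qed

section \<open>U-statistics of block statistics\<close>

lemma off_diag_mean_diff:
  "off_diag_mean b c - off_diag_mean b c' = off_diag_mean b (\<lambda>j k. c j k - c' j k)"
  by (simp add: off_diag_mean_def sum_subtractf case_prod_beta diff_divide_distrib)

lemma abs_off_diag_mean_le: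
  "\<bar>off_diag_mean b c\<bar> \<le> off_diag_mean b (\<lambda>j k. \<bar>c j k\<bar>)"
proof -
  define S where "S = {(j, k). j \<in> {1..b} \<and> k \<in> {1..b} \<and> j \<noteq> k}"
  \<comment> \<open>For b = 0 and b = 1 the prefactor is a division by zero and hence 0.\<close>
  have nn: "0 \<le> 1 / (real b * (real b - 1))" by (cases b) auto
  have "\<bar>off_diag_mean b c\<bar> = 1 / (real b * (real b - 1)) * \<bar>\<Sum>(j, k)\<in>S. c j k\<bar>"
    unfolding off_diag_mean_def S_def[symmetric] abs_mult using nn by (simp only: abs_of_nonneg)
  also have "\<dots> \<le> 1 / (real b * (real b - 1)) * (\<Sum>(j, k)\<in>S. \<bar>c j k\<bar>)"
    using nn sum_abs[of "\<lambda>p. c (fst p) (snd p)" S] by (intro mult_left_mono) (simp_all add: case_prod_beta)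
  finally show ?thesis by (simp add: off_diag_mean_def S_def)
qed

lemma off_diag_mean_le:
  assumes "\<And>j k. j \<in> {1..b} \<Longrightarrow> k \<in> {1..b} \<Longrightarrow> j \<noteq> k \<Longrightarrow> c j k \<le> B" "B \<ge> 0"
  shows "off_diag_mean b c \<le> B"
proof -
  define S where "S = {(j, k). j \<in> {1..b} \<and> k \<in> {1..b} \<and> j \<noteq> k}"
  have nn: "0 \<le> 1 / (real b * (real b - 1))" by (cases b) auto
  have "(\<Sum>(j, k)\<in>S. c j k) \<le> of_nat (card S) * B"
    by (intro sum_bounded_above) (auto simp: S_def intro: assms(1))
  then have "off_diag_mean b c \<le> 1 / (real b * (real b - 1)) * (real (card S) * B)"
    unfolding off_diag_mean_def S_def[symmetric] using nn by (rule mult_left_mono)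
  also have "\<dots> = 1 / (real b * (real b - 1)) * (real b * real (b - 1) * B)"
    unfolding S_def card_off_diag by simp
  also have "\<dots> \<le> B"
  proof (cases "b \<le> 1")
    case True
    then have "b = 0 \<or> b = 1" by auto
    then show ?thesis using assms(2) by auto
  next
    case False
    then have "real (b - 1) = real b - 1" "real b * (real b - 1) \<noteq> 0" by (auto simp: of_nat_diff)
    then show ?thesis by simp
  qed
  finally show ?thesis .
qed

text \<open>For b at most 1 the mean is 0 by convention, so centring constants can be pulled in only
  for large n.\<close>

lemma off_diag_mean_const: "b \<ge> 2 \<Longrightarrow> off_diag_mean b (\<lambda>j k. c) = c"
proof -
  assume b: "b \<ge> 2"
  then have "real (b - 1) = real b - 1" "real b * (real b - 1) \<noteq> 0" by (auto simp: of_nat_diff)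
  then show ?thesis
    unfolding off_diag_mean_def sum_off_diag_fst[of "\<lambda>j. c"] by simp
qed

lemma off_diag_mean_cong:
  assumes "\<And>j k. j \<in> {1..b} \<Longrightarrow> k \<in> {1..b} \<Longrightarrow> j \<noteq> k \<Longrightarrow> c j k = c' j k"
  shows "off_diag_mean b c = off_diag_mean b c'"
  unfolding off_diag_mean_def using assms by (intro arg_cong2[where f="(*)"] refl sum.cong) auto

lemma off_diag_mean_integral:
  assumes "\<And>j k. j \<in> {1..b} \<Longrightarrow> k \<in> {1..b} \<Longrightarrow> j \<noteq> k \<Longrightarrow> integrable M (c j k)"
  shows "(\<integral>x. off_diag_mean b (\<lambda>j k. c j k x) \<partial>M) = off_diag_mean b (\<lambda>j k. \<integral>x. c j k x \<partial>M)"
    and "integrable M (\<lambda>x. off_diag_mean b (\<lambda>j k. c j k x))"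
proof -
  define S where "S = {(j, k). j \<in> {1..b} \<and> k \<in> {1..b} \<and> j \<noteq> k}"
  have i: "integrable M (\<lambda>x. c (fst p) (snd p) x)" if "p \<in> S" for p
    using that assms by (auto simp: S_def)
  show "(\<integral>x. off_diag_mean b (\<lambda>j k. c j k x) \<partial>M) = off_diag_mean b (\<lambda>j k. \<integral>x. c j k x \<partial>M)"
    unfolding off_diag_mean_def S_def[symmetric] unfolding case_prod_unfold
    by (simp only: integral_mult_right_zero Bochner_Integration.integral_sum[OF i])
  show "integrable M (\<lambda>x. off_diag_mean b (\<lambda>j k. c j k x))"
    unfolding off_diag_mean_def S_def[symmetric] unfolding case_prod_unfold using i by (intro integrable_mult_right Bochner_Integration.integrable_sum)
qed

section \<open>Comparing the original, the cut-off and the independent block statistics\<close>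

context block_means
begin

lemma prob_BM_far:
  assumes "l > 0" "a > 0"
  shows "P.prob {x. a < norm (BM l j x - v0)} \<le> NB\<^sup>2 / (a\<^sup>2 * real l)"
proof -
  have sets: "{x. a < norm (BM l i x - v0)} \<in> P.events" for i
  proof -
    have "{x \<in> space P. a < norm (BM l i x - v0)} \<in> P.events" by measurable
    then show ?thesis by simp
  qed
  let ?t = "(int j - 1) * int l"
  have "shift ?t -` {x. a < norm (BM l 1 x - v0)} \<inter> space P = {x. a < norm (BM l j x - v0)}"
    by (auto simp: BM_shift[of l j])
  then have "P.prob {x. a < norm (BM l j x - v0)} = measure (distr P P (shift ?t)) {x. a < norm (BM l 1 x - v0)}"
    using measure_distr[OF measurable_shift sets[of 1], of ?t] by simp
  also have "\<dots> = P.prob {x. a < norm (BM l 1 x - v0)}" by (simp add: distr_shift)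
  also have "\<dots> \<le> P.prob {x \<in> space P. (N l x)\<^sup>2 \<ge> a\<^sup>2 * real l}"
  proof (rule P.finite_measure_mono)
    show "{x. a < norm (BM l 1 x - v0)} \<subseteq> {x \<in> space P. (N l x)\<^sup>2 \<ge> a\<^sup>2 * real l}"
    proof
      fix x assume "x \<in> {x. a < norm (BM l 1 x - v0)}"
      then have "sqrt (real l) * a \<le> sqrt (real l) * norm (BM l 1 x - v0)" by (intro mult_left_mono) auto
      then have "sqrt (real l) * a \<le> N l x" using norm_BM_le[of l x] by linarith
      from power_mono[OF this, of 2] have "a\<^sup>2 * real l \<le> (N l x)\<^sup>2"
        using \<open>a > 0\<close> by (simp add: power_mult_distrib mult.commute)
      then show "x \<in> {x \<in> space P. (N l x)\<^sup>2 \<ge> a\<^sup>2 * real l}" by simp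
    qed
    have [measurable]: "N l \<in> borel_measurable P" using L2_N by (rule L2_measurable)
    show "{x \<in> space P. (N l x)\<^sup>2 \<ge> a\<^sup>2 * real l} \<in> P.events" by measurable
  qed
  also have "\<dots> \<le> (\<integral>x. (N l x)\<^sup>2 \<partial>P) / (a\<^sup>2 * real l)"
    using assms by (intro integral_Markov_inequality_measure[where A="{}"] L2_sq_integrable L2_N) auto
  also have "\<dots> \<le> NB\<^sup>2 / (a\<^sup>2 * real l)"
    unfolding nrm_sq[symmetric] using nrm_N_le[of l] by (intro divide_right_mono power_mono) auto
  finally show ?thesis .
qed

text \<open>Surrogates of distinct blocks are independent with a common law, so one number centres
  every pair.\<close>

lemma WT_pair_mean:
  assumes "lip_kernel h Lh" "j \<noteq> k"
  shows "(\<integral>x. h (WT l j x, WT l k x) \<partial>P) = hmean h (distr P borel (WT l 1))"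
proof -
  interpret lip_kernel h Lh by fact
  let ?\<nu> = "distr P borel (WT l 1)"
  interpret \<nu>: prob_space ?\<nu> by (rule P.prob_space_distr) simp
  interpret \<nu>\<nu>: pair_prob_space ?\<nu> ?\<nu> ..
  have "block l j \<inter> block l k = {}"
    using disjoint_blocks[of l UNIV] assms(2) by (auto simp: disjoint_family_on_def)
  from indep_var_depends[OF WT_measurable WT_depends WT_measurable WT_depends this]
  have D: "?\<nu> \<Otimes>\<^sub>M ?\<nu> = distr P (borel \<Otimes>\<^sub>M borel) (\<lambda>x. (WT l j x, WT l k x))"
    unfolding P.indep_var_distribution_eq WT_law[of l j] WT_law[of l k] by blast
  have h_meas: "h \<in> borel_measurable (borel \<Otimes>\<^sub>M borel)"
    using h_measurable_borel by (simp add: borel_prod)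
  have T: "(\<lambda>x. (WT l j x, WT l k x)) \<in> measurable P (borel \<Otimes>\<^sub>M borel)" by measurable
  have "integrable P (\<lambda>x. h (WT l j x, WT l k x))"
    by (intro P.L2_integrable L2_h P.prob_space_axioms L2_WT)
  then have "integrable (?\<nu> \<Otimes>\<^sub>M ?\<nu>) h"
    unfolding D by (subst integrable_distr_eq[OF T h_meas])
  from \<nu>\<nu>.integral_fst'[OF this] have "hmean h ?\<nu> = (\<integral>z. h z \<partial>(?\<nu> \<Otimes>\<^sub>M ?\<nu>))"
    by (simp add: hmean_def hbar_def)
  also have "\<dots> = (\<integral>x. h (WT l j x, WT l k x) \<partial>P)"
    unfolding D by (rule integral_distr[OF T h_meas])
  finally show ?thesis ..
qed

lemma h_W_WT_error:
  assumes "lip_kernel h Lh"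
  shows "integrable P (\<lambda>x. h (W l j x, W l k x))" "integrable P (\<lambda>x. h (WT l j x, WT l k x))"
    "(\<integral>x. \<bar>h (W l j x, W l k x) - h (WT l j x, WT l k x)\<bar> \<partial>P) \<le> 2 * Lh * WC / sqrt (real l)"
proof -
  interpret lip_kernel h Lh by fact
  show i: "integrable P (\<lambda>x. h (W l j x, W l k x))" "integrable P (\<lambda>x. h (WT l j x, WT l k x))"
    by (intro P.L2_integrable L2_h P.prob_space_axioms L2_WT L2_W)+
  have int: "integrable P (\<lambda>x. \<bar>W l i x - WT l i x\<bar>)" for i
    by (intro integrable_abs P.L2_integrable W_WT)
  have e: "(\<integral>x. \<bar>W l i x - WT l i x\<bar> \<partial>P) \<le> WC / sqrt (real l)" for i
    using P.integral_abs_le_nrm[OF W_WT(1)[of l i]] W_WT(2)[of l i] by linarith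
  have "(\<integral>x. \<bar>h (W l j x, W l k x) - h (WT l j x, WT l k x)\<bar> \<partial>P) \<le>
      (\<integral>x. Lh * (\<bar>W l j x - WT l j x\<bar> + \<bar>W l k x - WT l k x\<bar>) \<partial>P)"
  proof (rule integral_mono)
    show "integrable P (\<lambda>x. \<bar>h (W l j x, W l k x) - h (WT l j x, WT l k x)\<bar>)"
      using i by simp
    show "integrable P (\<lambda>x. Lh * (\<bar>W l j x - WT l j x\<bar> + \<bar>W l k x - WT l k x\<bar>))"
      by (intro integrable_mult_right Bochner_Integration.integrable_add int)
  qed (rule h_lip)
  also have "\<dots> = Lh * ((\<integral>x. \<bar>W l j x - WT l j x\<bar> \<partial>P) + (\<integral>x. \<bar>W l k x - WT l k x\<bar> \<partial>P))"
    using int by simp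
  also have "\<dots> \<le> Lh * (WC / sqrt (real l) + WC / sqrt (real l))"
    by (intro mult_left_mono add_mono e Lh_nonneg)
  finally show "(\<integral>x. \<bar>h (W l j x, W l k x) - h (WT l j x, WT l k x)\<bar> \<partial>P) \<le> 2 * Lh * WC / sqrt (real l)"
    by (simp add: algebra_simps)
qed

lemma WC_nonneg: "WC \<ge> 0"
  unfolding WC_def using L_nonneg suminf_nonneg[OF summable_\<tau> wdep_nonneg[OF wdep_F]] by simp

text \<open>\<open>f1\<close> uses g, \<open>f2\<close> its cut-off version \<open>G\<close>,
  \<open>f3\<close> the surrogates with their own centring. Away from \<open>v0\<close> nothing
  controls the size of g, so h of the original statistics need not be integrable: \<open>f1\<close>
  and \<open>f2\<close> share the centring built from \<open>G\<close> and are compared on the event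
  where they agree, whereas \<open>f2\<close> and \<open>f3\<close> are compared in L1.\<close>

lemma block_ustat_char:
  assumes lk: "lip_kernel h Lh" and s: "s = \<sigma>\<^sup>2"
    and b: "filterlim b at_top sequentially" and l: "filterlim l at_top sequentially"
    and bl: "(\<lambda>n. real (b n) / real (l n)) \<longlonglongrightarrow> 0"
    and g [measurable]: "g \<in> borel_measurable borel" and "a > 0"
    and gG: "\<And>x. norm (x - v0) \<le> a \<Longrightarrow> g x = G x"
  shows "(\<lambda>n. char (distr P borel (\<lambda>x. sqrt (real (b n)) *
      (off_diag_mean (b n) (\<lambda>j k. h (sqrt (real (l n)) * g (BM (l n) j x), sqrt (real (l n)) * g (BM (l n) k x)))
       - off_diag_mean (b n) (\<lambda>j k. \<integral>z. h (W (l n) j z, W (l n) k z) \<partial>P)))) t)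
    \<longlonglongrightarrow> complex_of_real (exp (- (4 * gamma_sq h \<sigma>) * t\<^sup>2 / 2))"
proof -
  interpret lip_kernel h Lh by fact
  define \<mu>n where "\<mu>n n = hmean h (distr P borel (WT (l n) 1))" for n
  define c where "c n = off_diag_mean (b n) (\<lambda>j k. \<integral>z. h (W (l n) j z, W (l n) k z) \<partial>P)" for n
  define f1 where "f1 n x = sqrt (real (b n)) *
      (off_diag_mean (b n) (\<lambda>j k. h (sqrt (real (l n)) * g (BM (l n) j x), sqrt (real (l n)) * g (BM (l n) k x))) - c n)" for n x
  define f2 where "f2 n x = sqrt (real (b n)) * (off_diag_mean (b n) (\<lambda>j k. h (W (l n) j x, W (l n) k x)) - c n)" for n x
  define f3 where "f3 n x = sqrt (real (b n)) * (off_diag_mean (b n) (\<lambda>j k. h (WT (l n) j x, WT (l n) k x)) - \<mu>n n)" for n x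
  have meas_odm: "(\<lambda>x. off_diag_mean (b n) (\<lambda>j k. h (q j x, q k x))) \<in> borel_measurable P"
    if "\<And>j. q j \<in> borel_measurable P" for n and q :: "nat \<Rightarrow> (int \<Rightarrow> real) \<Rightarrow> real"
    unfolding off_diag_mean_def case_prod_beta using that
    by (intro borel_measurable_times borel_measurable_const borel_measurable_sum h_measurable)
  have [measurable]: "f1 n \<in> borel_measurable P" for n
    unfolding f1_def[abs_def]
    by (intro borel_measurable_times borel_measurable_diff borel_measurable_const
        meas_odm) measurable
  have [measurable]: "f2 n \<in> borel_measurable P" "f3 n \<in> borel_measurable P" for n
    unfolding f2_def[abs_def] f3_def[abs_def]
    by (intro borel_measurable_times borel_measurable_diff borel_measurable_const meas_odm W_measurable WT_measurable)+
  obtain B where B: "\<And>i. nrm P (WT i 1) \<le> B" using nrm_WT_bound by blast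
  have c3: "(\<lambda>n. char (distr P borel (f3 n)) t) \<longlonglongrightarrow> complex_of_real (exp (- (4 * gamma_sq h \<sigma>) * t\<^sup>2 / 2))"
    unfolding f3_def[abs_def] \<mu>n_def gamma_sq_eq
    by (rule ustat_clt[OF P.prob_space_axioms L2_WT ui2_WT B WT_weak_conv[OF s] b l WT_indep WT_law])
  have sq: "(\<lambda>n. sqrt (real (b n)) / sqrt (real (l n))) \<longlonglongrightarrow> 0"
    using tendsto_real_sqrt[OF bl] by (simp add: real_sqrt_divide)
  define K where "K = 2 * Lh * WC"
  have K: "K \<ge> 0" unfolding K_def using Lh_nonneg WC_nonneg by simp
  have int_h: "integrable P (\<lambda>x. h (W (l n) j x, W (l n) k x) - h (WT (l n) j x, WT (l n) k x))" for n j k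
    by (intro Bochner_Integration.integrable_diff h_W_WT_error[OF lk])
  have int23: "integrable P (\<lambda>x. f2 n x - f3 n x)" for n
  proof -
    have "integrable P (f2 n)" "integrable P (f3 n)"
      unfolding f2_def[abs_def] f3_def[abs_def]
      by (intro integrable_mult_right Bochner_Integration.integrable_diff P.integrable_const off_diag_mean_integral(2) h_W_WT_error[OF lk])+
    then show ?thesis by simp
  qed
  have lim23: "(\<lambda>n. \<integral>x. \<bar>f2 n x - f3 n x\<bar> \<partial>P) \<longlonglongrightarrow> 0"
  proof (rule Lim_null_comparison)
    show "(\<lambda>n. 2 * K * (sqrt (real (b n)) / sqrt (real (l n)))) \<longlonglongrightarrow> 0"
      using tendsto_mult_left[OF sq, of "2 * K"] by simp
    show "\<forall>\<^sub>F n in sequentially. norm (\<integral>x. \<bar>f2 n x - f3 n x\<bar> \<partial>P) \<le> 2 * K * (sqrt (real (b n)) / sqrt (real (l n)))"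
      using filterlim_at_top[THEN iffD1, OF b, rule_format, of 2]
    proof eventually_elim
      case (elim n)
      let ?d = "\<lambda>j k x. h (W (l n) j x, W (l n) k x) - h (WT (l n) j x, WT (l n) k x)"
      let ?e = "K / sqrt (real (l n))"
      have e: "(\<integral>x. \<bar>?d j k x\<bar> \<partial>P) \<le> ?e" for j k
        unfolding K_def by (rule h_W_WT_error(3)[OF lk])
      have e0: "?e \<ge> 0" using K by simp
      have \<mu>: "\<mu>n n = off_diag_mean (b n) (\<lambda>j k. \<integral>x. h (WT (l n) j x, WT (l n) k x) \<partial>P)"
      proof -
        have "\<mu>n n = off_diag_mean (b n) (\<lambda>j k. \<mu>n n)" using elim by (simp add: off_diag_mean_const)
        also have "\<dots> = off_diag_mean (b n) (\<lambda>j k. \<integral>x. h (WT (l n) j x, WT (l n) k x) \<partial>P)"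
          by (intro off_diag_mean_cong) (simp add: WT_pair_mean[OF lk] \<mu>n_def)
        finally show ?thesis .
      qed
      have diff: "c n - \<mu>n n = off_diag_mean (b n) (\<lambda>j k. \<integral>x. ?d j k x \<partial>P)"
        unfolding c_def \<mu> off_diag_mean_diff using h_W_WT_error(1,2)[OF lk] by simp
      have "\<bar>c n - \<mu>n n\<bar> \<le> off_diag_mean (b n) (\<lambda>j k. \<bar>\<integral>x. ?d j k x \<partial>P\<bar>)"
        unfolding diff by (rule abs_off_diag_mean_le)
      also have "\<dots> \<le> ?e"
      proof (rule off_diag_mean_le[OF _ e0])
        show "\<bar>\<integral>x. ?d j k x \<partial>P\<bar> \<le> ?e" for j k
          using integral_abs_bound[of P "?d j k"] e[of j k] by linarith
      qed
      finally have c\<mu>: "\<bar>c n - \<mu>n n\<bar> \<le> ?e" .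
      have eq: "f2 n x - f3 n x = sqrt (real (b n)) * (off_diag_mean (b n) (\<lambda>j k. ?d j k x) - (c n - \<mu>n n))" for x
        unfolding f2_def f3_def off_diag_mean_diff[symmetric] by (simp add: algebra_simps)
      have "\<bar>f2 n x - f3 n x\<bar> \<le> sqrt (real (b n)) * (off_diag_mean (b n) (\<lambda>j k. \<bar>?d j k x\<bar>) + ?e)" for x
        unfolding eq abs_mult using abs_off_diag_mean_le[of "b n" "\<lambda>j k. ?d j k x"] c\<mu>
        proof (intro mult_mono)
          assume 1: "\<bar>off_diag_mean (b n) (\<lambda>j k. ?d j k x)\<bar> \<le> off_diag_mean (b n) (\<lambda>j k. \<bar>?d j k x\<bar>)"
            and 2: "\<bar>c n - \<mu>n n\<bar> \<le> ?e"
          show "\<bar>off_diag_mean (b n) (\<lambda>j k. ?d j k x) - (c n - \<mu>n n)\<bar> \<le> off_diag_mean (b n) (\<lambda>j k. \<bar>?d j k x\<bar>) + ?e"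
            by (rule order_trans[OF abs_triangle_ineq4 add_mono[OF 1 2]])
        qed simp_all
      moreover have int_odm: "integrable P (\<lambda>x. off_diag_mean (b n) (\<lambda>j k. \<bar>?d j k x\<bar>))"
        by (intro off_diag_mean_integral(2) integrable_abs int_h)
      ultimately have "(\<integral>x. \<bar>f2 n x - f3 n x\<bar> \<partial>P) \<le> (\<integral>x. sqrt (real (b n)) * (off_diag_mean (b n) (\<lambda>j k. \<bar>?d j k x\<bar>) + ?e) \<partial>P)"
        using int23 by (intro integral_mono) auto
      also have "\<dots> = sqrt (real (b n)) * ((\<integral>x. off_diag_mean (b n) (\<lambda>j k. \<bar>?d j k x\<bar>) \<partial>P) + ?e)"
        using int_odm by (simp add: prob_UNIV)
      also have "\<dots> \<le> sqrt (real (b n)) * (?e + ?e)"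
      proof (intro mult_left_mono add_right_mono)
        have "(\<integral>x. off_diag_mean (b n) (\<lambda>j k. \<bar>?d j k x\<bar>) \<partial>P) = off_diag_mean (b n) (\<lambda>j k. \<integral>x. \<bar>?d j k x\<bar> \<partial>P)"
          by (rule off_diag_mean_integral(1)) (intro integrable_abs int_h)
        then show "(\<integral>x. off_diag_mean (b n) (\<lambda>j k. \<bar>?d j k x\<bar>) \<partial>P) \<le> ?e"
          using off_diag_mean_le[OF e e0] by (rule ord_eq_le_trans)
      qed simp
      finally have "(\<integral>x. \<bar>f2 n x - f3 n x\<bar> \<partial>P) \<le> sqrt (real (b n)) * (?e + ?e)"
.
      then show ?case by (simp add: field_simps)
    qed
  qed
  have c2: "(\<lambda>n. char (distr P borel (f2 n)) t) \<longlonglongrightarrow> complex_of_real (exp (- (4 * gamma_sq h \<sigma>) * t\<^sup>2 / 2))"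
    by (rule P.char_limit_L1[OF _ _ int23 lim23 c3]) simp_all
  have d12: "(\<lambda>n. char (distr P borel (f1 n)) t - char (distr P borel (f2 n)) t) \<longlonglongrightarrow> 0"
  proof (rule Lim_null_comparison)
    show "(\<lambda>n. 2 * NB\<^sup>2 / a\<^sup>2 * (real (b n) / real (l n))) \<longlonglongrightarrow> 0"
      using tendsto_mult_left[OF bl, of "2 * NB\<^sup>2 / a\<^sup>2"] by simp
    show "\<forall>\<^sub>F n in sequentially. norm (char (distr P borel (f1 n)) t - char (distr P borel (f2 n)) t)
        \<le> 2 * NB\<^sup>2 / a\<^sup>2 * (real (b n) / real (l n))"
      using filterlim_at_top[THEN iffD1, OF l, rule_format, of 1]
    proof eventually_elim
      case (elim n)
      define A where "A = (\<Union>j\<in>{1..b n}. {x. a < norm (BM (l n) j x - v0)})"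
      have sets: "{x. a < norm (BM (l n) j x - v0)} \<in> P.events" for j
      proof -
        have "{x \<in> space P. a < norm (BM (l n) j x - v0)} \<in> P.events" by measurable
        then show ?thesis by simp
      qed
      have "norm (char (distr P borel (f1 n)) t - char (distr P borel (f2 n)) t) \<le> 2 * P.prob A"
      proof (rule P.char_diff_event)
        show "A \<in> P.events" unfolding A_def using sets by auto
        fix x assume "x \<notin> A"
        then have "g (BM (l n) j x) = G (BM (l n) j x)" if "j \<in> {1..b n}" for j
          using that by (intro gG) (auto simp: A_def not_less)
        then have "off_diag_mean (b n) (\<lambda>j k. h (sqrt (real (l n)) * g (BM (l n) j x), sqrt (real (l n)) * g (BM (l n) k x)))
            = off_diag_mean (b n) (\<lambda>j k. h (W (l n) j x, W (l n) k x))"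
          by (intro off_diag_mean_cong) (simp add: W_def)
        then show "f1 n x = f2 n x" by (simp add: f1_def f2_def)
      qed simp_all
      also have "P.prob A \<le> (\<Sum>j\<in>{1..b n}. P.prob {x. a < norm (BM (l n) j x - v0)})"
        unfolding A_def using sets by (intro P.finite_measure_subadditive_finite) auto
      also have "\<dots> \<le> (\<Sum>j\<in>{1..b n}. NB\<^sup>2 / (a\<^sup>2 * real (l n)))"
        using elim \<open>a > 0\<close> by (intro sum_mono prob_BM_far) auto
      finally show ?case by (simp add: field_simps)
    qed
  qed
  from tendsto_add[OF d12 c2] show ?thesis by (simp add: f1_def[abs_def] c_def)
qed

end

section \<open>Lipschitz cutoffs\<close>

lemma has_derivative_partial_deriv:
  fixes g :: "real^'m::finite \<Rightarrow> real"
  assumes "g differentiable (at x)"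
  shows "(g has_derivative (\<lambda>v. \<Sum>k\<in>UNIV. partial_deriv k g x * v $ k)) (at x)"
proof -
  obtain g' where g': "(g has_derivative g') (at x)" using assms unfolding differentiable_def by blast
  interpret g': bounded_linear g' by (rule has_derivative_bounded_linear[OF g'])
  have pd: "partial_deriv k g x = g' (axis k 1)" for k
  proof -
    have "((\<lambda>s :: real. x + s *\<^sub>R axis k 1) has_derivative (\<lambda>s. s *\<^sub>R axis k 1)) (at 0)"
      by (auto intro!: derivative_eq_intros)
    from has_derivative_compose[OF this, of g g'] g'
    have "((\<lambda>s. g (x + s *\<^sub>R axis k 1)) has_derivative (\<lambda>s. g' (s *\<^sub>R axis k 1))) (at 0)" by simp
    then have "((\<lambda>s. g (x + s *\<^sub>R axis k 1)) has_field_derivative g' (axis k 1)) (at 0)"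
      by (simp add: has_field_derivative_def g'.scaleR mult.commute[of _ "g' _"])
    then show ?thesis unfolding partial_deriv_def by (rule DERIV_imp_deriv)
  qed
  have "g' v = (\<Sum>k\<in>UNIV. partial_deriv k g x * v $ k)" for v
  proof -
    have "v = (\<Sum>k\<in>UNIV. v $ k *\<^sub>R axis k 1)"
      using basis_expansion[of v] by (simp add: scalar_mult_eq_scaleR)
    then have "g' v = g' (\<Sum>k\<in>UNIV. v $ k *\<^sub>R axis k 1)" by simp
    also have "\<dots> = (\<Sum>k\<in>UNIV. partial_deriv k g x * v $ k)"
      by (simp add: g'.sum g'.scaleR pd mult.commute)
    finally show ?thesis .
  qed
  then have eq: "g' = (\<lambda>v. \<Sum>k\<in>UNIV. partial_deriv k g x * v $ k)" by (rule ext)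
  from g' show ?thesis unfolding eq .
qed

lemma lipschitz_from_gradient:
  fixes g :: "real^'m::finite \<Rightarrow> real"
  assumes "convex S" and diff: "\<And>x. x \<in> S \<Longrightarrow> g differentiable (at x)"
    and bd: "\<And>x. x \<in> S \<Longrightarrow> norm (gradient g x) \<le> B" and "x \<in> S" "y \<in> S"
  shows "\<bar>g x - g y\<bar> \<le> B * norm (x - y)"
proof -
  define D where "D z = (\<lambda>v. \<Sum>k\<in>UNIV. partial_deriv k g z * v $ k)" for z
  have "norm (g x - g y) \<le> B * norm (x - y)"
  proof (rule differentiable_bound[where f'=D and S=S])
    fix z assume z: "z \<in> S"
    show "(g has_derivative D z) (at z within S)"
      unfolding D_def by (rule has_derivative_at_withinI[OF has_derivative_partial_deriv[OF diff[OF z]]])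
    show "onorm (D z) \<le> B"
      unfolding D_def
    proof (rule onorm_le)
      fix v :: "real^'m"
      have eq: "(\<Sum>k\<in>UNIV. partial_deriv k g z * v $ k) = inner (gradient g z) v"
        by (simp add: inner_vec_def gradient_def)
      have "norm (\<Sum>k\<in>UNIV. partial_deriv k g z * v $ k) \<le> norm (gradient g z) * norm v"
        unfolding eq real_norm_def by (rule Cauchy_Schwarz_ineq2)
      also have "\<dots> \<le> B * norm v" by (intro mult_right_mono bd z) simp
      finally show "norm (\<Sum>k\<in>UNIV. partial_deriv k g z * v $ k) \<le> B * norm v" .
    qed
  qed (use assms in auto)
  then show ?thesis by simp
qed

text \<open>The partial derivatives are continuous, hence bounded on the closed ball, and vanish
  outside it because the function is locally 0 there.\<close>

lemma smooth_bump_lipschitz: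
  fixes \<eta> :: "real^'m::finite \<Rightarrow> real"
  assumes "smooth \<eta>" and zero: "\<And>x. norm (x - v0) > R \<Longrightarrow> \<eta> x = 0"
  shows "\<exists>K. \<forall>x y. \<bar>\<eta> x - \<eta> y\<bar> \<le> K * norm (x - y)"
proof -
  have diff: "\<eta> differentiable (at x)" for x
    using assms(1)[unfolded smooth_def, rule_format, of "[]" x] by simp
  have diff1: "partial_deriv k \<eta> differentiable (at x)" for k x
    using assms(1)[unfolded smooth_def, rule_format, of "[k]" x] by simp
  have "\<exists>B. \<forall>x. \<bar>partial_deriv k \<eta> x\<bar> \<le> B" for k
  proof -
    have "continuous_on (cball v0 R) (partial_deriv k \<eta>)"
      using diff1 by (intro continuous_at_imp_continuous_on ballI differentiable_imp_continuous_within)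
    then have "bounded (partial_deriv k \<eta> ` cball v0 R)"
      by (intro compact_imp_bounded compact_continuous_image) auto
    then obtain B where "\<forall>y\<in>partial_deriv k \<eta> ` cball v0 R. norm y \<le> B"
      unfolding bounded_iff by blast
    then have B: "\<bar>partial_deriv k \<eta> x\<bar> \<le> B" if "x \<in> cball v0 R" for x
      using that by fastforce
    have "\<bar>partial_deriv k \<eta> x\<bar> \<le> \<bar>B\<bar>" for x
    proof (cases "x \<in> cball v0 R")
      case True
      then show ?thesis using B[of x] by linarith
    next
      case False
      have "((\<lambda>s :: real. x + s *\<^sub>R axis k 1) \<longlongrightarrow> x + 0 *\<^sub>R axis k 1) (nhds 0)"
        by (intro tendsto_intros filterlim_ident)
      then have "((\<lambda>s :: real. x + s *\<^sub>R axis k 1) \<longlongrightarrow> x) (nhds 0)" by simp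
      from topological_tendstoD[OF this, of "- cball v0 R"] False
      have "\<forall>\<^sub>F s in nhds 0. x + s *\<^sub>R axis k 1 \<in> - cball v0 R" by auto
      then have "\<forall>\<^sub>F s in nhds 0. \<eta> (x + s *\<^sub>R axis k 1) = 0"
        by eventually_elim (auto intro!: zero simp: dist_norm norm_minus_commute)
      then have "partial_deriv k \<eta> x = deriv (\<lambda>s. 0) 0"
        unfolding partial_deriv_def by (intro deriv_cong_ev) auto
      then show ?thesis by simp
    qed
    then show ?thesis by blast
  qed
  then obtain B where B: "\<And>k x. \<bar>partial_deriv k \<eta> x\<bar> \<le> B k" by metis
  have "\<bar>\<eta> x - \<eta> y\<bar> \<le> (\<Sum>k\<in>UNIV. B k) * norm (x - y)" for x y
  proof (rule lipschitz_from_gradient[of UNIV])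
    fix z
    have "norm (gradient \<eta> z) \<le> (\<Sum>k\<in>UNIV. \<bar>gradient \<eta> z $ k\<bar>)" by (rule norm_le_l1_cart)
    also have "\<dots> \<le> (\<Sum>k\<in>UNIV. B k)" by (intro sum_mono) (simp add: gradient_def B)
    finally show "norm (gradient \<eta> z) \<le> (\<Sum>k\<in>UNIV. B k)" .
  qed (simp_all add: diff)
  then show ?thesis by blast
qed

text \<open>The product rule for differences, g x (\<eta> x - \<eta> y) + (g x - g y) \<eta> y. It
  works as soon as one point, called x, lies in the ball where g is bounded and Lipschitz, since
  \<eta> y is 0 when y does not.\<close>

lemma cutoff_lipschitz:
  fixes g \<eta> :: "real^'m::finite \<Rightarrow> real"
  assumes "R > 0" and diff: "\<And>x. x \<in> ball v0 R \<Longrightarrow> g differentiable (at x)"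
    and bdd: "\<And>x. x \<in> ball v0 R \<Longrightarrow> norm (gradient g x) \<le> B" and "g v0 = 0"
    and \<eta>: "smooth \<eta>" "\<And>x. 0 \<le> \<eta> x \<and> \<eta> x \<le> 1" and zero: "\<And>x. norm (x - v0) > R \<Longrightarrow> \<eta> x = 0"
  shows "\<exists>L. \<forall>x y. \<bar>g x * \<eta> x - g y * \<eta> y\<bar> \<le> L * norm (x - y)"
proof -
  obtain K where K: "\<And>x y. \<bar>\<eta> x - \<eta> y\<bar> \<le> K * norm (x - y)"
    using smooth_bump_lipschitz[OF \<eta>(1) zero] by blast
  have B: "B \<ge> 0" using bdd[of v0] \<open>R > 0\<close> norm_ge_zero[of "gradient g v0"] by (auto simp del: norm_ge_zero)
  have gl: "\<bar>g x - g y\<bar> \<le> B * norm (x - y)" if "x \<in> ball v0 R" "y \<in> ball v0 R" for x y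
    by (rule lipschitz_from_gradient[OF convex_ball diff bdd that])
  have gb: "\<bar>g x\<bar> \<le> B * R" if "x \<in> ball v0 R" for x
  proof -
    have "\<bar>g x\<bar> \<le> B * norm (x - v0)" using gl[OF that, of v0] \<open>R > 0\<close> \<open>g v0 = 0\<close> by simp
    also have "\<dots> \<le> B * R" using that B by (intro mult_left_mono) (auto simp: dist_norm norm_minus_commute)
    finally show ?thesis .
  qed
  \<comment> \<open>The hypothesis says nothing about the sphere of radius R, where g is not
    controlled either. There \<eta> vanishes by continuity, as seen from a point slightly further
    out on the same ray.\<close>
  have zero': "\<eta> x = 0" if x: "x \<notin> ball v0 R" for x
  proof (rule ccontr)
    assume nz: "\<eta> x \<noteq> 0"
    then have "norm (x - v0) \<le> R" using zero[of x] by force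
    with x have nx: "norm (x - v0) = R" by (simp add: dist_norm norm_minus_commute)
    define c where "c = \<bar>K\<bar> + 1"
    have c: "c > 0" by (simp add: c_def)
    \<comment> \<open>With this \<delta> the Lipschitz bound between x and the point further out
      gives |\<eta> x| <= |\<eta> x| / 2.\<close>
    define \<delta> where "\<delta> = \<bar>\<eta> x\<bar> / (2 * c * R)"
    have \<delta>: "\<delta> > 0" using nz \<open>R > 0\<close> c by (simp add: \<delta>_def)
    define y where "y = x + \<delta> *\<^sub>R (x - v0)"
    have "y - v0 = (1 + \<delta>) *\<^sub>R (x - v0)" by (simp add: y_def algebra_simps)
    then have "norm (y - v0) = (1 + \<delta>) * R" using nx \<delta> by simp
    also have "\<dots> > R" using \<delta> \<open>R > 0\<close> by simp
    finally have "\<eta> y = 0" by (rule zero)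
    then have "\<bar>\<eta> x\<bar> \<le> K * norm (x - y)" using K[of x y] by simp
    also have "\<dots> \<le> c * norm (x - y)" by (intro mult_right_mono) (auto simp: c_def)
    also have "norm (x - y) = \<delta> * R" using nx \<delta> by (simp add: y_def)
    also have "c * (\<delta> * R) = \<bar>\<eta> x\<bar> / 2"
      using \<open>R > 0\<close> c by (simp add: \<delta>_def field_simps)
    finally show False using nz by simp
  qed
  define L where "L = B + B * R * \<bar>K\<bar>"
  have half: "\<bar>g x * \<eta> x - g y * \<eta> y\<bar> \<le> L * norm (x - y)" if x: "x \<in> ball v0 R" for x y
  proof -
    have "\<bar>g x\<bar> * \<bar>\<eta> x - \<eta> y\<bar> \<le> (B * R) * (\<bar>K\<bar> * norm (x - y))"
    proof (intro mult_mono gb x)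
      have "K * norm (x - y) \<le> \<bar>K\<bar> * norm (x - y)" by (intro mult_right_mono) auto
      then show "\<bar>\<eta> x - \<eta> y\<bar> \<le> \<bar>K\<bar> * norm (x - y)" using K[of x y] by linarith
    qed (use B \<open>R > 0\<close> in auto)
    moreover have "\<bar>g x - g y\<bar> * \<bar>\<eta> y\<bar> \<le> B * norm (x - y)"
    proof (cases "y \<in> ball v0 R")
      case True
      have "\<bar>g x - g y\<bar> * \<bar>\<eta> y\<bar> \<le> (B * norm (x - y)) * 1"
        using \<eta>(2)[of y] B by (intro mult_mono gl x True) auto
      then show ?thesis by simp
    qed (simp add: zero' B)
    moreover have "g x * \<eta> x - g y * \<eta> y = g x * (\<eta> x - \<eta> y) + (g x - g y) * \<eta> y" by (simp add: algebra_simps)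
    then have "\<bar>g x * \<eta> x - g y * \<eta> y\<bar> \<le> \<bar>g x\<bar> * \<bar>\<eta> x - \<eta> y\<bar> + \<bar>g x - g y\<bar> * \<bar>\<eta> y\<bar>"
      using abs_triangle_ineq[of "g x * (\<eta> x - \<eta> y)" "(g x - g y) * \<eta> y"] by (simp add: abs_mult)
    ultimately show ?thesis by (simp add: L_def algebra_simps)
  qed
  have "\<bar>g x * \<eta> x - g y * \<eta> y\<bar> \<le> L * norm (x - y)" for x y
  proof (cases "x \<in> ball v0 R \<or> y \<in> ball v0 R")
    case True
    then show ?thesis using half[of x y] half[of y x] by (auto simp: norm_minus_commute abs_minus_commute)
  next
    case False
    then show ?thesis using B \<open>R > 0\<close> by (simp add: zero' L_def)
  qed
  then show ?thesis by blast
qed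

lemma lip_kernelI:
  assumes "C-lipschitz_on UNIV h" "\<forall>x y. h (x, y) = h (y, x)"
  shows "lip_kernel h C"
proof
  fix a b c d :: real
  have "\<bar>h (a, b) - h (c, d)\<bar> \<le> C * dist (a, b) (c, d)"
    using lipschitz_onD[OF assms(1), of "(a, b)" "(c, d)"] by (simp add: dist_real_def)
  also have "\<dots> \<le> C * (\<bar>a - c\<bar> + \<bar>b - d\<bar>)"
  proof (rule mult_left_mono)
    show "dist (a, b) (c, d) \<le> \<bar>a - c\<bar> + \<bar>b - d\<bar>"
      using sqrt_sum_squares_le_sum_abs[of "a - c" "b - d"] by (simp add: dist_prod_def dist_real_def)
  qed (use lipschitz_on_nonneg[OF assms(1)] in simp)
  finally show "\<bar>h (a, b) - h (c, d)\<bar> \<le> C * (\<bar>a - c\<bar> + \<bar>b - d\<bar>)" .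
  show "h (a, b) = h (b, a)" using assms(2) by blast
qed

lemma summable_inverse_square: "summable (\<lambda>r. D / (real r + 1)\<^sup>2)"
proof -
  have "summable (\<lambda>r. inverse (real (Suc r) ^ 2))"
    by (subst summable_Suc_iff) (rule inverse_power_summable, simp)
  from summable_mult[OF this, of D] show ?thesis
    by (simp add: divide_inverse add.commute)
qed

theorem theorem2:
  fixes M :: "'w measure"
    and eps :: "int \<Rightarrow> 'w \<Rightarrow> real"
    and f :: "(int \<Rightarrow> real) \<Rightarrow> real"
    and X :: "int \<Rightarrow> 'w \<Rightarrow> real"
    and m :: nat
    and idx :: "'m::finite \<Rightarrow> nat"
    and h :: "real \<times> real \<Rightarrow> real"
    and g \<eta> :: "real^'m \<Rightarrow> real"
    and v0 :: "real^'m"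
    and a \<sigma> :: real
    and b l :: "nat \<Rightarrow> nat"
  assumes "prob_space M"
    and "iid_real M eps"
    and "f \<in> borel_measurable (\<Pi>\<^sub>M u\<in>UNIV. borel)"
    and "X = bernoulli_shift f eps"
    and "m \<ge> 1" and "bij_betw idx UNIV {1..m}"
    and "\<forall>x y. h (x, y) = h (y, x)"
    and "g \<in> borel_measurable borel"
    and "\<forall>n\<ge>1. b n \<ge> 1" and "\<forall>n\<ge>1. l n \<ge> 1"
    and "\<exists>L. L-lipschitz_on UNIV h"
    and "integrable M (\<lambda>w. X 1 w ^ (2 * m))"
    and "(\<lambda>i::int. \<Sum>k=1..m. (real_of_int i)\<^sup>2 * dep_coeff M (\<lambda>x. f x ^ k) eps i)
           summable_on UNIV"
    and "v0 = (\<chi> k. \<integral>w. X 1 w ^ idx k \<partial>M)"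
    and "g v0 = 0"
    and "a > 0"
    and "\<forall>x \<in> {x. \<forall>k. v0 $ k - 2 * a < x $ k \<and> x $ k < v0 $ k + 2 * a}.
           g differentiable (at x)"
    and "bounded (gradient g ` {x. \<forall>k. v0 $ k - 2 * a < x $ k \<and> x $ k < v0 $ k + 2 * a})"
    and "filterlim b at_top sequentially" and "filterlim l at_top sequentially"
    and "(\<lambda>n. real (b n) / real (l n)) \<longlonglongrightarrow> 0"
    and "smooth \<eta>" and "\<forall>x. 0 \<le> \<eta> x \<and> \<eta> x \<le> 1"
    and "\<forall>x. norm (x - v0) \<le> a \<longrightarrow> \<eta> x = 1"
    and "\<forall>x. norm (x - v0) > 2 * a \<longrightarrow> \<eta> x = 0"
    and "long_run_var M g v0 idx X > 0"
    and "\<sigma> = sqrt (long_run_var M g v0 idx X)"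
  shows "weak_conv_m
           (\<lambda>n. distr M borel (\<lambda>w. sqrt (real (b n)) *
              (off_diag_mean (b n)
                 (\<lambda>j k. h (block_stat g idx X (l n) j w, block_stat g idx X (l n) k w))
               - off_diag_mean (b n)
                 (\<lambda>j k. \<integral>z. h (block_stat (\<lambda>x. g x * \<eta> x) idx X (l n) j z,
                                block_stat (\<lambda>x. g x * \<eta> x) idx X (l n) k z) \<partial>M))))
           (centred_normal (4 * gamma_sq h \<sigma>))"
proof -
  interpret M: prob_space M by (rule assms(1))
  define \<mu> where "\<mu> = distr M borel (eps 0)"
  have indep: "M.indep_vars (\<lambda>_. borel) eps UNIV" and law: "distr M borel (eps u) = \<mu>" for u
    using assms(2) unfolding iid_real_def \<mu>_def by simp_all
  have eps_meas [measurable]: "eps u \<in> borel_measurable M" for u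
    using indep by (auto simp: M.indep_vars_def)
  have "prob_space \<mu>" "sets \<mu> = sets borel"
    unfolding \<mu>_def by (rule M.prob_space_distr) simp_all
  then interpret noise \<mu> by (rule noise.intro)
  define E where "E w = (\<lambda>u. eps u w)" for w
  have E_meas [measurable]: "E \<in> measurable M P"
    by (rule measurable_into_P) (simp add: E_def)
  have E_law: "distr M P E = P"
  proof -
    have "distr M P E = distr M (PiM UNIV (\<lambda>_. borel)) (\<lambda>w. \<lambda>u\<in>UNIV. eps u w)"
      by (rule distr_cong) (auto simp: sets_P E_def)
    also have "\<dots> = PiM UNIV (\<lambda>u. distr M borel (eps u))"
      using M.indep_vars_iff_distr_eq_PiM[of UNIV eps "\<lambda>_. borel"] indep by simp
    also have "\<dots> = P" by (simp add: law P_def)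
    finally show ?thesis .
  qed
  have int_E: "(\<integral>w. \<phi> (E w) \<partial>M) = (\<integral>x. \<phi> x \<partial>P)" if "\<phi> \<in> borel_measurable P" for \<phi> :: "_ \<Rightarrow> real"
    using integral_distr[OF E_meas that] by (simp add: E_law)
  \<comment> \<open>Reflecting the index turns the convolution-type argument t - u into a
    translation, so that X_t becomes \<open>F1\<close> composed with \<open>shift t\<close>.\<close>
  define F1 where "F1 x = f (\<lambda>u. x (- u))" for x
  have F1_meas [measurable]: "F1 \<in> borel_measurable P"
  proof -
    have "(\<lambda>x u. x (- u)) \<in> measurable P (PiM UNIV (\<lambda>_. borel))"
      by (rule measurable_PiM_single') auto
    from measurable_compose[OF this assms(3)] show ?thesis by (simp add: F1_def[abs_def])
  qed
  have X: "X t w = F1 (shift t (E w))" for t w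
    by (simp add: assms(4) bernoulli_shift_def F1_def shift_def E_def)
  have idx: "idx k \<in> {1..m}" for k
    using assms(6) by (auto simp: bij_betw_def)
  define F where "F k x = F1 x ^ idx k" for k x
  have F_meas [measurable]: "F k \<in> borel_measurable P" for k unfolding F_def by simp
  have F_L2: "L2 P (F k)" for k
  proof -
    have "integrable M (\<lambda>w. F1 (shift 1 (E w)) ^ (2 * m))" using assms(12) by (simp add: X)
    then have "integrable P (\<lambda>x. F1 (shift 1 x) ^ (2 * m))"
      using integrable_distr_eq[OF E_meas, of "\<lambda>x. F1 (shift 1 x) ^ (2 * m)"] by (simp add: E_law)
    then have int: "integrable P (\<lambda>x. F1 x ^ (2 * m))"
      using integrable_distr_eq[OF measurable_shift, of "\<lambda>x. F1 x ^ (2 * m)" 1] by (simp add: distr_shift)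
    have "integrable P (\<lambda>x. 1 + F1 x ^ (2 * m))" using int by simp
    then have "integrable P (\<lambda>x. (F k x)\<^sup>2)"
    proof (rule Bochner_Integration.integrable_bound)
      show "AE x in P. norm ((F k x)\<^sup>2) \<le> norm (1 + F1 x ^ (2 * m))"
      proof (rule AE_I2)
        fix x
        define z where "z = (F1 x)\<^sup>2"
        have z: "z \<ge> 0" by (simp add: z_def)
        \<comment> \<open>No coordinate carries a power higher than m, so the moment of order 2 m
          makes all of them square integrable.\<close>
        have "z ^ idx k \<le> 1 + z ^ m"
        proof (cases "z \<le> 1")
          case True
          then have "z ^ idx k \<le> 1" using z by (simp add: power_le_one)
          moreover have "0 \<le> z ^ m" using z by simp
          ultimately show ?thesis by linarith
        next
          case False
          then have "z ^ idx k \<le> z ^ m" using idx[of k] by (intro power_increasing) auto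
          then show ?thesis by simp
        qed
        moreover have "(F k x)\<^sup>2 = z ^ idx k" "F1 x ^ (2 * m) = z ^ m"
          by (simp_all add: F_def z_def power_mult[symmetric] mult.commute)
        ultimately show "norm ((F k x)\<^sup>2) \<le> norm (1 + F1 x ^ (2 * m))" using z by simp
      qed
    qed simp
    then show ?thesis by (simp add: L2_def)
  qed
  define \<delta> where "\<delta> k i = dep_coeff M (\<lambda>x. f x ^ k) eps i" for k i
  have \<delta>_nonneg: "\<delta> k i \<ge> 0" for k i by (simp add: \<delta>_def dep_coeff_def Let_def)
  \<comment> \<open>\<open>mix (- {i})\<close> replaces just the noise variable i by the copy, as
    \<open>dep_coeff\<close> does. The map \<open>E\<close> on both factors carries the product of
    \<open>M\<close> with itself to the product of \<open>P\<close> with itself, so the two norms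
    are equal.\<close>
  have coupling: "nrm (P \<Otimes>\<^sub>M P) (\<lambda>z. F k (fst z) - F k (mix (- {i}) (fst z) (snd z))) = \<delta> (idx k) i" for k i
  proof -
    interpret PE: prob_space "distr M P E" by (rule M.prob_space_distr) simp
    have D: "distr (M \<Otimes>\<^sub>M M) (P \<Otimes>\<^sub>M P) (\<lambda>(w, w'). (E w, E w')) = P \<Otimes>\<^sub>M P"
      using pair_measure_distr[OF E_meas E_meas PE.sigma_finite_measure_axioms] by (simp add: E_law)
    have "nrm (distr (M \<Otimes>\<^sub>M M) (P \<Otimes>\<^sub>M P) (\<lambda>(w, w'). (E w, E w'))) (\<lambda>z. F k (fst z) - F k (mix (- {i}) (fst z) (snd z)))
        = nrm (M \<Otimes>\<^sub>M M) (\<lambda>p. F k (E (fst p)) - F k (mix (- {i}) (E (fst p)) (E (snd p))))"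
      by (subst nrm_distr) (auto simp: case_prod_unfold)
    also have "\<dots> = \<delta> (idx k) i"
    proof -
      have "(\<lambda>u. mix (- {i}) (E w) (E w') (- u)) = (\<lambda>u. if - u = i then eps i w' else eps (- u) w)" for w w'
        by (auto simp: mix_def E_def)
      then show ?thesis
        by (simp add: nrm_def \<delta>_def dep_coeff_def Let_def F_def F1_def bernoulli_shift_def E_def case_prod_unfold)
    qed
    finally show ?thesis by (simp add: D)
  qed
  \<comment> \<open>One constant serves all coordinates, because the summand of a single power is at
    most the sum over all powers.\<close>
  define D where "D = (\<Sum>\<^sub>\<infinity>i. \<Sum>k=1..m. (real_of_int i)\<^sup>2 * \<delta> k i)"
  define \<tau> where "\<tau> r = D / (real r + 1)\<^sup>2" for r :: nat
  have wdep_F: "wdep \<tau> (F k)" for k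
    unfolding \<tau>_def
  proof (rule wdep_from_coupling[OF F_L2])
    show "nrm (P \<Otimes>\<^sub>M P) (\<lambda>z. F k (fst z) - F k (mix (- {i}) (fst z) (snd z))) \<le> \<delta> (idx k) i" for i
      by (simp add: coupling)
    fix I :: "int set" assume "finite I"
    have "(\<Sum>i\<in>I. (real_of_int i)\<^sup>2 * \<delta> (idx k) i) \<le> (\<Sum>i\<in>I. \<Sum>k=1..m. (real_of_int i)\<^sup>2 * \<delta> k i)"
      using idx[of k] \<delta>_nonneg
      by (intro sum_mono member_le_sum[of "idx k" "{1..m}" "\<lambda>k. (real_of_int _)\<^sup>2 * \<delta> k _"]) auto
    also have "\<dots> \<le> D"
      unfolding D_def using assms(13) \<open>finite I\<close> \<delta>_nonneg
      by (intro finite_sum_le_infsum) (auto simp: \<delta>_def[symmetric] intro!: sum_nonneg)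
    finally show "(\<Sum>i\<in>I. (real_of_int i)\<^sup>2 * \<delta> (idx k) i) \<le> D" .
  qed
  have v0: "v0 $ k = (\<integral>x. F k x \<partial>P)" for k
    using int_E[of "\<lambda>x. F k (shift 1 x)"] integral_shift[OF F_meas, of k 1]
    by (simp add: assms(14) X F_def)
  \<comment> \<open>The cutoff lives on Euclidean balls while differentiability is assumed on a
    cube; the ball of radius 2 a fits inside.\<close>
  have in_box: "x \<in> {x. \<forall>k. v0 $ k - 2 * a < x $ k \<and> x $ k < v0 $ k + 2 * a}" if "x \<in> ball v0 (2 * a)" for x
  proof -
    have "\<bar>(x - v0) $ k\<bar> < 2 * a" for k
      using component_le_norm_cart[of "x - v0" k] that by (simp add: dist_norm norm_minus_commute)
    then have "\<bar>x $ k - v0 $ k\<bar> < 2 * a" for k by simp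
    then have "v0 $ k - 2 * a < x $ k \<and> x $ k < v0 $ k + 2 * a" for k
      unfolding abs_less_iff by (simp add: algebra_simps)
    then show ?thesis by blast
  qed
  have g_diff: "g differentiable (at x)" if "x \<in> ball v0 (2 * a)" for x
    using assms(17) in_box[OF that] by blast
  obtain B where B: "norm (gradient g x) \<le> B" if "x \<in> ball v0 (2 * a)" for x
    using assms(18) in_box unfolding bounded_iff by blast
  define G where "G x = g x * \<eta> x" for x
  obtain L where L: "\<bar>G x - G y\<bar> \<le> L * norm (x - y)" for x y
    using cutoff_lipschitz[of "2 * a" v0 g B \<eta>] g_diff B assms(15,16,22,23,25) unfolding G_def by auto
  have gG: "g x = G x" if "norm (x - v0) \<le> a" for x
    using assms(24) that by (simp add: G_def)
  define d where "d k = partial_deriv k g v0" for k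
  \<comment> \<open>The cutoff equals 1 near \<open>v0\<close>, so \<open>G\<close> and
    \<open>g\<close> agree there and share the derivative.\<close>
  have G_deriv: "(G has_derivative (\<lambda>v. \<Sum>k\<in>UNIV. d k * v $ k)) (at v0)"
  proof (rule has_derivative_transform_within[where d=a])
    show "(g has_derivative (\<lambda>v. \<Sum>k\<in>UNIV. d k * v $ k)) (at v0)"
      unfolding d_def using assms(16) by (intro has_derivative_partial_deriv g_diff) simp
    show "g x = G x" if "dist x v0 < a" for x using that by (intro gG) (simp add: dist_norm)
  qed (use assms(16) in auto)
  define Y where "Y x = (\<Sum>k\<in>UNIV. d k * (F k x - v0 $ k))" for x
  have Y_L2: "L2 P Y"
    unfolding Y_def[abs_def] by (intro L2_sum L2_cmult L2_diff F_L2 P.L2_const)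
  have Y_meas [measurable]: "Y \<in> borel_measurable P" using Y_L2 by (rule L2_measurable)
  have cov: "covariance M (\<lambda>w. \<Sum>k\<in>UNIV. partial_deriv k g v0 * X 0 w ^ idx k)
      (\<lambda>w. \<Sum>k\<in>UNIV. partial_deriv k g v0 * X t w ^ idx k) = (\<integral>x. Y x * Y (shift t x) \<partial>P)" for t
  proof -
    have mean: "(\<integral>w. (\<Sum>k\<in>UNIV. partial_deriv k g v0 * X s w ^ idx k) \<partial>M) = (\<Sum>k\<in>UNIV. d k * v0 $ k)" for s
    proof -
      have "(\<integral>w. (\<Sum>k\<in>UNIV. partial_deriv k g v0 * X s w ^ idx k) \<partial>M) = (\<integral>x. (\<Sum>k\<in>UNIV. d k * F k (shift s x)) \<partial>P)"
        using int_E[of "\<lambda>x. \<Sum>k\<in>UNIV. d k * F k (shift s x)"] by (simp add: X F_def d_def)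
      also have "\<dots> = (\<Sum>k\<in>UNIV. d k * v0 $ k)"
        using P.L2_integrable[OF L2_shift[OF F_L2]] by (simp add: integral_shift v0)
      finally show ?thesis .
    qed
    have centred: "(\<Sum>k\<in>UNIV. partial_deriv k g v0 * X s w ^ idx k) - (\<Sum>k\<in>UNIV. d k * v0 $ k) = Y (shift s (E w))" for s w
      by (simp add: Y_def X F_def d_def right_diff_distrib sum_subtractf)
    have "shift 0 x = x" for x :: "int \<Rightarrow> real" by (simp add: shift_def)
    then show ?thesis
      unfolding covariance_def mean centred using int_E[of "\<lambda>x. Y x * Y (shift t x)"] by simp
  qed
  define s where "s = long_run_var M g v0 idx X"
  have s_eq: "s = (\<Sum>\<^sub>\<infinity>t. \<integral>x. Y x * Y (shift t x) \<partial>P)"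
    unfolding s_def long_run_var_def cov ..
  have s_pos: "s > 0" using assms(26) by (simp add: s_def)
  \<comment> \<open>\<open>infsum\<close> of a non-summable family is 0, so a positive value forces
    the covariances to be summable.\<close>
  have "(\<lambda>t. \<integral>x. Y x * Y (shift t x) \<partial>P) summable_on UNIV"
    using s_pos infsum_not_exists[of "\<lambda>t. \<integral>x. Y x * Y (shift t x) \<partial>P" UNIV] unfolding s_eq by fastforce
  from nsum_variance_limit[OF Y_L2 this]
  have lrv: "(\<lambda>l. \<integral>x. (nsum Y l x)\<^sup>2 \<partial>P) \<longlonglongrightarrow> s" unfolding s_eq .
  interpret B: block_means \<mu> F \<tau> v0 G L d s
    using wdep_F summable_inverse_square[of D] v0 L G_deriv lrv assms(15)
    by unfold_locales (auto simp: \<tau>_def[abs_def] G_def Y_def[abs_def])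
  obtain Lh where "Lh-lipschitz_on UNIV h" using assms(11) by blast
  then have lk: "lip_kernel h Lh" using assms(7) by (rule lip_kernelI)
  interpret h: lip_kernel h Lh by (rule lk)
  have \<sigma>: "s = \<sigma>\<^sup>2" using assms(27) s_pos by (simp add: s_def)
  have moments: "block_moments idx X l' j w = B.BM l' j (E w)" for l' j w
    by (simp add: block_moments_def B.BM_def X F_def)
  define Z where "Z n x = sqrt (real (b n)) *
      (off_diag_mean (b n) (\<lambda>j k. h (sqrt (real (l n)) * g (B.BM (l n) j x), sqrt (real (l n)) * g (B.BM (l n) k x)))
       - off_diag_mean (b n) (\<lambda>j k. \<integral>z. h (B.W (l n) j z, B.W (l n) k z) \<partial>P))" for n x
  have Z_meas [measurable]: "Z n \<in> borel_measurable P" for n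
  proof -
    have "(\<lambda>x. h (sqrt (real (l n)) * g (B.BM (l n) j x), sqrt (real (l n)) * g (B.BM (l n) k x))) \<in> borel_measurable P" for j k
      using assms(8) by (intro h.h_measurable) simp_all
    then show ?thesis
      unfolding Z_def[abs_def] off_diag_mean_def case_prod_beta
      by (intro borel_measurable_times borel_measurable_diff borel_measurable_const borel_measurable_sum)
  qed
  \<comment> \<open>The expectations in the theorem are taken with the cutoff, so they are those of
    \<open>B.W\<close> and can be transported as a whole.\<close>
  have centre: "(\<integral>z. h (block_stat (\<lambda>x. g x * \<eta> x) idx X (l n) j z, block_stat (\<lambda>x. g x * \<eta> x) idx X (l n) k z) \<partial>M)
      = (\<integral>x. h (B.W (l n) j x, B.W (l n) k x) \<partial>P)" for n j k
    unfolding block_stat_def moments G_def[symmetric]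
    using int_E[of "\<lambda>x. h (B.W (l n) j x, B.W (l n) k x)"] by (simp add: B.W_def)
  have "(\<lambda>w. sqrt (real (b n)) *
              (off_diag_mean (b n)
                 (\<lambda>j k. h (block_stat g idx X (l n) j w, block_stat g idx X (l n) k w))
               - off_diag_mean (b n)
                 (\<lambda>j k. \<integral>z. h (block_stat (\<lambda>x. g x * \<eta> x) idx X (l n) j z,
                                block_stat (\<lambda>x. g x * \<eta> x) idx X (l n) k z) \<partial>M))) = (\<lambda>w. Z n (E w))" for n
    unfolding centre unfolding Z_def block_stat_def moments ..
  moreover have "distr M borel (\<lambda>w. Z n (E w)) = distr P borel (Z n)" for n
    using distr_distr[OF Z_meas E_meas, of n] by (simp add: E_law comp_def)
  moreover have "weak_conv_m (\<lambda>n. distr P borel (Z n)) (centred_normal (4 * gamma_sq h \<sigma>))"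
  proof -
    \<comment> \<open>Nonnegative as four times the integral of a square;
      \<open>centred_normal\<close> can then be written as a scaled standard normal, the point mass
      included.\<close>
    have \<gamma>: "4 * gamma_sq h \<sigma> \<ge> 0" by (simp add: h.gamma_sq_eq)
    show ?thesis
      unfolding centred_normal_eq_gauss[OF \<gamma>]
    proof (rule levy_continuity[OF _ real_distribution_gauss])
      show "real_distribution (distr P borel (Z n))" for n by (rule P.real_distribution_distr) simp
      show "(\<lambda>n. char (distr P borel (Z n)) t) \<longlonglongrightarrow> char (real_gauss (sqrt (4 * gamma_sq h \<sigma>))) t" for t
        using B.block_ustat_char[OF lk \<sigma> assms(19,20,21,8,16) gG, of t] \<gamma>
        by (simp only: char_gauss Z_def[abs_def] real_sqrt_pow2)
    qed
  qed
  ultimately show ?thesis by simp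
qed

end
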